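(* The $\mathbb{R}_+$-action on $\Pi_*$, together with the quotient map $\Pi_*\to\Pi_*/\mathbb{R}_+$, is a locally trivial principal $\mathbb{R}_+$-bundle, and this bundle is nontrivial.
   Context: mm-spaces are triples $(X,d_X,\mu_X)$ with $(X,d_X)$ complete separable metric and $\mu_X$ a Borel probability measure, assumed to satisfy $X=\operatorname{supp}\mu_X$. $\mathcal{X}$ is the set of mm-isomorphism classes, where isomorphisms are measure-preserving isometries of supports. The box distance $\square$ is the metric on $\mathcal{X}$ defined as follows: $\square(X,Y)$ is the infimum of $\varepsilon\ge0$ such that there exist Borel maps $\varphi\colon[0,1)\to X$, $\psi\colon[0,1)\to Y$ pushing Lebesgue measure to $\mu_X,\mu_Y$ and a Borel $I_0$ of measure $\ge1-\varepsilon$ with $|d_X(\varphi(s),\varphi(t))-d_Y(\psi(s),\psi(t))|\le\varepsilon$ for all $s,t\in I_0$. Lipschitz order: $Y\prec X$ if there is a 1-Lipschitz $f\colon X\to Y$ with $f_*\mu_X=\mu_Y$. A pyramid is a subset $\mathcal{P}\subset\mathcal{X}$ such that: (1) $X\in\mathcal{P}$ and $Y\prec X$ imply $Y\in\mathcal{P}$; (2) for $Y,Y'\in\mathcal{P}$ there is $X\in\mathcal{P}$ with $Y\prec X$ and $Y'\prec X$; (3) $\mathcal{P}$ is nonempty and $\square$-closed. $\Pi$ denotes the set of pyramids. Pyramids $\mathcal{P}_n$ converge weakly to $\mathcal{P}$ if $\square(X,\mathcal{P}_n)\to0$ for every $X\in\mathcal{P}$ and $\liminf_n\square(X,\mathcal{P}_n)>0$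 for every $X\notin\mathcal{P}$. $\Pi$ carries the topology of weak convergence, which is induced by a metric and makes $\Pi$ compact. $\mathbb{R}_+=(0,\infty)$ acts on $\Pi$ by $t\mathcal{P}=\{tX: X\in\mathcal{P}\}$, where $tX=(X,t\,d_X,\mu_X)$. $\mathrm{Fix}(\Pi)$ is the set of fixed points, $\Pi_*=\Pi\setminus\mathrm{Fix}(\Pi)$, and $\Pi_*/\mathbb{R}_+$ has the quotient topology. A free $\mathbb{R}_+$-action on $E$ with quotient map $\pi\colon E\to E/\mathbb{R}_+$ is a principal $\mathbb{R}_+$-bundle if the translation function $\tau(e,e')$, defined by $e'=\tau(e,e')e$ for $\pi(e)=\pi(e')$, is continuous. It is locally trivial if the base has an open cover by sets $U$ with $\mathbb{R}_+$-equivariant homeomorphisms $\pi^{-1}(U)\cong U\times\mathbb{R}_+$ over $U$. It is trivial if this holds for $U$ equal to the whole base. *)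

theory Defs
  imports "HOL-Probability.Probability"
begin

text \<open>An mm-space is represented by a pair (d, mu): the underlying set is
  space mu (a subset of the reals; every complete separable metric space has
  cardinality at most the continuum, so every mm-isomorphism class has such a
  representative), d is a metric on it, and mu is a Borel probability measure
  with full support.\<close>

type_synonym mmspace = "(real \<Rightarrow> real \<Rightarrow> real) \<times> real measure"

definition mm_dist :: "mmspace \<Rightarrow> real \<Rightarrow> real \<Rightarrow> real" where
  "mm_dist X = fst X"

definition mm_meas :: "mmspace \<Rightarrow> real measure" where
  "mm_meas X = snd X"

definition mm_carrier :: "mmspace \<Rightarrow> real set" where
  "mm_carrier X = space (mm_meas X)"

definition mm_top :: "mmspace \<Rightarrow> real topology" where
  "mm_top X = Metric_space.mtopology (mm_carrier X) (mm_dist X)"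

definition mm_space :: "mmspace \<Rightarrow> bool" where
  "mm_space X \<longleftrightarrow>
     Metric_space (mm_carrier X) (mm_dist X) \<and>
     Metric_space.mcomplete (mm_carrier X) (mm_dist X) \<and>
     separable_space (mm_top X) \<and>
     sets (mm_meas X) = sigma_sets (mm_carrier X) {U. openin (mm_top X) U} \<and>
     prob_space (mm_meas X) \<and>
     (\<forall>x\<in>mm_carrier X. \<forall>r>0.
        measure (mm_meas X) (Metric_space.mball (mm_carrier X) (mm_dist X) x r) > 0)"

definition mm_scale :: "real \<Rightarrow> mmspace \<Rightarrow> mmspace" where
  "mm_scale t X = ((\<lambda>x y. t * mm_dist X x y), mm_meas X)"

definition unit_interval_leb :: "real measure" where
  "unit_interval_leb = restrict_space lborel {0..<1}"

definition box_admissible :: "mmspace \<Rightarrow> mmspace \<Rightarrow> real \<Rightarrow> bool" where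
  "box_admissible X Y \<epsilon> \<longleftrightarrow> \<epsilon> \<ge> 0 \<and>
     (\<exists>\<phi> \<psi> I0.
        \<phi> \<in> measurable unit_interval_leb (mm_meas X) \<and>
        distr unit_interval_leb (mm_meas X) \<phi> = mm_meas X \<and>
        \<psi> \<in> measurable unit_interval_leb (mm_meas Y) \<and>
        distr unit_interval_leb (mm_meas Y) \<psi> = mm_meas Y \<and>
        I0 \<in> sets unit_interval_leb \<and>
        measure unit_interval_leb I0 \<ge> 1 - \<epsilon> \<and>
        (\<forall>s\<in>I0. \<forall>t\<in>I0.
           \<bar>mm_dist X (\<phi> s) (\<phi> t) - mm_dist Y (\<psi> s) (\<psi> t)\<bar> \<le> \<epsilon>))"

definition box :: "mmspace \<Rightarrow> mmspace \<Rightarrow> real" where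
  "box X Y = Inf {\<epsilon>. box_admissible X Y \<epsilon>}"

definition box_set :: "mmspace \<Rightarrow> mmspace set \<Rightarrow> real" where
  "box_set X P = Inf (box X ` P)"

definition lip_le :: "mmspace \<Rightarrow> mmspace \<Rightarrow> bool" where
  "lip_le Y X \<longleftrightarrow> (\<exists>f. f \<in> measurable (mm_meas X) (mm_meas Y) \<and>
     (\<forall>x\<in>mm_carrier X. \<forall>x'\<in>mm_carrier X.
        mm_dist Y (f x) (f x') \<le> mm_dist X x x') \<and>
     distr (mm_meas X) (mm_meas Y) f = mm_meas Y)"

text \<open>A pyramid is represented as the set of all mm-space representatives of
  its members (it is closed under mm-isomorphism by condition (1)).\<close>
definition pyramid :: "mmspace set \<Rightarrow> bool" where
  "pyramid P \<longleftrightarrow>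
     (\<forall>X\<in>P. mm_space X) \<and>
     (\<forall>X\<in>P. \<forall>Y. mm_space Y \<and> lip_le Y X \<longrightarrow> Y \<in> P) \<and>
     (\<forall>Y\<in>P. \<forall>Y'\<in>P. \<exists>X\<in>P. lip_le Y X \<and> lip_le Y' X) \<and>
     P \<noteq> {} \<and>
     (\<forall>X. mm_space X \<and> box_set X P = 0 \<longrightarrow> X \<in> P)"

definition Pyramids :: "mmspace set set" where
  "Pyramids = {P. pyramid P}"

definition weak_conv :: "(nat \<Rightarrow> mmspace set) \<Rightarrow> mmspace set \<Rightarrow> bool" where
  "weak_conv Ps P \<longleftrightarrow>
     (\<forall>X\<in>P. (\<lambda>n. box_set X (Ps n)) \<longlonglongrightarrow> 0) \<and>
     (\<forall>X. mm_space X \<and> X \<notin> P \<longrightarrow> liminf (\<lambda>n. ereal (box_set X (Ps n))) > 0)"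

text \<open>Topology of weak convergence: since it is metrizable, it is the
  sequential topology determined by weak convergence.\<close>
definition pyr_topology :: "mmspace set topology" where
  "pyr_topology = topology (\<lambda>U. U \<subseteq> Pyramids \<and>
     (\<forall>P\<in>U. \<forall>Ps. (\<forall>n. Ps n \<in> Pyramids) \<and> weak_conv Ps P \<longrightarrow>
        eventually (\<lambda>n. Ps n \<in> U) sequentially))"

definition pyr_scale :: "real \<Rightarrow> mmspace set \<Rightarrow> mmspace set" where
  "pyr_scale t P = mm_scale t ` P"

definition Fix_Pyr :: "mmspace set set" where
  "Fix_Pyr = {P\<in>Pyramids. \<forall>t>0. pyr_scale t P = P}"

definition Pyr_star :: "mmspace set set" where
  "Pyr_star = Pyramids - Fix_Pyr"

definition Pyr_star_top :: "mmspace set topology" where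
  "Pyr_star_top = subtopology pyr_topology Pyr_star"

definition orbit :: "mmspace set \<Rightarrow> mmspace set set" where
  "orbit P = {pyr_scale t P | t. t > 0}"

definition Orbits :: "mmspace set set set" where
  "Orbits = orbit ` Pyr_star"

definition quot_top :: "mmspace set set topology" where
  "quot_top = topology (\<lambda>U. U \<subseteq> Orbits \<and>
     openin Pyr_star_top {P \<in> Pyr_star. orbit P \<in> U})"

definition pos_reals_top :: "real topology" where
  "pos_reals_top = subtopology euclideanreal {0<..}"

definition translation :: "mmspace set \<Rightarrow> mmspace set \<Rightarrow> real" where
  "translation P Q = (THE t. t > 0 \<and> Q = pyr_scale t P)"

definition free_action :: bool where
  "free_action \<longleftrightarrow> (\<forall>P\<in>Pyr_star. \<forall>t>0. pyr_scale t P = P \<longrightarrow> t = 1)"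

definition principal_bundle :: bool where
  "principal_bundle \<longleftrightarrow> free_action \<and>
     continuous_map
       (subtopology (prod_topology Pyr_star_top Pyr_star_top)
          {(P, Q). P \<in> Pyr_star \<and> Q \<in> Pyr_star \<and> orbit P = orbit Q})
       pos_reals_top (\<lambda>(P, Q). translation P Q)"

definition local_trivialization ::
  "mmspace set set set \<Rightarrow> (mmspace set \<Rightarrow> mmspace set set \<times> real) \<Rightarrow> bool" where
  "local_trivialization U h \<longleftrightarrow>
     homeomorphic_map (subtopology Pyr_star_top {P \<in> Pyr_star. orbit P \<in> U})
       (prod_topology (subtopology quot_top U) pos_reals_top) h \<and>
     (\<forall>P. P \<in> Pyr_star \<and> orbit P \<in> U \<longrightarrow> fst (h P) = orbit P) \<and>
     (\<forall>P t. P \<in> Pyr_star \<and> orbit P \<in> U \<and> t > 0 \<longrightarrow>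
        h (pyr_scale t P) = (fst (h P), t * snd (h P)))"

definition locally_trivial :: bool where
  "locally_trivial \<longleftrightarrow> (\<exists>\<U>. (\<forall>U\<in>\<U>. openin quot_top U) \<and> \<Union>\<U> = Orbits \<and>
     (\<forall>U\<in>\<U>. \<exists>h. local_trivialization U h))"

definition trivial_bundle :: bool where
  "trivial_bundle \<longleftrightarrow> (\<exists>h. local_trivialization Orbits h)"

end

(*
  Pyramids are compared through the laws of 1-Lipschitz functions X -> [0,R], X in P. Given weights
  m_j and points c_j, let H(P) be the least total deficit of such a law with respect to having mass
  m_j near c_j. H is continuous for weak convergence: McShane extension transports functions between
  box-close spaces, and Helly selection with the Skorohod representation gives limits of laws.

  If P is not fixed, choose X in P with tX not in P, cut most of X into separated small pieces K_j of
  mass m_j, and let c_j be the values of a 1-Lipschitz function that is constant on the pieces. Then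
  H(P) = 0. If H(P/s) were small for a large s, some Y in P would have pieces of about the same masses
  at huge mutual distances, so that 1-Lipschitz functions of Y could imitate all distances between the
  pieces of tX, and tX would lie in the box closure of P. Hence s |-> H(P/s) separates scales, and
  integrating max(0, a - H(P/s)) over s > 0, for a small constant a > 0, gives a continuous function
  f > 0 with f(tP) = t f(P) on an invariant neighbourhood of P. It yields the translation function f(Q)/f(P) and the local
  trivialization P |-> (orbit P, f P).

  A global trivialization would give such an f on all non-fixed pyramids. Three atoms at distances
  1, n, n converge, as do their rescalings by 1/n, to non-fixed pyramids P and Q; then
  f(P_n) -> f(P) and f(P_n)/n -> f(Q) > 0, which is absurd.
*)

theory Submission
  imports Defs
begin

section \<open>Coding standard Borel spaces by real numbers\<close>

text \<open>Families of mm-spaces need not have box-convergent subsequences, so limits cannot be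
  taken among spaces. Laws on a fixed interval [0,R] are compact, and a law is itself an mm-space
  below the space that carries it; this is why pyramids are probed by laws. The box distance speaks
  of parametrizations by [0,1), whereas the arguments produce couplings; coding points by real
  numbers turns a coupling into a pair of parametrizations. A scale cannot be read off as the
  solution s of H(P/s) = a: H(P/s) is only nondecreasing in s and may stay at the level a on an
  interval, where the solution would jump. The integral over s does not see this, and substitution
  makes it homogeneous. The topology is given by sequences, and subspaces and products of sequential
  topologies need not be sequential. Continuity in two variables is therefore reduced to the
  functions f and to compact intervals of scales.\<close>

lemma odd_floor_binary_digits_base4:
  fixes b :: "nat \<Rightarrow> bool"
  shows "odd \<lfloor>4 ^ k * (\<Sum>j. of_bool (b j) / 4 ^ j) :: real\<rfloor> = b k"
proof -
  let ?a = "\<lambda>j. of_bool (b j) / 4 ^ j :: real"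
  have sm: "summable ?a"
    by (rule summable_comparison_test'[OF summable_geometric[of "1/4::real"], where N=0])
       (auto simp: power_divide)
  have tail_sm: "summable (\<lambda>j. ?a (j + Suc k))"
    using sm by (subst summable_iff_shift)
  have geo: "(\<lambda>j. (1/4::real) ^ (j + Suc k)) sums ((1/4)^Suc k * (4/3))"
    using sums_mult2[OF geometric_sums[of "1/4::real"], of "(1/4)^Suc k"]
    by (simp add: power_add mult_ac)
  have tail_le: "(\<Sum>j. ?a (j + Suc k)) \<le> (1/4)^Suc k * (4/3)"
    using geo by (intro sums_le[OF _ summable_sums[OF tail_sm] geo]) (auto simp: power_divide)
  have tail_ge: "(\<Sum>j. ?a (j + Suc k)) \<ge> 0"
    by (rule suminf_nonneg[OF tail_sm]) auto
  \<comment> \<open>Digits 0 and 1 in base 4 rule out carries: the digits after position k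
    contribute at most 1/3 after multiplication by \<open>4 ^ k\<close>, the earlier ones a multiple
    of 4, so the parity of the floor is the digit.\<close>
  define T where "T = 4 ^ k * (\<Sum>j. ?a (j + Suc k))"
  have T: "0 \<le> T" "T < 1"
  proof -
    show "0 \<le> T" unfolding T_def using tail_ge by simp
    have "T \<le> 4 ^ k * ((1/4)^Suc k * (4/3))"
      unfolding T_def using tail_le by (intro mult_left_mono) auto
    also have "\<dots> = 1/3" by (simp add: power_divide)
    finally show "T < 1" by simp
  qed
  define m where "m = (\<Sum>j<k. of_bool (b j) * 4 ^ (k - Suc j) :: int)"
  have "(\<Sum>j. ?a j) = (\<Sum>j. ?a (j + Suc k)) + (\<Sum>j<Suc k. ?a j)"
    by (rule suminf_split_initial_segment[OF sm])
  then have "4 ^ k * (\<Sum>j. ?a j) = T + 4 ^ k * (\<Sum>j<k. ?a j) + of_bool (b k)"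
    by (simp add: T_def algebra_simps)
  also have "4 ^ k * (\<Sum>j<k. ?a j) = (\<Sum>j<k. 4 * real_of_int (of_bool (b j) * 4 ^ (k - Suc j)))"
    unfolding sum_distrib_left
  proof (rule sum.cong)
    fix j assume "j \<in> {..<k}"
    then have "(4::real) ^ k = 4 * 4 ^ (k - Suc j) * 4 ^ j"
      by (simp flip: power_Suc power_add)
    then show "4 ^ k * ?a j = 4 * real_of_int (of_bool (b j) * 4 ^ (k - Suc j))"
      by simp
  qed simp
  also have "\<dots> = real_of_int (4 * m)"
    by (simp only: m_def sum_distrib_left of_int_sum of_int_mult of_int_numeral)
  finally have "\<lfloor>4 ^ k * (\<Sum>j. ?a j)\<rfloor> = 4 * m + of_bool (b k)"
    using T by (intro floor_unique) auto
  then show ?thesis by simp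
qed

lemma space_unit_interval_leb [simp]: "space unit_interval_leb = {0..<1}"
  by (simp add: unit_interval_leb_def space_restrict_space)

lemma prob_space_unit_interval_leb: "prob_space unit_interval_leb"
  by (rule prob_spaceI)
     (simp add: unit_interval_leb_def emeasure_restrict_space space_restrict_space)

text \<open>The quantile function \<open>I\<close> of the distribution function pushes Lebesgue
  measure on the open unit interval to \<nu>; the value 0 at the null point 0 extends it to
  [0,1).\<close>

lemma real_distribution_parametrization:
  assumes "real_distribution \<nu>"
  obtains I where "I \<in> borel_measurable unit_interval_leb" "distr unit_interval_leb borel I = \<nu>"
proof -
  interpret cdf_distribution \<nu> using assms by (simp add: cdf_distribution_def)
  define J where "J s = (if s \<in> {0<..<1} then I s else 0)" for s :: real
  have J: "J \<in> borel_measurable borel"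
    using measurable_CI
    by (subst (asm) borel_measurable_restrict_space_iff, simp, elim measurable_cong[THEN iffD1, rotated])
       (auto simp: J_def)
  have JU: "J \<in> borel_measurable unit_interval_leb"
    unfolding unit_interval_leb_def using J by (intro measurable_restrict_space1) simp
  have "distr unit_interval_leb borel J = distr (restrict_space lborel {0<..<1}) borel I"
  proof (rule measure_eqI)
    fix A assume "A \<in> sets (distr unit_interval_leb borel J)"
    then have A[measurable]: "A \<in> sets borel" by simp
    have I_meas: "I \<in> borel_measurable (restrict_space lborel {0<..<1})"
      using measurable_CI by (simp cong: measurable_cong_sets sets_restrict_space_cong)
    note [measurable] = J
    have JA: "J -` A \<in> sets borel"
      using measurable_sets[OF J A] by simp
    have "emeasure (distr unit_interval_leb borel J) A = emeasure lborel (J -` A \<inter> {0..<1})"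
      using JU by (simp add: emeasure_distr) (simp add: unit_interval_leb_def emeasure_restrict_space)
    also have "\<dots> = emeasure lborel (J -` A \<inter> {0<..<1})"
    proof (rule emeasure_eq_AE)
      show "AE x in lborel. (x \<in> J -` A \<inter> {0..<1}) = (x \<in> J -` A \<inter> {0<..<1})"
        using AE_lborel_singleton[of "0::real"] by eventually_elim auto
    qed (use JA in auto)
    also have "J -` A \<inter> {0<..<1} = I -` A \<inter> {0<..<1}"
      by (auto simp: J_def)
    also have "emeasure lborel \<dots> = emeasure (distr (restrict_space lborel {0<..<1}) borel I) A"
      using I_meas by (simp add: emeasure_distr space_restrict_space emeasure_restrict_space)
    finally show "emeasure (distr unit_interval_leb borel J) A = \<dots>" .
  qed simp
  then show ?thesis
    using that JU distr_I_eq_M by simp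
qed

section \<open>Decoding in complete separable metric spaces\<close>

context Metric_space
begin

lemma MCauchy_geometric:
  assumes M: "\<And>n. s n \<in> M" and le: "\<And>n. d (s n) (s (Suc n)) \<le> 2 * (1/2) ^ n"
  shows "MCauchy s"
proof -
  \<comment> \<open>Subtracting \<open>4 * (1/2)^(n + k)\<close> makes the induction close: the next
    step, of length at most \<open>2 * (1/2)^(n + k)\<close>, is exactly the decrease of that
    term.\<close>
  have *: "d (s n) (s (n + k)) \<le> 4 * (1/2)^n - 4 * (1/2)^(n + k)" for n k
  proof (induction k)
    case (Suc k)
    have "d (s n) (s (n + Suc k)) \<le> d (s n) (s (n + k)) + d (s (n + k)) (s (Suc (n + k)))"
      using triangle M by simp
    also have "\<dots> \<le> 4 * (1/2)^n - 4 * (1/2)^(n + k) + 2 * (1/2)^(n + k)"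
      using Suc.IH le[of "n + k"] by simp
    also have "\<dots> = 4 * (1/2)^n - 4 * (1/2)^(n + Suc k)"
      by simp
    finally show ?case .
  qed (use M in simp)
  have **: "d (s n) (s m) \<le> 4 * (1/2)^n" if "n \<le> m" for n m
  proof -
    from that obtain k where m: "m = n + k" by (auto simp: le_iff_add)
    have "0 \<le> (1/2::real)^(n + k)" by simp
    then show ?thesis unfolding m using *[of n k] by linarith
  qed
  show ?thesis
    unfolding MCauchy_def
  proof (intro conjI allI impI)
    show "range s \<subseteq> M" using M by auto
    fix \<epsilon> :: real assume "\<epsilon> > 0"
    obtain N where N: "(1/2::real)^N < \<epsilon> / 4"
      using real_arch_pow_inv[of "\<epsilon>/4" "1/2"] \<open>\<epsilon> > 0\<close> by auto
    show "\<exists>N. \<forall>n n'. N \<le> n \<longrightarrow> N \<le> n' \<longrightarrow> d (s n) (s n') < \<epsilon>"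
    proof (intro exI allI impI)
      fix n n' assume nn: "N \<le> n" "N \<le> n'"
      have small: "4 * (1/2::real)^m < \<epsilon>" if "N \<le> m" for m
      proof -
        have "(1/2::real)^m \<le> (1/2)^N" using that by (intro power_decreasing) auto
        then show ?thesis using N by linarith
      qed
      show "d (s n) (s n') < \<epsilon>"
        using **[of n n'] **[of n' n] small[of n] small[of n'] nn commute[of "s n" "s n'"]
        by (cases "n \<le> n'") auto
    qed
  qed
qed

lemma dense_sequence:
  assumes "separable_space mtopology" "M \<noteq> {}"
  obtains q :: "nat \<Rightarrow> 'a" where "range q \<subseteq> M" "\<And>x r. x \<in> M \<Longrightarrow> r > 0 \<Longrightarrow> \<exists>i. d x (q i) < r"
proof -
  obtain D where D: "countable D" "D \<subseteq> M" "mtopology closure_of D = M"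
    using assms(1) unfolding separable_space_def topspace_mtopology by auto
  have dense: "\<exists>y\<in>D. d x y < r" if "x \<in> M" "r > 0" for x r
    using that D(3) unfolding metric_closure_of by (auto simp: set_eq_iff)
  have "D \<noteq> {}" using dense assms(2) by (metis empty_iff ex_in_conv zero_less_one)
  show ?thesis
  proof (rule that[of "from_nat_into D"])
    show "range (from_nat_into D) \<subseteq> M"
      using D \<open>D \<noteq> {}\<close> by (simp add: range_from_nat_into)
    fix x r assume "x \<in> M" "(r::real) > 0"
    then obtain y where "y \<in> D" "d x y < r" using dense by blast
    then show "\<exists>i. d x (from_nat_into D i) < r"
      using from_nat_into_surj[OF D(1)] by metis
  qed
qed

text \<open>In a separable space an open set is a countable union of balls of radius 1/(n+1) about a
  dense sequence, so measurability of a map follows from that of its distances to fixed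
  points.\<close>

lemma measurable_into_mtopology:
  assumes sep: "separable_space mtopology" and sets: "sets \<mu> = sigma_sets M {U. openin mtopology U}"
    and r: "r \<in> space N \<rightarrow> M"
    and dist: "\<And>a. a \<in> M \<Longrightarrow> (\<lambda>z. d a (r z)) \<in> borel_measurable N"
  shows "r \<in> measurable N \<mu>"
proof (cases "M = {}")
  case True
  then have N: "space N = {}" using r by auto
  show ?thesis by (rule measurableI) (auto simp: N)
next
  case False
  obtain q where q: "range q \<subseteq> M" "\<And>x r. x \<in> M \<Longrightarrow> r > 0 \<Longrightarrow> \<exists>i::nat. d x (q i) < r"
    using dense_sequence[OF sep False] by blast
  show ?thesis
  proof (rule measurable_sigma_sets[OF sets])
    show "{U. openin mtopology U} \<subseteq> Pow M" by (auto simp: openin_mtopology)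
    show "r \<in> space N \<rightarrow> M" by fact
    fix U assume "U \<in> {U. openin mtopology U}"
    then have U: "U \<subseteq> M" "\<And>x. x \<in> U \<Longrightarrow> \<exists>r>0. mball x r \<subseteq> U"
      by (auto simp: openin_mtopology)
    define S where "S = {(i::nat, n::nat). mball (q i) (1 / real (Suc n)) \<subseteq> U}"
    have "r -` U \<inter> space N = (\<Union>(i, n)\<in>S. {z \<in> space N. d (q i) (r z) < 1 / real (Suc n)})"
    proof (intro equalityI subsetI)
      fix z assume z: "z \<in> r -` U \<inter> space N"
      then obtain \<epsilon> where e: "\<epsilon> > 0" "mball (r z) \<epsilon> \<subseteq> U" using U(2) by blast
      obtain n where n: "1 / real (Suc n) < \<epsilon> / 2"
        using e(1) by (metis half_gt_zero nat_approx_posE)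
      obtain i where i: "d (r z) (q i) < 1 / real (Suc n)"
        using q(2)[of "r z" "1 / real (Suc n)"] z U(1) by auto
      have "mball (q i) (1 / real (Suc n)) \<subseteq> mball (r z) \<epsilon>"
        using i n z U(1) commute by (intro mball_subset) (auto simp: commute)
      then have "(i, n) \<in> S" using e(2) by (auto simp: S_def)
      then show "z \<in> (\<Union>(i, n)\<in>S. {z \<in> space N. d (q i) (r z) < 1 / real (Suc n)})"
        using i z by (auto simp: commute)
    next
      fix z assume "z \<in> (\<Union>(i, n)\<in>S. {z \<in> space N. d (q i) (r z) < 1 / real (Suc n)})"
      then obtain i n where "mball (q i) (1 / real (Suc n)) \<subseteq> U" "z \<in> space N"
        "d (q i) (r z) < 1 / real (Suc n)" by (auto simp: S_def)
      then show "z \<in> r -` U \<inter> space N" using r q(1) by (auto simp: subset_iff)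
    qed
    also have "\<dots> \<in> sets N"
    proof (rule sets.countable_UN'')
      show "countable S" by simp
      fix p assume "p \<in> S"
      obtain i n where p: "p = (i, n)" by fastforce
      have [measurable]: "(\<lambda>z. d (q i) (r z)) \<in> borel_measurable N"
        using dist q(1) by auto
      have "{z \<in> space N. d (q i) (r z) < 1 / real (Suc n)} \<in> sets N" by measurable
      then show "(case p of (i, n) \<Rightarrow> {z \<in> space N. d (q i) (r z) < 1 / real (Suc n)}) \<in> sets N"
        by (simp add: p)
    qed
    finally show "r -` U \<inter> space N \<in> sets N" .
  qed
qed

text \<open>The code \<open>e x\<close> records in its base 4 digits which of the balls with centres in a countable
  dense set and radii \<open>1/2^n\<close> contain \<open>x\<close>; a point is recovered as the limit of the first
  admissible centres, and this recipe makes sense for all codes outside the image of \<open>e\<close> as well.\<close>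

lemma standard_borel_coding:
  fixes \<mu> :: "'a measure"
  assumes compl: "mcomplete" and sep: "separable_space mtopology" and ne: "M \<noteq> {}"
    and sets: "sets \<mu> = sigma_sets M {U. openin mtopology U}"
  shows "\<exists>(e :: 'a \<Rightarrow> real) r. e \<in> borel_measurable \<mu> \<and> r \<in> measurable borel \<mu> \<and> (\<forall>x\<in>M. r (e x) = x)"
proof -
  obtain q where q: "range q \<subseteq> M" "\<And>x r. x \<in> M \<Longrightarrow> r > 0 \<Longrightarrow> \<exists>i::nat. d x (q i) < r"
    using dense_sequence[OF sep ne] by blast
  have qM: "q i \<in> M" for i using q(1) by auto
  have space: "space \<mu> = M"
  proof -
    have "{U. openin mtopology U} \<subseteq> Pow M" by (auto simp: openin_mtopology)
    then show ?thesis using sets sets_eq_imp_space_eq[of \<mu> "sigma M {U. openin mtopology U}"]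
      by (simp add: sets_measure_of space_measure_of)
  qed
  define bit where "bit x k = (d x (q (fst (prod_decode k))) < (1/2) ^ snd (prod_decode k))" for x k
  define e where "e x = (\<Sum>k. of_bool (bit x k) / 4 ^ k :: real)" for x
  define dec where "dec k z = odd \<lfloor>4 ^ k * z\<rfloor>" for k and z :: real
  have dec_e: "dec k (e x) = bit x k" for k x
    unfolding dec_def e_def by (rule odd_floor_binary_digits_base4)
  have [measurable]: "Measurable.pred borel (dec k)" for k
    unfolding dec_def by measurable
  \<comment> \<open>The least index is a measurable choice. Codes that name no ball of radius
    (1/2)^n get some index as well; whether the centres converge is decided by
    \<open>E\<close>.\<close>
  define idx where "idx n z = (LEAST i. dec (prod_encode (i, n)) z)" for n z
  have idx_meas [measurable]: "idx n \<in> measurable borel (count_space UNIV)" for n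
    unfolding idx_def by measurable
  have idx_e: "d x (q (idx n (e x))) < (1/2)^n" if xM: "x \<in> M" for n x
  proof -
    have "(0::real) < (1/2)^n" by simp
    then obtain i where "d x (q i) < (1/2)^n" using q(2)[OF xM] by blast
    then have "dec (prod_encode (i, n)) (e x)" by (simp add: dec_e bit_def)
    then have "dec (prod_encode (idx n (e x), n)) (e x)" unfolding idx_def by (rule LeastI)
    then show ?thesis by (simp add: dec_e bit_def)
  qed
  \<comment> \<open>For a genuine code two consecutive centres lie within (1/2)^n and (1/2)^(n+1) of
    the point and hence satisfy this bound; conversely the bound makes the centres Cauchy for every
    z in \<open>E\<close>.\<close>
  define E where "E = {z. \<forall>n. d (q (idx n z)) (q (idx (Suc n) z)) \<le> 2 * (1/2)^n}"
  have [measurable]: "E \<in> sets borel"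
  proof -
    have [measurable]: "(\<lambda>z. d (q (idx n z)) (q (idx (Suc n) z))) \<in> borel_measurable borel" for n
    proof (rule measurable_compose_countable[where f="\<lambda>i z. d (q i) (q (idx (Suc n) z))" and g="idx n"])
      show "(\<lambda>z. d (q i) (q (idx (Suc n) z))) \<in> borel_measurable borel" for i
        by (rule measurable_compose[OF idx_meas]) simp
    qed simp
    show ?thesis unfolding E_def by measurable
  qed
  have e_E: "e x \<in> E" if "x \<in> M" for x
  proof -
    have "d (q (idx n (e x))) (q (idx (Suc n) (e x))) \<le> 2 * (1/2)^n" for n
    proof -
      have "d (q (idx n (e x))) (q (idx (Suc n) (e x))) \<le> d x (q (idx n (e x))) + d x (q (idx (Suc n) (e x)))"
        using triangle''[of "q (idx n (e x))" x "q (idx (Suc n) (e x))"] qM that by simp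
      then show ?thesis using idx_e[OF that, of n] idx_e[OF that, of "Suc n"]
        zero_le_power[of "1/2::real" n] unfolding power_Suc by linarith
    qed
    then show ?thesis by (simp add: E_def)
  qed
  define r where "r z = (if z \<in> E then (SOME l. limitin mtopology (\<lambda>n. q (idx n z)) l sequentially) else q 0)" for z
  have r_lim: "limitin mtopology (\<lambda>n. q (idx n z)) (r z) sequentially" if "z \<in> E" for z
  proof -
    have "MCauchy (\<lambda>n. q (idx n z))"
      using that qM by (intro MCauchy_geometric) (auto simp: E_def)
    then have "\<exists>l. limitin mtopology (\<lambda>n. q (idx n z)) l sequentially"
      using compl unfolding mcomplete_def by blast
    then show ?thesis unfolding r_def using that by (simp add: someI_ex[of "\<lambda>l. limitin _ _ l _"])
  qed
  have rM: "r z \<in> M" for z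
    using r_lim[of z] qM by (cases "z \<in> E") (auto simp: limitin_mspace r_def)
  \<comment> \<open>Distances to the decoded point are pointwise limits of functions of the
    measurable indices; this yields the measurability of \<open>r\<close>.\<close>
  have dist_r: "(\<lambda>n. if z \<in> E then d a (q (idx n z)) else d a (q 0)) \<longlonglongrightarrow> d a (r z)" if a: "a \<in> M" for a z
  proof (cases "z \<in> E")
    case True
    have "(\<lambda>n. d (q (idx n z)) (r z)) \<longlonglongrightarrow> 0"
      using r_lim[OF True] by (simp add: limitin_metric_dist_null)
    then have "(\<lambda>n. d a (q (idx n z)) - d a (r z)) \<longlonglongrightarrow> 0"
    proof (rule Lim_null_comparison[rotated])
      show "\<forall>\<^sub>F n in sequentially. norm (d a (q (idx n z)) - d a (r z)) \<le> d (q (idx n z)) (r z)"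
        by (intro always_eventually allI) (metis mdist_reverse_triangle commute real_norm_def qM a rM)
    qed
    then show ?thesis using True by (simp add: LIM_zero_iff)
  qed (simp add: r_def)
  have r_e: "r (e x) = x" if "x \<in> M" for x
  proof -
    have "(\<lambda>n. d x (q (idx n (e x)))) \<longlonglongrightarrow> d x (r (e x))"
      using dist_r[OF that, of "e x"] e_E[OF that] by simp
    moreover have "(\<lambda>n. d x (q (idx n (e x)))) \<longlonglongrightarrow> 0"
    proof (rule Lim_null_comparison)
      show "\<forall>\<^sub>F n in sequentially. norm (d x (q (idx n (e x)))) \<le> (1/2)^n"
        using idx_e[OF that] by (intro always_eventually allI) (simp add: less_imp_le)
    qed (simp add: LIMSEQ_power_zero)
    ultimately have "d x (r (e x)) = 0" by (rule LIMSEQ_unique)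
    then show ?thesis using that rM by simp
  qed
  show ?thesis
  proof (intro exI[of _ e] exI[of _ r] conjI ballI)
    show "r \<in> measurable borel \<mu>"
    proof (rule measurable_into_mtopology[OF sep sets])
      fix a assume a: "a \<in> M"
      show "(\<lambda>z. d a (r z)) \<in> borel_measurable borel"
      proof (rule borel_measurable_LIMSEQ_real[OF dist_r[OF a]])
        fix n
        have [measurable]: "(\<lambda>z. d a (q (idx n z))) \<in> borel_measurable borel"
          by (rule measurable_compose[OF idx_meas]) simp
        show "(\<lambda>z. if z \<in> E then d a (q (idx n z)) else d a (q 0)) \<in> borel_measurable borel"
          by measurable
      qed
    qed (use rM in auto)
    have [measurable]: "Measurable.pred \<mu> (\<lambda>x. bit x k)" for k
    proof -
      have "{x \<in> space \<mu>. bit x k} = mball (q (fst (prod_decode k))) ((1/2) ^ snd (prod_decode k))"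
        using qM by (auto simp: bit_def space commute)
      also have "\<dots> \<in> sets \<mu>"
        unfolding sets by (rule sigma_sets.Basic) simp
      finally show ?thesis by (simp add: pred_def)
    qed
    show "e \<in> borel_measurable \<mu>" unfolding e_def by measurable
  qed (fact r_e)
qed

end

text \<open>A parametrization of the law of the code is pushed through \<open>r\<close>: the law of
  \<open>r \<circ> e\<close> is \<mu> because \<open>r\<close> decodes \<open>e\<close>.\<close>

lemma probability_parametrization:
  fixes e :: "'a \<Rightarrow> real"
  assumes "prob_space \<mu>" and e: "e \<in> borel_measurable \<mu>" and r: "r \<in> measurable borel \<mu>"
    and inv: "\<And>x. x \<in> space \<mu> \<Longrightarrow> r (e x) = x"
  obtains \<phi> where "\<phi> \<in> measurable unit_interval_leb \<mu>" "distr unit_interval_leb \<mu> \<phi> = \<mu>"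
proof -
  interpret prob_space \<mu> by fact
  have "real_distribution (distr \<mu> borel e)" using e by (rule real_distribution_distr)
  then obtain I where I: "I \<in> borel_measurable unit_interval_leb"
    "distr unit_interval_leb borel I = distr \<mu> borel e"
    by (rule real_distribution_parametrization)
  have "distr unit_interval_leb \<mu> (r \<circ> I) = distr (distr unit_interval_leb borel I) \<mu> r"
    using r I(1) by (simp add: distr_distr)
  also have "\<dots> = distr \<mu> \<mu> (r \<circ> e)"
    unfolding I(2) using r e by (simp add: distr_distr)
  also have "\<dots> = distr \<mu> \<mu> id"
    by (rule distr_cong) (auto simp: inv)
  also have "\<dots> = \<mu>" by (simp add: id_def distr_id)
  finally show ?thesis
    using that[of "r \<circ> I"] r I(1) by (auto intro: measurable_comp)
qed

section \<open>Couplings and the box distance\<close>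

locale mm =
  fixes X :: mmspace
  assumes mm_space: "mm_space X"

sublocale mm \<subseteq> Metric_space "mm_carrier X" "mm_dist X"
  using mm_space by (simp add: mm_space_def)

sublocale mm \<subseteq> prob_space "mm_meas X"
  using mm_space by (simp add: mm_space_def)

context mm
begin

lemma mm_complete: "mcomplete"
  and mm_separable: "separable_space mtopology"
  and sets_mm: "sets (mm_meas X) = sigma_sets (mm_carrier X) {U. openin mtopology U}"
  and mm_support: "x \<in> mm_carrier X \<Longrightarrow> r > 0 \<Longrightarrow> prob (mball x r) > 0"
  using mm_space by (auto simp: mm_space_def mm_top_def)

lemma space_mm: "space (mm_meas X) = mm_carrier X"
  by (simp add: mm_carrier_def)

lemma carrier_ne: "mm_carrier X \<noteq> {}"
  using not_empty by (simp add: space_mm)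

lemma openin_sets: "openin mtopology U \<Longrightarrow> U \<in> sets (mm_meas X)"
  unfolding sets_mm by (rule sigma_sets.Basic) simp

lemma closedin_sets: "closedin mtopology U \<Longrightarrow> U \<in> sets (mm_meas X)"
  using sets.compl_sets[OF openin_sets, of "mm_carrier X - U"]
  by (auto simp: closedin_def space_mm double_diff)

lemma lipschitz_measurable:
  fixes f :: "real \<Rightarrow> real"
  assumes "\<And>x y. x \<in> mm_carrier X \<Longrightarrow> y \<in> mm_carrier X \<Longrightarrow> \<bar>f x - f y\<bar> \<le> mm_dist X x y"
  shows "f \<in> borel_measurable (mm_meas X)"
proof (rule borel_measurableI)
  fix S :: "real set" assume "open S"
  have "openin mtopology (f -` S \<inter> mm_carrier X)"
    unfolding openin_mtopology
  proof (intro conjI allI impI)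
    fix x assume x: "x \<in> f -` S \<inter> mm_carrier X"
    then obtain r where r: "r > 0" "ball (f x) r \<subseteq> S"
      using \<open>open S\<close> by (auto simp: open_contains_ball)
    have "mball x r \<subseteq> f -` S \<inter> mm_carrier X"
    proof
      fix y assume "y \<in> mball x r"
      then have "f y \<in> ball (f x) r"
        using assms[of x y] by (auto simp: dist_real_def)
      then show "y \<in> f -` S \<inter> mm_carrier X" using r \<open>y \<in> mball x r\<close> by auto
    qed
    then show "\<exists>r>0. mball x r \<subseteq> f -` S \<inter> mm_carrier X" using r by blast
  qed auto
  then show "f -` S \<inter> space (mm_meas X) \<in> sets (mm_meas X)"
    unfolding space_mm by (rule openin_sets)
qed

lemma mm_coding:
  "\<exists>(e :: real \<Rightarrow> real) r. e \<in> borel_measurable (mm_meas X) \<and>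
    r \<in> measurable borel (mm_meas X) \<and> (\<forall>x\<in>mm_carrier X. r (e x) = x)"
  by (rule standard_borel_coding[OF mm_complete mm_separable carrier_ne sets_mm])

lemma mm_parametrization:
  obtains \<phi> where "\<phi> \<in> measurable unit_interval_leb (mm_meas X)"
    "distr unit_interval_leb (mm_meas X) \<phi> = mm_meas X"
proof -
  obtain e :: "real \<Rightarrow> real" and r where e: "e \<in> borel_measurable (mm_meas X)"
    "r \<in> measurable borel (mm_meas X)" "\<And>x. x \<in> mm_carrier X \<Longrightarrow> r (e x) = x"
    using mm_coding by blast
  show ?thesis
    by (rule probability_parametrization[OF prob_space_axioms e(1,2) e(3)])
       (simp_all add: space_mm that)
qed

text \<open>Continuity from below along balls of integer radius. An unbounded space can be cut down
  to a ball at a small cost in measure, which keeps errors proportional to distances under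
  control.\<close>

lemma mm_big_ball:
  assumes "\<epsilon> > 0" "x \<in> mm_carrier X"
  obtains R where "R > 0" "prob (mball x R) > 1 - \<epsilon>"
proof -
  have "(\<lambda>n. prob (mball x (real n))) \<longlonglongrightarrow> prob (\<Union>n. mball x (real n))"
    by (intro finite_Lim_measure_incseq) (auto simp: incseq_def openin_sets)
  also have "(\<Union>n. mball x (real n)) = space (mm_meas X)"
    using assms by (auto simp: space_mm reals_Archimedean2)
  finally have "(\<lambda>n. prob (mball x (real n))) \<longlonglongrightarrow> 1" by (simp add: prob_space)
  then have "\<forall>\<^sub>F n in sequentially. prob (mball x (real n)) > 1 - \<epsilon>"
    using \<open>\<epsilon> > 0\<close> by (intro order_tendstoD) auto
  then have "\<forall>\<^sub>F n in sequentially. prob (mball x (real n)) > 1 - \<epsilon> \<and> n > 0"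
    by (intro eventually_conj eventually_gt_at_top)
  then obtain n where "prob (mball x (real n)) > 1 - \<epsilon>" "n > 0"
    using eventually_happens by fastforce
  then show ?thesis using that[of "real n"] by simp
qed

end

lemma second_countable_euclidean:
  "second_countable (euclidean :: 'a::second_countable_topology topology)"
proof -
  obtain B :: "'a set set" where B: "countable B" "topological_basis B"
    using ex_countable_basis by blast
  show ?thesis
    unfolding second_countable_def
  proof (intro exI[of _ B] conjI allI impI ballI)
    fix U x assume "openin euclidean (U :: 'a set) \<and> x \<in> U"
    then show "\<exists>V\<in>B. x \<in> V \<and> V \<subseteq> U"
      using topological_basisE[OF B(2), of U x] by (metis open_openin)
  qed (use B topological_basis_open in auto)
qed

text \<open>A pair of codes has a joint law on the plane. The plane is itself complete and
  separable, so its points are coded by single reals once more.\<close>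

lemma plane_parametrization:
  fixes \<nu> :: "(real \<times> real) measure"
  assumes "prob_space \<nu>" and sets: "sets \<nu> = sets borel"
  obtains \<phi> where "\<phi> \<in> borel_measurable unit_interval_leb" "distr unit_interval_leb borel \<phi> = \<nu>"
proof -
  have sep: "separable_space (Met_TC.mtopology :: (real \<times> real) topology)"
    using second_countable_imp_separable_space[OF second_countable_euclidean] by simp
  have compl: "Metric_space.mcomplete (UNIV :: (real \<times> real) set) dist"
    by (simp add: complete_UNIV)
  have sig: "sets \<nu> = sigma_sets UNIV {U. openin Met_TC.mtopology U}"
    unfolding sets borel_def by (simp add: sets_measure_of)
  obtain e :: "real \<times> real \<Rightarrow> real" and r where e: "e \<in> borel_measurable \<nu>" "r \<in> measurable borel \<nu>" "\<And>x. r (e x) = x"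
    using Met_TC.standard_borel_coding[OF compl sep UNIV_not_empty sig] by blast
  obtain \<phi> where "\<phi> \<in> measurable unit_interval_leb \<nu>" "distr unit_interval_leb \<nu> \<phi> = \<nu>"
    by (rule probability_parametrization[OF assms(1) e])
  moreover have "distr unit_interval_leb \<nu> \<phi> = distr unit_interval_leb borel \<phi>"
    by (rule distr_cong) (simp_all add: sets)
  ultimately show ?thesis
    using that[of \<phi>] by (simp add: measurable_cong_sets[OF refl sets])
qed

text \<open>Box admissibility asks for maps on [0,1), while constructions yield a probability space
  \<Omega> with maps to both spaces. The joint law of the codes of both images is parametrized by
  [0,1), and decoding it gives two parametrizations with the joint law of \<open>p\<close> and
  \<open>q\<close>.\<close>

lemma box_admissible_coupling:
  assumes X: "mm_space X" and Y: "mm_space Y" and \<Omega>: "prob_space \<Omega>"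
    and p[measurable]: "p \<in> measurable \<Omega> (mm_meas X)" and pX: "distr \<Omega> (mm_meas X) p = mm_meas X"
    and q[measurable]: "q \<in> measurable \<Omega> (mm_meas Y)" and qY: "distr \<Omega> (mm_meas Y) q = mm_meas Y"
    and W[measurable]: "W \<in> sets (mm_meas X \<Otimes>\<^sub>M mm_meas Y)" and "\<epsilon> \<ge> 0"
    and W_prob: "measure \<Omega> {\<omega> \<in> space \<Omega>. (p \<omega>, q \<omega>) \<in> W} \<ge> 1 - \<epsilon>"
    and W_dist: "\<And>x y x' y'. (x, y) \<in> W \<Longrightarrow> (x', y') \<in> W \<Longrightarrow> \<bar>mm_dist X x x' - mm_dist Y y y'\<bar> \<le> \<epsilon>"
  shows "box_admissible X Y \<epsilon>"
proof -
  interpret X: mm X by standard fact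
  interpret Y: mm Y by standard fact
  interpret \<Omega>: prob_space \<Omega> by fact
  obtain eX :: "real \<Rightarrow> real" and rX where eX[measurable]: "eX \<in> borel_measurable (mm_meas X)"
    and rX[measurable]: "rX \<in> measurable borel (mm_meas X)" and reX: "\<And>x. x \<in> mm_carrier X \<Longrightarrow> rX (eX x) = x"
    using X.mm_coding by blast
  obtain eY :: "real \<Rightarrow> real" and rY where eY[measurable]: "eY \<in> borel_measurable (mm_meas Y)"
    and rY[measurable]: "rY \<in> measurable borel (mm_meas Y)" and reY: "\<And>x. x \<in> mm_carrier Y \<Longrightarrow> rY (eY x) = x"
    using Y.mm_coding by blast
  define g where "g \<omega> = (eX (p \<omega>), eY (q \<omega>))" for \<omega>
  have g[measurable]: "g \<in> borel_measurable \<Omega>" unfolding g_def by measurable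
  obtain \<phi> where \<phi>[measurable]: "\<phi> \<in> borel_measurable unit_interval_leb"
    and \<phi>_distr: "distr unit_interval_leb borel \<phi> = distr \<Omega> borel g"
    by (rule plane_parametrization[of "distr \<Omega> borel g"]) (auto intro: \<Omega>.prob_space_distr)
  define a where "a z = rX (fst z)" for z :: "real \<times> real"
  define b where "b z = rY (snd z)" for z :: "real \<times> real"
  have a[measurable]: "a \<in> measurable borel (mm_meas X)"
    unfolding a_def by (intro measurable_compose[OF _ rX]) (simp add: borel_prod[symmetric])
  have b[measurable]: "b \<in> measurable borel (mm_meas Y)"
    unfolding b_def by (intro measurable_compose[OF _ rY]) (simp add: borel_prod[symmetric])
  have ag: "a (g \<omega>) = p \<omega>" "b (g \<omega>) = q \<omega>" if "\<omega> \<in> space \<Omega>" for \<omega>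
    using measurable_space[OF p that] measurable_space[OF q that]
    by (simp_all add: a_def b_def g_def reX reY X.space_mm Y.space_mm)
  have aX: "distr unit_interval_leb (mm_meas X) (a \<circ> \<phi>) = mm_meas X"
  proof -
    have "distr unit_interval_leb (mm_meas X) (a \<circ> \<phi>) = distr (distr \<Omega> borel g) (mm_meas X) a"
      by (simp add: distr_distr flip: \<phi>_distr)
    also have "\<dots> = distr \<Omega> (mm_meas X) p"
      by (subst distr_distr) (auto simp: ag intro!: distr_cong)
    finally show ?thesis using pX by simp
  qed
  have bY: "distr unit_interval_leb (mm_meas Y) (b \<circ> \<phi>) = mm_meas Y"
  proof -
    have "distr unit_interval_leb (mm_meas Y) (b \<circ> \<phi>) = distr (distr \<Omega> borel g) (mm_meas Y) b"
      by (simp add: distr_distr flip: \<phi>_distr)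
    also have "\<dots> = distr \<Omega> (mm_meas Y) q"
      by (subst distr_distr) (auto simp: ag intro!: distr_cong)
    finally show ?thesis using qY by simp
  qed
  \<comment> \<open>The good event is given by a measurable set \<open>W\<close> of pairs, so it can
    be carried from \<Omega> to [0,1) through the joint law alone.\<close>
  define B where "B = {z. (a z, b z) \<in> W}"
  have [measurable]: "(\<lambda>z. (a z, b z)) \<in> measurable borel (mm_meas X \<Otimes>\<^sub>M mm_meas Y)"
    by (intro measurable_Pair a b)
  have B[measurable]: "B \<in> sets borel"
    unfolding B_def by measurable
  define I0 where "I0 = \<phi> -` B \<inter> space unit_interval_leb"
  have "measure unit_interval_leb I0 = measure (distr unit_interval_leb borel \<phi>) B"
    unfolding I0_def by (simp add: measure_distr)
  also have "\<dots> = measure \<Omega> (g -` B \<inter> space \<Omega>)"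
    unfolding \<phi>_distr by (simp add: measure_distr)
  also have "g -` B \<inter> space \<Omega> = {\<omega> \<in> space \<Omega>. (p \<omega>, q \<omega>) \<in> W}"
    by (auto simp: B_def ag)
  finally have "measure unit_interval_leb I0 \<ge> 1 - \<epsilon>" using W_prob by simp
  moreover have "I0 \<in> sets unit_interval_leb" unfolding I0_def by measurable
  moreover have "\<forall>s\<in>I0. \<forall>t\<in>I0. \<bar>mm_dist X ((a \<circ> \<phi>) s) ((a \<circ> \<phi>) t) - mm_dist Y ((b \<circ> \<phi>) s) ((b \<circ> \<phi>) t)\<bar> \<le> \<epsilon>"
    using W_dist by (auto simp: I0_def B_def)
  moreover have "a \<circ> \<phi> \<in> measurable unit_interval_leb (mm_meas X)" "b \<circ> \<phi> \<in> measurable unit_interval_leb (mm_meas Y)"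
    by measurable
  ultimately show ?thesis
    unfolding box_admissible_def using aX bY \<open>\<epsilon> \<ge> 0\<close> by blast
qed

section \<open>Elementary properties of the box distance\<close>

lemma box_admissible_mono: "box_admissible X Y \<epsilon> \<Longrightarrow> \<epsilon> \<le> \<epsilon>' \<Longrightarrow> box_admissible X Y \<epsilon>'"
proof -
  assume "box_admissible X Y \<epsilon>" and le: "\<epsilon> \<le> \<epsilon>'"
  then obtain \<phi> \<psi> I0 where *: "\<epsilon> \<ge> 0" "\<phi> \<in> measurable unit_interval_leb (mm_meas X)"
    "distr unit_interval_leb (mm_meas X) \<phi> = mm_meas X"
    "\<psi> \<in> measurable unit_interval_leb (mm_meas Y)"
    "distr unit_interval_leb (mm_meas Y) \<psi> = mm_meas Y" "I0 \<in> sets unit_interval_leb"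
    "measure unit_interval_leb I0 \<ge> 1 - \<epsilon>"
    "\<And>s t. s\<in>I0 \<Longrightarrow> t\<in>I0 \<Longrightarrow> \<bar>mm_dist X (\<phi> s) (\<phi> t) - mm_dist Y (\<psi> s) (\<psi> t)\<bar> \<le> \<epsilon>"
    unfolding box_admissible_def by blast
  show "box_admissible X Y \<epsilon>'"
    unfolding box_admissible_def
  proof (intro conjI exI ballI)
    show "1 - \<epsilon>' \<le> measure unit_interval_leb I0" using *(7) le by linarith
    show "\<bar>mm_dist X (\<phi> s) (\<phi> t) - mm_dist Y (\<psi> s) (\<psi> t)\<bar> \<le> \<epsilon>'" if "s \<in> I0" "t \<in> I0" for s t
      using *(8)[OF that] le by linarith
  qed (use * le in linarith | fact)+
qed

text \<open>At \<epsilon> = 1 the empty set of parameters is large enough, so the infimum defining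
  \<open>box\<close> is over a nonempty set.\<close>

lemma box_admissible_1:
  assumes "mm_space X" "mm_space Y"
  shows "box_admissible X Y 1"
proof -
  interpret X: mm X by standard fact
  interpret Y: mm Y by standard fact
  obtain \<phi> \<psi> where "\<phi> \<in> measurable unit_interval_leb (mm_meas X)"
    "distr unit_interval_leb (mm_meas X) \<phi> = mm_meas X"
    "\<psi> \<in> measurable unit_interval_leb (mm_meas Y)"
    "distr unit_interval_leb (mm_meas Y) \<psi> = mm_meas Y"
    using X.mm_parametrization Y.mm_parametrization by metis
  then show ?thesis
    unfolding box_admissible_def by (intro conjI exI[of _ \<phi>] exI[of _ \<psi>] exI[of _ "{}"]) auto
qed

lemma box_admissible_refl:
  assumes "mm_space X" "\<epsilon> \<ge> 0"
  shows "box_admissible X X \<epsilon>"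
proof -
  interpret X: mm X by standard fact
  interpret U: prob_space unit_interval_leb by (rule prob_space_unit_interval_leb)
  obtain \<phi> where "\<phi> \<in> measurable unit_interval_leb (mm_meas X)"
    "distr unit_interval_leb (mm_meas X) \<phi> = mm_meas X"
    using X.mm_parametrization by metis
  then show ?thesis
    unfolding box_admissible_def using U.prob_space \<open>\<epsilon> \<ge> 0\<close>
    by (auto intro!: exI[of _ \<phi>] exI[of _ "space unit_interval_leb"] simp del: space_unit_interval_leb)
qed

lemma box_admissible_set: "bdd_below {\<epsilon>. box_admissible X Y \<epsilon>}"
  by (rule bdd_belowI[of _ 0]) (simp add: box_admissible_def)

lemma box_le: "box_admissible X Y \<epsilon> \<Longrightarrow> box X Y \<le> \<epsilon>"
  unfolding box_def by (rule cInf_lower) (auto intro: box_admissible_set)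

lemma box_nonneg: "mm_space X \<Longrightarrow> mm_space Y \<Longrightarrow> box X Y \<ge> 0"
  unfolding box_def using box_admissible_1[of X Y]
  by (intro cInf_greatest) (blast, simp add: box_admissible_def)

lemma box_lessD: "mm_space X \<Longrightarrow> mm_space Y \<Longrightarrow> box X Y < \<epsilon> \<Longrightarrow> box_admissible X Y \<epsilon>"
  unfolding box_def using box_admissible_1[of X Y] box_admissible_set[of X Y]
  by (subst (asm) cInf_less_iff) (blast, blast, meson mem_Collect_eq box_admissible_mono less_imp_le)

text \<open>\<open>box_set\<close> is an infimum of infima; the estimates below all start from one
  space of P at an admissible distance, and this predicate provides that witness.\<close>

definition box_near :: "mmspace \<Rightarrow> mmspace set \<Rightarrow> real \<Rightarrow> bool" where
  "box_near X P \<epsilon> \<longleftrightarrow> (\<exists>Y\<in>P. box_admissible X Y \<epsilon>)"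

lemma box_near_mono: "box_near X P \<epsilon> \<Longrightarrow> \<epsilon> \<le> \<epsilon>' \<Longrightarrow> box_near X P \<epsilon>'"
  unfolding box_near_def using box_admissible_mono by blast

lemma pyramid_mm: "pyramid P \<Longrightarrow> X \<in> P \<Longrightarrow> mm_space X"
  by (simp add: pyramid_def)

lemma pyramid_ne: "pyramid P \<Longrightarrow> P \<noteq> {}"
  by (simp add: pyramid_def)

lemma pyramid_down: "pyramid P \<Longrightarrow> X \<in> P \<Longrightarrow> mm_space Y \<Longrightarrow> lip_le Y X \<Longrightarrow> Y \<in> P"
  unfolding pyramid_def by blast

lemma box_set_nonneg:
  assumes "P \<noteq> {}" "\<And>Y. Y \<in> P \<Longrightarrow> mm_space Y" "mm_space X"
  shows "box_set X P \<ge> 0"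
  unfolding box_set_def using assms by (intro cInf_greatest) (auto intro: box_nonneg)

lemma box_set_lessD:
  assumes "P \<noteq> {}" "\<And>Y. Y \<in> P \<Longrightarrow> mm_space Y" "mm_space X" "box_set X P < \<epsilon>"
  shows "box_near X P \<epsilon>"
proof -
  have "\<exists>z\<in>box X ` P. z < \<epsilon>"
    using assms by (subst cInf_less_iff[symmetric])
      (auto simp: box_set_def intro!: bdd_belowI[of _ 0] box_nonneg)
  then show ?thesis unfolding box_near_def using box_lessD assms by blast
qed

lemma box_set_le:
  assumes "\<And>Y. Y \<in> P \<Longrightarrow> mm_space Y" "mm_space X" "box_near X P \<epsilon>"
  shows "box_set X P \<le> \<epsilon>"
proof -
  obtain Y where "Y \<in> P" "box X Y \<le> \<epsilon>"
    using assms box_le unfolding box_near_def by blast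
  then show ?thesis
    unfolding box_set_def using assms
    by (intro cInf_lower2[of "box X Y"]) (auto intro!: bdd_belowI[of _ 0] box_nonneg)
qed

lemma pyramid_closed:
  assumes P: "pyramid P" and X: "mm_space X" and near: "\<And>\<epsilon>. \<epsilon> > 0 \<Longrightarrow> box_near X P \<epsilon>"
  shows "X \<in> P"
proof -
  have "box_set X P \<le> 0 + \<epsilon>" if "\<epsilon> > 0" for \<epsilon>
    using box_set_le[OF pyramid_mm[OF P] X near[OF that]] by simp
  then have "box_set X P \<le> 0" by (rule field_le_epsilon)
  then have "box_set X P = 0"
    using box_set_nonneg[OF pyramid_ne[OF P] pyramid_mm[OF P] X] by simp
  then show ?thesis using P X unfolding pyramid_def by blast
qed

text \<open>The numbers \<open>box_set X (Ps n)\<close> are nonnegative, so convergence to 0 is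
  eventual nearness at every level, and a positive lower limit is eventual failure of nearness at
  one level.\<close>

lemma weak_conv_iff:
  assumes Ps: "\<And>n. pyramid (Ps n)" and P: "pyramid P"
  shows "weak_conv Ps P \<longleftrightarrow> (\<forall>X\<in>P. \<forall>\<epsilon>>0. \<forall>\<^sub>F n in sequentially. box_near X (Ps n) \<epsilon>) \<and>
    (\<forall>X. mm_space X \<and> X \<notin> P \<longrightarrow> (\<exists>\<epsilon>>0. \<forall>\<^sub>F n in sequentially. \<not> box_near X (Ps n) \<epsilon>))"
proof -
  have nonneg: "0 \<le> box_set X (Ps n)" if "mm_space X" for X n
    by (rule box_set_nonneg[OF pyramid_ne[OF Ps] pyramid_mm[OF Ps] that])
  have lessD: "box_near X (Ps n) \<epsilon>" if "box_set X (Ps n) < \<epsilon>" "mm_space X" for X n \<epsilon>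
    by (rule box_set_lessD[OF pyramid_ne[OF Ps] pyramid_mm[OF Ps] that(2,1)])
  have le: "box_set X (Ps n) \<le> \<epsilon>" if "box_near X (Ps n) \<epsilon>" "mm_space X" for X n \<epsilon>
    by (rule box_set_le[OF pyramid_mm[OF Ps] that(2,1)])
  have 1: "(\<lambda>n. box_set X (Ps n)) \<longlonglongrightarrow> 0 \<longleftrightarrow> (\<forall>\<epsilon>>0. \<forall>\<^sub>F n in sequentially. box_near X (Ps n) \<epsilon>)"
    if "mm_space X" for X
  proof
    assume *: "(\<lambda>n. box_set X (Ps n)) \<longlonglongrightarrow> 0"
    show "\<forall>\<epsilon>>0. \<forall>\<^sub>F n in sequentially. box_near X (Ps n) \<epsilon>"
    proof (intro allI impI)
      fix \<epsilon> :: real assume "\<epsilon> > 0"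
      then have "\<forall>\<^sub>F n in sequentially. box_set X (Ps n) < \<epsilon>"
        using * by (intro order_tendstoD) auto
      then show "\<forall>\<^sub>F n in sequentially. box_near X (Ps n) \<epsilon>"
        by eventually_elim (rule lessD[OF _ that])
    qed
  next
    assume *: "\<forall>\<epsilon>>0. \<forall>\<^sub>F n in sequentially. box_near X (Ps n) \<epsilon>"
    show "(\<lambda>n. box_set X (Ps n)) \<longlonglongrightarrow> 0"
    proof (rule order_tendstoI)
      fix a :: real assume "a < 0"
      then show "\<forall>\<^sub>F n in sequentially. a < box_set X (Ps n)"
        using nonneg[OF that] by (intro always_eventually allI) (meson less_le_trans)
    next
      fix a :: real assume "0 < a"
      then have "\<forall>\<^sub>F n in sequentially. box_near X (Ps n) (a / 2)" using * by simp
      then show "\<forall>\<^sub>F n in sequentially. box_set X (Ps n) < a"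
        by eventually_elim (use le[OF _ that] \<open>0 < a\<close> in fastforce)
    qed
  qed
  have 2: "liminf (\<lambda>n. ereal (box_set X (Ps n))) > 0 \<longleftrightarrow> (\<exists>\<epsilon>>0. \<forall>\<^sub>F n in sequentially. \<not> box_near X (Ps n) \<epsilon>)"
    if "mm_space X" for X
  proof
    assume "liminf (\<lambda>n. ereal (box_set X (Ps n))) > 0"
    then obtain \<epsilon> where \<epsilon>: "0 < ereal \<epsilon>" "ereal \<epsilon> < liminf (\<lambda>n. ereal (box_set X (Ps n)))"
      using ereal_dense2 by blast
    from less_LiminfD[OF \<epsilon>(2)] have "\<forall>\<^sub>F n in sequentially. \<not> box_near X (Ps n) \<epsilon>"
      by eventually_elim (use le[OF _ that] in fastforce)
    then show "\<exists>\<epsilon>>0. \<forall>\<^sub>F n in sequentially. \<not> box_near X (Ps n) \<epsilon>"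
      using \<epsilon>(1) by auto
  next
    assume "\<exists>\<epsilon>>0. \<forall>\<^sub>F n in sequentially. \<not> box_near X (Ps n) \<epsilon>"
    then obtain \<epsilon> where \<epsilon>: "\<epsilon> > 0" "\<forall>\<^sub>F n in sequentially. \<not> box_near X (Ps n) \<epsilon>" by blast
    from \<epsilon>(2) have "\<forall>\<^sub>F n in sequentially. ereal \<epsilon> \<le> ereal (box_set X (Ps n))"
      by eventually_elim (use lessD[OF _ that] in force)
    then have "ereal \<epsilon> \<le> liminf (\<lambda>n. ereal (box_set X (Ps n)))"
      by (rule Liminf_bounded)
    then show "liminf (\<lambda>n. ereal (box_set X (Ps n))) > 0"
      using \<epsilon>(1) by (metis ereal_less(2) less_le_trans)
  qed
  show ?thesis
    unfolding weak_conv_def using 1 2 pyramid_mm[OF P] by blast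
qed

lemma weak_conv_nearD:
  assumes "\<And>n. pyramid (Ps n)" "pyramid P" "weak_conv Ps P" "X \<in> P" "\<epsilon> > 0"
  shows "\<forall>\<^sub>F n in sequentially. box_near X (Ps n) \<epsilon>"
  using assms weak_conv_iff by blast

lemma weak_conv_farD:
  assumes "\<And>n. pyramid (Ps n)" "pyramid P" "weak_conv Ps P" "mm_space X" "X \<notin> P"
  obtains \<epsilon> where "\<epsilon> > 0" "\<forall>\<^sub>F n in sequentially. \<not> box_near X (Ps n) \<epsilon>"
  using assms weak_conv_iff by blast

section \<open>Change of scale\<close>

lemma mm_dist_Pair [simp]: "mm_dist (d, \<mu>) = d"
  and mm_meas_Pair [simp]: "mm_meas (d, \<mu>) = \<mu>"
  by (simp_all add: mm_dist_def mm_meas_def)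

lemma mm_carrier_Pair [simp]: "mm_carrier (d, \<mu>) = space \<mu>"
  by (simp add: mm_carrier_def)

context mm
begin

text \<open>Bi-Lipschitz metrics have the same open sets and Cauchy sequences, hence the same Borel
  sets and the same completeness. This serves for rescaling and for metrics built from finitely many
  observables.\<close>

lemma bilipschitz_mm_space:
  assumes d': "Metric_space (mm_carrier X) d'" and "a > 0" "b > 0"
    and le: "\<And>x y. x \<in> mm_carrier X \<Longrightarrow> y \<in> mm_carrier X \<Longrightarrow> a * mm_dist X x y \<le> d' x y"
    and ge: "\<And>x y. x \<in> mm_carrier X \<Longrightarrow> y \<in> mm_carrier X \<Longrightarrow> d' x y \<le> b * mm_dist X x y"
  shows "mm_space (d', mm_meas X)"
proof -
  interpret D: Metric_space "mm_carrier X" d' by fact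
  have sub1: "mball x (r / b) \<subseteq> D.mball x r" for x r
  proof
    fix y assume "y \<in> mball x (r / b)"
    then show "y \<in> D.mball x r"
      using ge[of x y] \<open>b > 0\<close> by (auto simp: field_simps)
  qed
  have sub2: "D.mball x (a * r) \<subseteq> mball x r" for x r
  proof
    fix y assume "y \<in> D.mball x (a * r)"
    then have "a * mm_dist X x y < a * r" using le[of x y] by auto
    then show "y \<in> mball x r"
      using \<open>y \<in> D.mball x (a * r)\<close> \<open>a > 0\<close> by simp
  qed
  have top: "D.mtopology = mtopology"
  proof (subst topology_eq, intro allI iffI)
    fix U assume "openin D.mtopology U"
    then show "openin mtopology U"
      unfolding D.openin_mtopology openin_mtopology using sub1 \<open>b > 0\<close>
      by (meson divide_pos_pos order_trans)
  next
    fix U assume "openin mtopology U"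
    then show "openin D.mtopology U"
      unfolding D.openin_mtopology openin_mtopology using sub2 \<open>a > 0\<close>
      by (meson mult_pos_pos order_trans)
  qed
  have "D.mcomplete"
    unfolding D.mcomplete_def
  proof (intro allI impI)
    fix s assume s: "D.MCauchy s"
    have "MCauchy s"
      unfolding MCauchy_def
    proof (intro conjI allI impI)
      show "range s \<subseteq> mm_carrier X" using s by (simp add: D.MCauchy_def)
      fix \<epsilon> :: real assume "\<epsilon> > 0"
      then have "a * \<epsilon> > 0" using \<open>a > 0\<close> by simp
      then obtain N where N: "\<And>n n'. N \<le> n \<Longrightarrow> N \<le> n' \<Longrightarrow> d' (s n) (s n') < a * \<epsilon>"
        using s unfolding D.MCauchy_def by blast
      show "\<exists>N. \<forall>n n'. N \<le> n \<longrightarrow> N \<le> n' \<longrightarrow> mm_dist X (s n) (s n') < \<epsilon>"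
      proof (intro exI allI impI)
        fix n n' assume "N \<le> n" "N \<le> n'"
        then have "a * mm_dist X (s n) (s n') < a * \<epsilon>"
        proof -
          have "s n \<in> mm_carrier X" "s n' \<in> mm_carrier X" using s by (auto simp: D.MCauchy_def)
          then show ?thesis using le N[OF \<open>N \<le> n\<close> \<open>N \<le> n'\<close>] by (meson le_less_trans)
        qed
        then show "mm_dist X (s n) (s n') < \<epsilon>" using \<open>a > 0\<close> by simp
      qed
    qed
    then show "\<exists>x. limitin D.mtopology s x sequentially"
      using mm_complete by (simp add: top mcomplete_def)
  qed
  moreover have "measure (mm_meas X) (D.mball x r) > 0" if "x \<in> mm_carrier X" "r > 0" for x r
  proof -
    have "0 < prob (mball x (r / b))" using that \<open>b > 0\<close> by (intro mm_support) auto
    also have "\<dots> \<le> prob (D.mball x r)"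
    proof (rule finite_measure_mono[OF sub1])
      show "D.mball x r \<in> events"
        using D.openin_mball[of x r] by (intro openin_sets) (simp add: top)
    qed
    finally show ?thesis .
  qed
  ultimately show ?thesis
    unfolding mm_space_def mm_top_def
    using d' mm_separable sets_mm prob_space_axioms
    by (simp add: space_mm top)
qed

end

lemma mm_scale_sel [simp]:
  "mm_dist (mm_scale t X) = (\<lambda>x y. t * mm_dist X x y)"
  "mm_meas (mm_scale t X) = mm_meas X"
  "mm_carrier (mm_scale t X) = mm_carrier X"
  by (simp_all add: mm_scale_def mm_carrier_def)

lemma mm_scale_scale [simp]: "mm_scale s (mm_scale t X) = mm_scale (s * t) X"
  by (simp add: mm_scale_def mult.assoc)

lemma mm_scale_1 [simp]: "mm_scale 1 X = X"
  by (simp add: mm_scale_def mm_dist_def mm_meas_def)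

lemma mm_space_scale:
  assumes "mm_space X" "t > 0"
  shows "mm_space (mm_scale t X)"
proof -
  interpret mm X by standard fact
  have "Metric_space (mm_carrier X) (\<lambda>x y. t * mm_dist X x y)"
    using \<open>t > 0\<close> triangle commute
    by unfold_locales (auto simp: zero simp flip: distrib_left)
  from bilipschitz_mm_space[OF this, of t t] show ?thesis
    using \<open>t > 0\<close> by (simp add: mm_scale_def)
qed

lemma lip_le_scale:
  assumes "lip_le Y X" "t > 0"
  shows "lip_le (mm_scale t Y) (mm_scale t X)"
proof -
  obtain f where "f \<in> measurable (mm_meas X) (mm_meas Y)" "distr (mm_meas X) (mm_meas Y) f = mm_meas Y"
    "\<forall>x\<in>mm_carrier X. \<forall>x'\<in>mm_carrier X. mm_dist Y (f x) (f x') \<le> mm_dist X x x'"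
    using assms(1) unfolding lip_le_def by blast
  then show ?thesis
    unfolding lip_le_def using assms(2) by (intro exI[of _ f]) simp
qed

lemma lip_le_identity:
  assumes "mm_space X" "\<And>x y. x \<in> mm_carrier X \<Longrightarrow> y \<in> mm_carrier X \<Longrightarrow> d' x y \<le> mm_dist X x y"
  shows "lip_le (d', mm_meas X) X"
  unfolding lip_le_def using assms by (intro exI[of _ "\<lambda>x. x"]) (simp add: distr_id)

lemma mm_scale_lip_le:
  assumes "mm_space X" "t \<le> 1"
  shows "lip_le (mm_scale t X) X"
proof -
  interpret mm X by standard fact
  show ?thesis
    unfolding mm_scale_def using assms
    using mult_right_mono[OF \<open>t \<le> 1\<close> nonneg] by (intro lip_le_identity) auto
qed

text \<open>The error \<open>(t - s) * mm_dist X x y\<close> is unbounded on an unbounded space, so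
  parameters are restricted to those that \<phi> sends into a large ball. The resulting \<delta>
  depends on X, t and \<epsilon> only and serves all Y and s at once.\<close>

lemma box_admissible_scale:
  assumes "mm_space X" "t > 0" "\<epsilon> > 0"
  obtains \<delta> where "\<delta> > 0" "\<And>Y s. \<bar>s - t\<bar> < \<delta> \<Longrightarrow> s > 0 \<Longrightarrow> mm_space Y \<Longrightarrow> box_admissible X Y \<delta> \<Longrightarrow>
    box_admissible (mm_scale t X) (mm_scale s Y) \<epsilon>"
proof -
  interpret mm X by standard fact
  interpret U: prob_space unit_interval_leb by (rule prob_space_unit_interval_leb)
  obtain x where x: "x \<in> mm_carrier X" using carrier_ne by blast
  obtain R where R: "R > 0" "prob (mball x R) > 1 - \<epsilon> / 2"
    using mm_big_ball[of "\<epsilon>/2" x] x \<open>\<epsilon> > 0\<close> by auto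
  \<comment> \<open>Inside the ball distances are below 2R, and \<delta> \<le> 1 gives s \<le> t +
    1, so the error is at most \<delta>(2R) + (t + 1)\<delta> \<le> \<epsilon>. The bound \<delta>
    \<le> \<epsilon>/2 leaves room for the parameters outside the ball.\<close>
  define \<delta> where "\<delta> = min (\<epsilon> / 2) (min 1 (\<epsilon> / (2 * R + t + 1)))"
  have \<delta>: "\<delta> > 0" "\<delta> \<le> \<epsilon> / 2" "\<delta> \<le> 1" "\<delta> * (2 * R + t + 1) \<le> \<epsilon>"
  proof -
    have "\<delta> \<le> \<epsilon> / (2 * R + t + 1)" by (simp add: \<delta>_def)
    then show "\<delta> * (2 * R + t + 1) \<le> \<epsilon>" using \<open>t > 0\<close> R(1) by (simp add: field_simps)
    show "\<delta> \<le> \<epsilon> / 2" unfolding \<delta>_def by (rule min.cobounded1)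
  qed (use \<open>\<epsilon> > 0\<close> \<open>t > 0\<close> R(1) in \<open>auto simp: \<delta>_def\<close>)
  show ?thesis
  proof (rule that[OF \<delta>(1)])
    fix Y s assume s: "\<bar>s - t\<bar> < \<delta>" "s > 0" and "mm_space Y" and adm: "box_admissible X Y \<delta>"
    obtain \<phi> \<psi> I0 where *: "\<phi> \<in> measurable unit_interval_leb (mm_meas X)"
      "distr unit_interval_leb (mm_meas X) \<phi> = mm_meas X"
      "\<psi> \<in> measurable unit_interval_leb (mm_meas Y)"
      "distr unit_interval_leb (mm_meas Y) \<psi> = mm_meas Y" "I0 \<in> sets unit_interval_leb"
      "measure unit_interval_leb I0 \<ge> 1 - \<delta>"
      "\<And>s t. s\<in>I0 \<Longrightarrow> t\<in>I0 \<Longrightarrow> \<bar>mm_dist X (\<phi> s) (\<phi> t) - mm_dist Y (\<psi> s) (\<psi> t)\<bar> \<le> \<delta>"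
      using adm unfolding box_admissible_def by blast
    define B where "B = \<phi> -` mball x R \<inter> space unit_interval_leb"
    have ball: "mball x R \<in> events" by (intro openin_sets) simp
    have B: "B \<in> sets unit_interval_leb"
      unfolding B_def using *(1) ball by (rule measurable_sets)
    have "U.prob B = measure (distr unit_interval_leb (mm_meas X) \<phi>) (mball x R)"
      unfolding B_def using *(1) ball by (simp add: measure_distr)
    then have PB: "U.prob B > 1 - \<epsilon> / 2" using R(2) *(2) by simp
    have I: "U.prob (I0 \<inter> B) \<ge> 1 - \<epsilon>"
    proof -
      have "U.prob (space unit_interval_leb - I0 \<inter> B) = U.prob ((space unit_interval_leb - I0) \<union> (space unit_interval_leb - B))"
        by (rule arg_cong[where f=U.prob]) auto
      also have "\<dots> \<le> U.prob (space unit_interval_leb - I0) + U.prob (space unit_interval_leb - B)"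
        using *(5) B by (intro measure_Un_le sets.compl_sets)
      finally show ?thesis
        using *(5,6) B PB \<delta>(2) by (simp add: U.prob_compl del: space_unit_interval_leb)
    qed
    show "box_admissible (mm_scale t X) (mm_scale s Y) \<epsilon>"
      unfolding box_admissible_def
    proof (intro conjI exI ballI)
      show "1 - \<epsilon> \<le> measure unit_interval_leb (I0 \<inter> B)" by (rule I)
      show "I0 \<inter> B \<in> sets unit_interval_leb" using *(5) B by blast
      fix u v assume uv: "u \<in> I0 \<inter> B" "v \<in> I0 \<inter> B"
      let ?dx = "mm_dist X (\<phi> u) (\<phi> v)" and ?dy = "mm_dist Y (\<psi> u) (\<psi> v)"
      have dx: "?dx < 2 * R" "?dx \<ge> 0"
        using triangle''[of "\<phi> u" x "\<phi> v"] uv by (auto simp: B_def)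
      have "t * ?dx - s * ?dy = (t - s) * ?dx + s * (?dx - ?dy)" by (simp add: algebra_simps)
      then have "\<bar>t * ?dx - s * ?dy\<bar> \<le> \<bar>t - s\<bar> * \<bar>?dx\<bar> + \<bar>s\<bar> * \<bar>?dx - ?dy\<bar>"
        by (metis abs_mult abs_triangle_ineq)
      also have "\<dots> \<le> \<delta> * (2 * R) + (t + 1) * \<delta>"
        using s dx *(7)[of u v] uv \<delta> by (intro add_mono mult_mono) auto
      also have "\<dots> \<le> \<epsilon>" using \<delta>(4) by (simp add: algebra_simps)
      finally show "\<bar>mm_dist (mm_scale t X) (\<phi> u) (\<phi> v) - mm_dist (mm_scale s Y) (\<psi> u) (\<psi> v)\<bar> \<le> \<epsilon>"
        by simp
    qed (use * \<open>\<epsilon> > 0\<close> in simp_all)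
  qed
qed

lemma pyr_scale_scale [simp]: "pyr_scale s (pyr_scale t P) = pyr_scale (s * t) P"
  by (auto simp: pyr_scale_def image_iff)

lemma pyr_scale_1 [simp]: "pyr_scale 1 P = P"
  by (simp add: pyr_scale_def)

lemma in_pyr_scale_iff:
  assumes "t > 0"
  shows "X \<in> pyr_scale t P \<longleftrightarrow> mm_scale (1 / t) X \<in> P"
proof
  assume "X \<in> pyr_scale t P"
  then show "mm_scale (1 / t) X \<in> P" using assms by (auto simp: pyr_scale_def)
next
  assume "mm_scale (1 / t) X \<in> P"
  then have "mm_scale t (mm_scale (1 / t) X) \<in> pyr_scale t P" unfolding pyr_scale_def by blast
  then show "X \<in> pyr_scale t P" using assms by simp
qed

lemma box_near_scale:
  assumes "mm_space X" "t > 0" "\<epsilon> > 0"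
  obtains \<delta> where "\<delta> > 0" "\<And>P s. \<bar>s - t\<bar> < \<delta> \<Longrightarrow> s > 0 \<Longrightarrow> pyramid P \<Longrightarrow> box_near X P \<delta> \<Longrightarrow>
    box_near (mm_scale t X) (pyr_scale s P) \<epsilon>"
proof -
  obtain \<delta> where \<delta>: "\<delta> > 0" "\<And>Y s. \<bar>s - t\<bar> < \<delta> \<Longrightarrow> s > 0 \<Longrightarrow> mm_space Y \<Longrightarrow> box_admissible X Y \<delta> \<Longrightarrow>
    box_admissible (mm_scale t X) (mm_scale s Y) \<epsilon>"
    using box_admissible_scale[OF assms] by blast
  show ?thesis
  proof (rule that[OF \<delta>(1)])
    fix P s assume *: "\<bar>s - t\<bar> < \<delta>" "s > 0" "pyramid P" "box_near X P \<delta>"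
    then obtain Y where "Y \<in> P" "box_admissible X Y \<delta>" by (auto simp: box_near_def)
    then have "box_admissible (mm_scale t X) (mm_scale s Y) \<epsilon>"
      using * by (intro \<delta>(2) pyramid_mm)
    then show "box_near (mm_scale t X) (pyr_scale s P) \<epsilon>"
      unfolding box_near_def pyr_scale_def using \<open>Y \<in> P\<close> by blast
  qed
qed

lemma box_near_unscale:
  assumes P: "pyramid P" and X: "mm_space X" and "t > 0" "\<epsilon> > 0"
  obtains \<delta> where "\<delta> > 0" "box_near X (pyr_scale t P) \<delta> \<Longrightarrow> box_near (mm_scale (1 / t) X) P \<epsilon>"
proof -
  obtain \<delta> where \<delta>: "\<delta> > 0" "\<And>Y s. \<bar>s - 1 / t\<bar> < \<delta> \<Longrightarrow> s > 0 \<Longrightarrow> mm_space Y \<Longrightarrow> box_admissible X Y \<delta> \<Longrightarrow>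
    box_admissible (mm_scale (1 / t) X) (mm_scale s Y) \<epsilon>"
    using box_admissible_scale[OF X, of "1 / t" \<epsilon>] \<open>t > 0\<close> \<open>\<epsilon> > 0\<close>
    by (metis zero_less_divide_1_iff)
  show ?thesis
  proof (rule that[OF \<delta>(1)])
    assume "box_near X (pyr_scale t P) \<delta>"
    then obtain Y where Y: "Y \<in> P" "box_admissible X (mm_scale t Y) \<delta>"
      by (auto simp: box_near_def pyr_scale_def)
    have "box_admissible (mm_scale (1 / t) X) (mm_scale (1 / t) (mm_scale t Y)) \<epsilon>"
      using \<delta> \<open>t > 0\<close> Y by (intro \<delta>(2) mm_space_scale pyramid_mm[OF P]) auto
    then show "box_near (mm_scale (1 / t) X) P \<epsilon>"
      using Y(1) \<open>t > 0\<close> by (auto simp: box_near_def)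
  qed
qed

lemma pyramid_scale:
  assumes P: "pyramid P" and "t > 0"
  shows "pyramid (pyr_scale t P)"
proof -
  have mm': "mm_space X" if "X \<in> pyr_scale t P" for X
    using that \<open>t > 0\<close> pyramid_mm[OF P] mm_space_scale by (auto simp: pyr_scale_def)
  have ne: "pyr_scale t P \<noteq> {}" using pyramid_ne[OF P] by (simp add: pyr_scale_def)
  show ?thesis
    unfolding pyramid_def
  proof (intro conjI ballI allI impI)
    fix X Y assume X: "X \<in> pyr_scale t P" and Y: "mm_space Y \<and> lip_le Y X"
    have "lip_le (mm_scale (1/t) Y) (mm_scale (1/t) X)"
      using Y \<open>t > 0\<close> by (intro lip_le_scale) auto
    then show "Y \<in> pyr_scale t P"
      using X Y \<open>t > 0\<close> pyramid_down[OF P] mm_space_scale by (auto simp: in_pyr_scale_iff)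
  next
    fix Y Y' assume "Y \<in> pyr_scale t P" "Y' \<in> pyr_scale t P"
    then obtain Z Z' where Z: "Z \<in> P" "Z' \<in> P" "Y = mm_scale t Z" "Y' = mm_scale t Z'"
      by (auto simp: pyr_scale_def)
    then obtain X where "X \<in> P" "lip_le Z X" "lip_le Z' X" using P unfolding pyramid_def by blast
    then show "\<exists>X\<in>pyr_scale t P. lip_le Y X \<and> lip_le Y' X"
      using Z \<open>t > 0\<close> by (auto simp: pyr_scale_def intro: lip_le_scale)
  next
    fix X assume X: "mm_space X \<and> box_set X (pyr_scale t P) = 0"
    have "mm_scale (1 / t) X \<in> P"
    proof (rule pyramid_closed[OF P])
      show "mm_space (mm_scale (1 / t) X)" using X \<open>t > 0\<close> by (intro mm_space_scale) auto
      fix \<epsilon> :: real assume "\<epsilon> > 0"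
      obtain \<delta> where \<delta>: "\<delta> > 0" "box_near X (pyr_scale t P) \<delta> \<Longrightarrow> box_near (mm_scale (1 / t) X) P \<epsilon>"
        using box_near_unscale[OF P _ \<open>t > 0\<close> \<open>\<epsilon> > 0\<close>] X by blast
      have "box_near X (pyr_scale t P) \<delta>"
        using box_set_lessD[OF ne mm'] X \<delta>(1) by simp
      then show "box_near (mm_scale (1 / t) X) P \<epsilon>" by (rule \<delta>(2))
    qed
    then show "X \<in> pyr_scale t P" using \<open>t > 0\<close> by (simp add: in_pyr_scale_iff)
  qed (use mm' ne in auto)
qed

text \<open>Joint sequential continuity of the action. Members of tP are approached by rescaling
  witnesses; a space outside tP stays far, because its nearness to
  \<open>pyr_scale (ts n) (Ps n)\<close> could be scaled back by \<open>1 / ts n\<close>, which is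
  close to 1/t.\<close>

lemma weak_conv_scale:
  assumes Ps: "\<And>n. pyramid (Ps n)" and P: "pyramid P" and conv: "weak_conv Ps P"
    and ts: "ts \<longlonglongrightarrow> t" "\<And>n. ts n > 0" and "t > 0"
  shows "weak_conv (\<lambda>n. pyr_scale (ts n) (Ps n)) (pyr_scale t P)"
proof (subst weak_conv_iff, goal_cases)
  case (1 n) then show ?case using Ps ts by (intro pyramid_scale)
next
  case 2 then show ?case using P \<open>t > 0\<close> by (intro pyramid_scale)
next
  case 3
  show ?case
  proof (intro conjI ballI allI impI)
    fix X and \<epsilon> :: real assume X: "X \<in> pyr_scale t P" and "\<epsilon> > 0"
    then obtain Y where Y: "Y \<in> P" "X = mm_scale t Y" by (auto simp: pyr_scale_def)
    obtain \<delta> where \<delta>: "\<delta> > 0" "\<And>Q s. \<bar>s - t\<bar> < \<delta> \<Longrightarrow> s > 0 \<Longrightarrow> pyramid Q \<Longrightarrow> box_near Y Q \<delta> \<Longrightarrow>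
      box_near (mm_scale t Y) (pyr_scale s Q) \<epsilon>"
      using box_near_scale[OF pyramid_mm[OF P Y(1)] \<open>t > 0\<close> \<open>\<epsilon> > 0\<close>] by blast
    have "\<forall>\<^sub>F n in sequentially. \<bar>ts n - t\<bar> < \<delta>"
      using tendstoD[OF ts(1) \<delta>(1)] by (simp add: dist_real_def)
    moreover have "\<forall>\<^sub>F n in sequentially. box_near Y (Ps n) \<delta>"
      by (rule weak_conv_nearD[OF Ps P conv Y(1) \<delta>(1)])
    ultimately show "\<forall>\<^sub>F n in sequentially. box_near X (pyr_scale (ts n) (Ps n)) \<epsilon>"
      unfolding Y(2) by eventually_elim (use Ps ts in \<open>intro \<delta>(2)\<close>)
  next
    fix X assume X: "mm_space X \<and> X \<notin> pyr_scale t P"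
    then have "mm_space (mm_scale (1 / t) X)" "mm_scale (1 / t) X \<notin> P"
      using \<open>t > 0\<close> by (auto simp: in_pyr_scale_iff mm_space_scale)
    then obtain \<epsilon> where \<epsilon>: "\<epsilon> > 0" "\<forall>\<^sub>F n in sequentially. \<not> box_near (mm_scale (1 / t) X) (Ps n) \<epsilon>"
      using weak_conv_farD[OF Ps P conv] by blast
    have "1 / t > 0" using \<open>t > 0\<close> by simp
    then obtain \<delta> where \<delta>: "\<delta> > 0" "\<And>Q s. \<bar>s - 1 / t\<bar> < \<delta> \<Longrightarrow> s > 0 \<Longrightarrow> pyramid Q \<Longrightarrow> box_near X Q \<delta> \<Longrightarrow>
      box_near (mm_scale (1 / t) X) (pyr_scale s Q) \<epsilon>"
      using box_near_scale[OF conjunct1[OF X] _ \<open>\<epsilon> > 0\<close>] by blast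
    have "(\<lambda>n. 1 / ts n) \<longlonglongrightarrow> 1 / t" using ts(1) \<open>t > 0\<close> by (intro tendsto_intros) auto
    from tendstoD[OF this \<delta>(1)]
    have "\<forall>\<^sub>F n in sequentially. \<bar>1 / ts n - 1 / t\<bar> < \<delta>" by (simp add: dist_real_def)
    with \<epsilon>(2) have "\<forall>\<^sub>F n in sequentially. \<not> box_near X (pyr_scale (ts n) (Ps n)) \<delta>"
    proof eventually_elim
      case (elim n)
      have "ts n > 0" by (rule ts)
      then have "1 / ts n > 0" "pyr_scale (1 / ts n) (pyr_scale (ts n) (Ps n)) = Ps n" by auto
      then show ?case
        using \<delta>(2)[OF elim(2) _ pyramid_scale[OF Ps \<open>ts n > 0\<close>]] elim(1) by auto
    qed
    then show "\<exists>\<epsilon>>0. \<forall>\<^sub>F n in sequentially. \<not> box_near X (pyr_scale (ts n) (Ps n)) \<epsilon>"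
      using \<delta>(1) by blast
  qed
qed

text \<open>Shrinking a space is a 1-Lipschitz map, so the orbit of a pyramid is a chain under
  inclusion; all monotonicity in the scale comes from here.\<close>

lemma pyr_scale_subset:
  assumes P: "pyramid P" and "0 < t" "t \<le> 1"
  shows "pyr_scale t P \<subseteq> P"
  unfolding pyr_scale_def
  using assms pyramid_down[OF P] mm_scale_lip_le mm_space_scale pyramid_mm[OF P] by blast

lemma pyr_scale_mono: "P \<subseteq> Q \<Longrightarrow> pyr_scale t P \<subseteq> pyr_scale t Q"
  unfolding pyr_scale_def by blast

section \<open>Laws of 1-Lipschitz functions\<close>

definition law_support :: "real measure \<Rightarrow> real set" where
  "law_support \<nu> = {x. \<forall>r>0. measure \<nu> (ball x r) > 0}"

text \<open>Points outside the support are removed because an mm-space must have full support; this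
  makes a law on the line a space that can belong to a pyramid.\<close>

definition law_space :: "real measure \<Rightarrow> mmspace" where
  "law_space \<nu> = (dist, restrict_space \<nu> (law_support \<nu>))"

context real_distribution
begin

lemma closed_law_support: "closed (law_support M)"
proof -
  have "open (- law_support M)"
    unfolding open_contains_ball
  proof
    fix x assume "x \<in> - law_support M"
    then obtain r where r: "r > 0" "prob (ball x r) \<le> 0"
      by (auto simp: law_support_def not_less)
    have "ball x (r / 2) \<subseteq> - law_support M"
    proof
      fix y assume y: "y \<in> ball x (r / 2)"
      have "ball y (r / 2) \<subseteq> ball x r"
      proof
        fix z assume "z \<in> ball y (r / 2)"
        then show "z \<in> ball x r" using y dist_triangle[of x z y] by simp
      qed
      then have "prob (ball y (r / 2)) \<le> prob (ball x r)"
        by (intro finite_measure_mono) auto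
      then show "y \<in> - law_support M"
        using r by (auto simp: law_support_def not_less intro!: exI[of _ "r / 2"])
    qed
    then show "\<exists>e>0. ball x e \<subseteq> - law_support M"
      using r(1) by (intro exI[of _ "r / 2"]) auto
  qed
  then show ?thesis by (simp add: closed_def)
qed

lemma law_support_sets [measurable]: "law_support M \<in> sets borel"
  using closed_law_support by (rule borel_closed)

text \<open>The complement of the support is covered by null balls, and by Lindelof countably many
  of them suffice.\<close>

lemma prob_law_support: "prob (law_support M) = 1"
proof -
  define F where "F = {ball x r | x r. prob (ball x r) = 0}"
  obtain F' where F': "F' \<subseteq> F" "countable F'" "\<Union>F' = \<Union>F"
    by (rule Lindelof[of F]) (auto simp: F_def)
  have "- law_support M \<subseteq> \<Union>F"
  proof
    fix x assume "x \<in> - law_support M"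
    then obtain r where "r > 0" "prob (ball x r) = 0"
      by (auto simp: law_support_def not_less measure_le_0_iff)
    then show "x \<in> \<Union>F" unfolding F_def by (auto intro!: exI[of _ "ball x r"])
  qed
  then have sub: "- law_support M \<subseteq> (\<Union>A\<in>F'. A)" using F'(3) by auto
  have "(\<Union>A\<in>F'. A) \<in> null_sets M"
    using F'(1,2) by (intro null_sets_UN') (auto simp: F_def null_sets_def emeasure_eq_measure)
  then have "- law_support M \<in> null_sets M"
    by (rule null_sets_subset[OF _ _ sub]) auto
  then have "prob (- law_support M) = 0" by (rule measure_eq_0_null_sets)
  then show ?thesis
    using prob_compl[of "law_support M"] by (simp add: Compl_eq_Diff_UNIV)
qed

lemma AE_law_support: "AE x in M. x \<in> law_support M"
  using prob_law_support by (subst prob_Collect_eq_1[symmetric]) (auto simp: pred_def)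

lemma law_space_sel [simp]:
  "mm_dist (law_space M) = dist" "mm_meas (law_space M) = restrict_space M (law_support M)"
  "mm_carrier (law_space M) = law_support M"
  by (simp_all add: law_space_def space_restrict_space)

text \<open>A closed subset of the line inherits completeness and separability, and its balls keep
  the mass of the balls of the line because the support has full measure.\<close>

lemma mm_space_law: "mm_space (law_space M)"
proof -
  interpret S: Submetric "UNIV :: real set" dist "law_support M"
    by unfold_locales simp
  have "closedin (Met_TC.mtopology :: real topology) (law_support M)"
    using closed_law_support by simp
  then have compl: "S.sub.mcomplete"
    by (rule S.closedin_mcomplete_imp_mcomplete) (simp add: complete_UNIV)
  have top: "S.sub.mtopology = top_of_set (law_support M)"
    using S.mtopology_submetric by simp
  have sep: "separable_space S.sub.mtopology"
    unfolding top
    by (intro second_countable_imp_separable_space second_countable_subtopology second_countable_euclidean)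
  have "sets (restrict_space M (law_support M)) = (\<inter>) (law_support M) ` sigma_sets UNIV {U. open U}"
    by (simp add: sets_restrict_space borel_def sets_measure_of)
  also have "\<dots> = sigma_sets (law_support M) ((\<inter>) (law_support M) ` {U. open U})"
    using law_support_sets by (intro sigma_sets_Int) (auto simp: borel_def sets_measure_of)
  also have "(\<inter>) (law_support M) ` {U. open U} = {U. openin (top_of_set (law_support M)) U}"
    by (auto simp: openin_open)
  finally have sets: "sets (restrict_space M (law_support M)) = sigma_sets (law_support M) {U. openin S.sub.mtopology U}"
    by (simp add: top)
  have prob: "prob_space (restrict_space M (law_support M))"
    using prob_law_support by (intro prob_space_restrict_space) (auto simp: emeasure_eq_measure)
  have pos: "0 < measure (restrict_space M (law_support M)) (S.sub.mball x r)"
    if "x \<in> law_support M" "r > 0" for x r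
  proof -
    have eq: "S.sub.mball x r = ball x r \<inter> law_support M" using that by auto
    have "measure (restrict_space M (law_support M)) (S.sub.mball x r) = prob (ball x r \<inter> law_support M)"
      unfolding eq by (subst measure_restrict_space) auto
    also have "\<dots> = prob (ball x r)"
      using AE_law_support by (intro finite_measure_eq_AE) auto
    finally show ?thesis using that by (simp add: law_support_def)
  qed
  show ?thesis
    unfolding mm_space_def mm_top_def
    using S.sub.Metric_space_axioms compl sep sets prob pos by simp
qed

end

section \<open>Observables of a space and their laws\<close>

definition lipschitz_observable :: "mmspace \<Rightarrow> (real \<Rightarrow> real) \<Rightarrow> bool" where
  "lipschitz_observable X f \<longleftrightarrow>
    (\<forall>x\<in>mm_carrier X. \<forall>y\<in>mm_carrier X. \<bar>f x - f y\<bar> \<le> mm_dist X x y)"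

lemma lipschitz_observableD:
  "lipschitz_observable X f \<Longrightarrow> x \<in> mm_carrier X \<Longrightarrow> y \<in> mm_carrier X \<Longrightarrow> \<bar>f x - f y\<bar> \<le> mm_dist X x y"
  by (simp add: lipschitz_observable_def)

lemma (in mm) observable_measurable:
  "lipschitz_observable X f \<Longrightarrow> f \<in> borel_measurable (mm_meas X)"
  by (rule lipschitz_measurable) (rule lipschitz_observableD)

lemma (in mm) observable_law:
  "lipschitz_observable X f \<Longrightarrow> real_distribution (distr (mm_meas X) borel f)"
  by (rule real_distribution_distr) (rule observable_measurable)

text \<open>Full support of X forces every value of f, not only almost every one, into the support
  of the law; hence f maps into \<open>law_space\<close>.\<close>

lemma (in mm) observable_in_support:
  assumes f: "lipschitz_observable X f" and x: "x \<in> mm_carrier X"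
  shows "f x \<in> law_support (distr (mm_meas X) borel f)"
  unfolding law_support_def
proof (intro CollectI allI impI)
  fix r :: real assume "r > 0"
  note [measurable] = observable_measurable[OF f]
  have "0 < prob (mball x r)" using x \<open>r > 0\<close> by (rule mm_support)
  also have "\<dots> \<le> prob (f -` ball (f x) r \<inter> space (mm_meas X))"
  proof (rule finite_measure_mono)
    show "mball x r \<subseteq> f -` ball (f x) r \<inter> space (mm_meas X)"
    proof
      fix y assume y: "y \<in> mball x r"
      then have "\<bar>f x - f y\<bar> < r" using lipschitz_observableD[OF f x, of y] by auto
      then show "y \<in> f -` ball (f x) r \<inter> space (mm_meas X)"
        using y by (auto simp: space_mm dist_real_def)
    qed
  qed (rule measurable_sets[OF observable_measurable[OF f]], simp)
  also have "\<dots> = measure (distr (mm_meas X) borel f) (ball (f x) r)"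
    by (simp add: measure_distr)
  finally show "0 < measure (distr (mm_meas X) borel f) (ball (f x) r)" .
qed

text \<open>The observable itself is the dominating 1-Lipschitz map, so a pyramid contains the laws
  of all observables of its members.\<close>

lemma (in mm) law_space_lip_le:
  assumes f: "lipschitz_observable X f"
  shows "lip_le (law_space (distr (mm_meas X) borel f)) X"
proof -
  let ?\<nu> = "distr (mm_meas X) borel f"
  interpret \<nu>: real_distribution ?\<nu> using f by (rule observable_law)
  have meas: "f \<in> measurable (mm_meas X) (restrict_space ?\<nu> (law_support ?\<nu>))"
    using observable_measurable[OF f] observable_in_support[OF f]
    by (intro measurable_restrict_space2) (auto simp: space_mm)
  have "distr (mm_meas X) (restrict_space ?\<nu> (law_support ?\<nu>)) f = restrict_space ?\<nu> (law_support ?\<nu>)"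
  proof (rule measure_eqI)
    fix A assume A: "A \<in> sets (distr (mm_meas X) (restrict_space ?\<nu> (law_support ?\<nu>)) f)"
    then have A': "A \<in> sets borel" "A \<subseteq> law_support ?\<nu>"
      using \<nu>.law_support_sets by (auto simp: sets_restrict_space)
    show "emeasure (distr (mm_meas X) (restrict_space ?\<nu> (law_support ?\<nu>)) f) A =
      emeasure (restrict_space ?\<nu> (law_support ?\<nu>)) A"
      using A A' meas observable_measurable[OF f] by (simp add: emeasure_distr emeasure_restrict_space)
  qed simp
  then show ?thesis
    unfolding lip_le_def using meas f
    by (intro exI[of _ f]) (auto simp: dist_real_def lipschitz_observable_def)
qed

text \<open>When both variables are \<delta>-close at two sample points, the distances between the
  two samples differ by at most 2\<delta>, one \<delta> for each endpoint; \<Omega> itself serves as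
  the coupling.\<close>

lemma law_box_admissible:
  assumes \<Omega>: "prob_space \<Omega>" and a[measurable]: "a \<in> borel_measurable \<Omega>" and b[measurable]: "b \<in> borel_measurable \<Omega>"
    and "\<delta> \<ge> 0" and close: "measure \<Omega> {\<omega> \<in> space \<Omega>. \<bar>a \<omega> - b \<omega>\<bar> \<le> \<delta>} \<ge> 1 - \<delta>"
  shows "box_admissible (law_space (distr \<Omega> borel a)) (law_space (distr \<Omega> borel b)) (2 * \<delta>)"
proof -
  interpret \<Omega>: prob_space \<Omega> by fact
  have coupled: "\<exists>p. p \<in> measurable \<Omega> (restrict_space (distr \<Omega> borel c) (law_support (distr \<Omega> borel c))) \<and>
      distr \<Omega> (restrict_space (distr \<Omega> borel c) (law_support (distr \<Omega> borel c))) p =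
        restrict_space (distr \<Omega> borel c) (law_support (distr \<Omega> borel c)) \<and>
      (AE \<omega> in \<Omega>. p \<omega> = c \<omega>)" if c[measurable]: "c \<in> borel_measurable \<Omega>" for c
  proof -
    let ?\<nu> = "distr \<Omega> borel c" and ?S = "law_support (distr \<Omega> borel c)"
    interpret \<nu>: real_distribution ?\<nu> using c by (rule \<Omega>.real_distribution_distr)
    obtain x0 where x0: "x0 \<in> ?S" using \<nu>.prob_law_support by (metis all_not_in_conv measure_empty zero_neq_one)
    have [measurable]: "?S \<in> sets borel" by (rule \<nu>.law_support_sets)
    \<comment> \<open>Values outside the support occur with probability 0 and are sent to a fixed
      point \<open>x0\<close> of it, so that \<open>p\<close> maps into the carrier
      everywhere.\<close>
    define p where "p \<omega> = (if c \<omega> \<in> ?S then c \<omega> else x0)" for \<omega>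
    have p_borel[measurable]: "p \<in> borel_measurable \<Omega>" unfolding p_def by measurable
    have p: "p \<in> measurable \<Omega> (restrict_space ?\<nu> ?S)"
      using x0 by (intro measurable_restrict_space2) (auto simp: p_def[abs_def])
    have "AE \<omega> in \<Omega>. c \<omega> \<in> ?S"
      using \<nu>.AE_law_support by (simp add: AE_distr_iff)
    then have AE: "AE \<omega> in \<Omega>. p \<omega> = c \<omega>" by eventually_elim (simp add: p_def)
    have "distr \<Omega> (restrict_space ?\<nu> ?S) p = restrict_space ?\<nu> ?S"
    proof (rule measure_eqI)
      fix A assume A: "A \<in> sets (distr \<Omega> (restrict_space ?\<nu> ?S) p)"
      then have A': "A \<in> sets borel" "A \<subseteq> ?S"
        by (auto simp: sets_restrict_space)
      have "emeasure (distr \<Omega> (restrict_space ?\<nu> ?S) p) A = emeasure \<Omega> (p -` A \<inter> space \<Omega>)"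
        using A p by (simp add: emeasure_distr)
      also have "\<dots> = emeasure \<Omega> (c -` A \<inter> space \<Omega>)"
        using A' AE by (intro emeasure_eq_AE) auto
      also have "\<dots> = emeasure (restrict_space ?\<nu> ?S) A"
        using A' by (simp add: emeasure_restrict_space emeasure_distr)
      finally show "emeasure (distr \<Omega> (restrict_space ?\<nu> ?S) p) A = emeasure (restrict_space ?\<nu> ?S) A" .
    qed simp
    then show ?thesis using p AE by blast
  qed
  let ?A = "law_space (distr \<Omega> borel a)" and ?B = "law_space (distr \<Omega> borel b)"
  interpret A: real_distribution "distr \<Omega> borel a" using a by (rule \<Omega>.real_distribution_distr)
  interpret B: real_distribution "distr \<Omega> borel b" using b by (rule \<Omega>.real_distribution_distr)
  obtain p where p: "p \<in> measurable \<Omega> (mm_meas ?A)" "distr \<Omega> (mm_meas ?A) p = mm_meas ?A" "AE \<omega> in \<Omega>. p \<omega> = a \<omega>"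
    unfolding A.law_space_sel using coupled[OF a] by blast
  obtain q where q: "q \<in> measurable \<Omega> (mm_meas ?B)" "distr \<Omega> (mm_meas ?B) q = mm_meas ?B" "AE \<omega> in \<Omega>. q \<omega> = b \<omega>"
    unfolding B.law_space_sel using coupled[OF b] by blast
  have pb: "p \<in> borel_measurable \<Omega>" "q \<in> borel_measurable \<Omega>"
    using p(1) q(1) by (auto simp: measurable_restrict_space2_iff)
  note [measurable] = pb
  define W where "W = {z \<in> space (mm_meas ?A \<Otimes>\<^sub>M mm_meas ?B). \<bar>fst z - snd z\<bar> \<le> \<delta>}"
  have fs: "fst \<in> borel_measurable (mm_meas ?A \<Otimes>\<^sub>M mm_meas ?B)" "snd \<in> borel_measurable (mm_meas ?A \<Otimes>\<^sub>M mm_meas ?B)"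
    by (intro measurable_compose[OF measurable_fst] measurable_compose[OF measurable_snd]; simp add: measurable_restrict_space1)+
  note [measurable] = fs
  have W: "W \<in> sets (mm_meas ?A \<Otimes>\<^sub>M mm_meas ?B)" unfolding W_def by measurable
  show ?thesis
  proof (rule box_admissible_coupling[OF A.mm_space_law B.mm_space_law \<Omega> p(1,2) q(1,2) W])
    show "0 \<le> 2 * \<delta>" using \<open>\<delta> \<ge> 0\<close> by simp
    have "measure \<Omega> {\<omega> \<in> space \<Omega>. (p \<omega>, q \<omega>) \<in> W} = measure \<Omega> {\<omega> \<in> space \<Omega>. \<bar>p \<omega> - q \<omega>\<bar> \<le> \<delta>}"
      using measurable_space[OF p(1)] measurable_space[OF q(1)]
      by (intro arg_cong[where f="measure \<Omega>"]) (auto simp: W_def space_pair_measure)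
    also have "\<dots> = measure \<Omega> {\<omega> \<in> space \<Omega>. \<bar>a \<omega> - b \<omega>\<bar> \<le> \<delta>}"
      using p(3) q(3) by (intro \<Omega>.finite_measure_eq_AE) auto
    finally show "1 - 2 * \<delta> \<le> measure \<Omega> {\<omega> \<in> space \<Omega>. (p \<omega>, q \<omega>) \<in> W}"
      using close \<open>\<delta> \<ge> 0\<close> by linarith
    fix x y x' y' assume "(x, y) \<in> W" "(x', y') \<in> W"
    then show "\<bar>mm_dist ?A x x' - mm_dist ?B y y'\<bar> \<le> 2 * \<delta>"
      by (auto simp: W_def dist_real_def)
  qed
qed

text \<open>The infimum \<open>h\<close> is 1-Lipschitz and at most u along p; the almost Lipschitz
  condition keeps it above u - \<delta>. The cut-off at R respects this because u \<le> R. The data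
  are indexed by parameters s because p may identify parameters with different values of u.\<close>

lemma mcshane_extension:
  fixes u :: "'s \<Rightarrow> real" and p :: "'s \<Rightarrow> real"
  assumes Y: "mm_space Y" and p: "\<And>s. s \<in> I \<Longrightarrow> p s \<in> mm_carrier Y"
    and u: "\<And>s. s \<in> I \<Longrightarrow> 0 \<le> u s \<and> u s \<le> R"
    and lip: "\<And>s t. s \<in> I \<Longrightarrow> t \<in> I \<Longrightarrow> u s - u t \<le> mm_dist Y (p s) (p t) + \<delta>"
    and "R \<ge> 0" "\<delta> \<ge> 0"
  obtains g where "lipschitz_observable Y g" "\<And>y. 0 \<le> g y \<and> g y \<le> R" "\<And>s. s \<in> I \<Longrightarrow> \<bar>g (p s) - u s\<bar> \<le> \<delta>"
proof (cases "I = {}")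
  case True
  interpret mm Y by standard fact
  show ?thesis
    by (rule that[of "\<lambda>_. 0"]) (use True \<open>R \<ge> 0\<close> in \<open>auto simp: lipschitz_observable_def\<close>)
next
  case False
  interpret mm Y by standard fact
  define h where "h y = (INF s\<in>I. u s + mm_dist Y (p s) y)" for y
  have bdd: "bdd_below ((\<lambda>s. u s + mm_dist Y (p s) y) ` I)" for y
    using u by (intro bdd_belowI2[of _ 0]) (simp add: add_nonneg_nonneg)
  have h0: "h y \<ge> 0" for y
    unfolding h_def using False u by (intro cINF_greatest) (auto simp: add_nonneg_nonneg)
  have lip1: "h x \<le> h y + mm_dist Y x y" if "x \<in> mm_carrier Y" "y \<in> mm_carrier Y" for x y
  proof -
    have "h x - mm_dist Y x y \<le> h y"
      unfolding h_def[of y]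
    proof (rule cINF_greatest[OF False])
      fix s assume s: "s \<in> I"
      have "h x \<le> u s + mm_dist Y (p s) x"
        unfolding h_def by (rule cINF_lower[OF bdd s])
      also have "mm_dist Y (p s) x \<le> mm_dist Y (p s) y + mm_dist Y x y"
        using triangle[OF p[OF s] that(2,1)] by (simp add: commute)
      finally show "h x - mm_dist Y x y \<le> u s + mm_dist Y (p s) y" by simp
    qed
    then show ?thesis by simp
  qed
  define g where "g y = min R (h y)" for y
  have "\<bar>g x - g y\<bar> \<le> mm_dist Y x y" if "x \<in> mm_carrier Y" "y \<in> mm_carrier Y" for x y
    using lip1[OF that] lip1[OF that(2,1)] nonneg[of x y] commute[of x y] by (auto simp: g_def min_def)
  then have "lipschitz_observable Y g" by (auto simp: lipschitz_observable_def)
  moreover have "\<bar>g (p s) - u s\<bar> \<le> \<delta>" if s: "s \<in> I" for s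
  proof -
    have "h (p s) \<le> u s + mm_dist Y (p s) (p s)"
      unfolding h_def by (rule cINF_lower[OF bdd s])
    then have "h (p s) \<le> u s" using p[OF s] by simp
    moreover have "u s - \<delta> \<le> h (p s)"
      unfolding h_def
    proof (rule cINF_greatest[OF False])
      fix t assume "t \<in> I"
      then show "u s - \<delta> \<le> u t + mm_dist Y (p t) (p s)" using lip[OF s, of t] by (simp add: commute)
    qed
    ultimately show ?thesis using u[OF s] \<open>\<delta> \<ge> 0\<close> by (auto simp: g_def min_def)
  qed
  ultimately show ?thesis using that[of g] h0 \<open>R \<ge> 0\<close> by (auto simp: g_def)
qed

section \<open>A continuous functional on pyramids\<close>

text \<open>The fixed range [0,R] makes these laws tight, so that sequences of them have weak
  limits.\<close>

definition observable_laws :: "mmspace set \<Rightarrow> real \<Rightarrow> real measure set" where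
  "observable_laws P R = {distr (mm_meas X) borel f | X f. X \<in> P \<and> lipschitz_observable X f \<and>
    (\<forall>x\<in>mm_carrier X. 0 \<le> f x \<and> f x \<le> R)}"

lemma observable_lawsI:
  "X \<in> P \<Longrightarrow> lipschitz_observable X f \<Longrightarrow> (\<And>x. x \<in> mm_carrier X \<Longrightarrow> 0 \<le> f x \<and> f x \<le> R) \<Longrightarrow>
    distr (mm_meas X) borel f \<in> observable_laws P R"
  unfolding observable_laws_def by blast

lemma observable_laws_mono: "P \<subseteq> Q \<Longrightarrow> observable_laws P R \<subseteq> observable_laws Q R"
  unfolding observable_laws_def by blast

lemma observable_laws_ne:
  assumes "pyramid P" "R \<ge> 0"
  shows "observable_laws P R \<noteq> {}"
proof -
  obtain X where X: "X \<in> P" using pyramid_ne[OF assms(1)] by blast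
  interpret mm X by standard (rule pyramid_mm[OF assms(1) X])
  have "distr (mm_meas X) borel (\<lambda>_. 0) \<in> observable_laws P R"
    using X assms(2) by (intro observable_lawsI) (auto simp: lipschitz_observable_def)
  then show ?thesis by blast
qed

lemma observable_laws_distribution:
  assumes "pyramid P" "\<nu> \<in> observable_laws P R"
  shows "real_distribution \<nu>" "law_space \<nu> \<in> P" "AE x in \<nu>. 0 \<le> x \<and> x \<le> R"
proof -
  obtain X f where X: "X \<in> P" "lipschitz_observable X f" "\<nu> = distr (mm_meas X) borel f"
    "\<And>x. x \<in> mm_carrier X \<Longrightarrow> 0 \<le> f x \<and> f x \<le> R"
    using assms(2) unfolding observable_laws_def by blast
  interpret mm X by standard (rule pyramid_mm[OF assms(1) X(1)])
  show \<nu>: "real_distribution \<nu>" unfolding X(3) using X(2) by (rule observable_law)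
  then show "law_space \<nu> \<in> P"
    using pyramid_down[OF assms(1) X(1) real_distribution.mm_space_law[OF \<nu>]]
      law_space_lip_le[OF X(2)] X(3) by simp
  note [measurable] = observable_measurable[OF X(2)]
  show "AE x in \<nu>. 0 \<le> x \<and> x \<le> R"
    unfolding X(3) using X(4) by (subst AE_distr_iff) (auto simp: space_mm)
qed

text \<open>The identity on the support is an observable of \<open>law_space \<nu>\<close> with law
  \<nu>. Together with \<open>observable_laws_distribution\<close> this describes the laws by
  membership of \<open>law_space\<close> in P, a condition that passes to box limits.\<close>

lemma observable_lawsI_law_space:
  assumes "real_distribution \<nu>" "law_space \<nu> \<in> P" "AE x in \<nu>. 0 \<le> x \<and> x \<le> R"
  shows "\<nu> \<in> observable_laws P R"
proof -
  interpret real_distribution \<nu> by fact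
  have supp: "0 \<le> x \<and> x \<le> R" if "x \<in> law_support \<nu>" for x
  proof (rule ccontr)
    assume "\<not> (0 \<le> x \<and> x \<le> R)"
    then have "x \<in> - {0..R}" "open (- {0..R})" by auto
    then obtain r where r: "r > 0" "ball x r \<inter> {0..R} = {}"
      unfolding open_contains_ball disjoint_eq_subset_Compl by blast
    have "AE y in \<nu>. y \<notin> ball x r"
      using assms(3) by eventually_elim (use r(2) in auto)
    then have "prob (ball x r) = 0"
      by (subst prob_eq_0) auto
    then show False using that r(1) by (auto simp: law_support_def)
  qed
  have "distr (mm_meas (law_space \<nu>)) borel (\<lambda>x. x) = \<nu>"
  proof (rule measure_eqI)
    fix A assume "A \<in> sets (distr (mm_meas (law_space \<nu>)) borel (\<lambda>x. x))"
    then have A[measurable]: "A \<in> sets borel" by simp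
    have "emeasure (distr (mm_meas (law_space \<nu>)) borel (\<lambda>x. x)) A = emeasure \<nu> (A \<inter> law_support \<nu>)"
      by (simp add: emeasure_distr emeasure_restrict_space measurable_restrict_space1 space_restrict_space)
    also have "\<dots> = emeasure \<nu> A"
      using AE_law_support by (intro emeasure_eq_AE) auto
    finally show "emeasure (distr (mm_meas (law_space \<nu>)) borel (\<lambda>x. x)) A = emeasure \<nu> A" .
  qed simp
  moreover have "distr (mm_meas (law_space \<nu>)) borel (\<lambda>x. x) \<in> observable_laws P R"
    using assms(2) supp by (intro observable_lawsI) (auto simp: lipschitz_observable_def dist_real_def)
  ultimately show ?thesis by simp
qed

section \<open>Deficit of a law against prescribed masses\<close>

locale law_deficit =
  fixes J :: nat and m c :: "nat \<Rightarrow> real" and w R :: real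
  assumes w: "w > 0" and R: "R \<ge> 0"
begin

text \<open>A Lipschitz substitute for the indicator of the interval of radius w about
  \<open>c j\<close>; with indicators the deficit would not be stable under small perturbations of
  the law.\<close>

definition tent :: "nat \<Rightarrow> real \<Rightarrow> real" where
  "tent j x = max 0 (1 - \<bar>x - c j\<bar> / w)"

definition deficit :: "real measure \<Rightarrow> real" where
  "deficit \<nu> = (\<Sum>j<J. max 0 (m j - (\<integral>x. tent j x \<partial>\<nu>)))"

definition pyramid_deficit :: "mmspace set \<Rightarrow> real" where
  "pyramid_deficit P = Inf (deficit ` observable_laws P R)"

lemma tent_bounds: "0 \<le> tent j x" "tent j x \<le> 1"
  using w by (auto simp: tent_def)

lemma tent_lipschitz: "tent j x - tent j y \<le> \<bar>x - y\<bar> / w"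
proof -
  have "\<bar>y - c j\<bar> / w \<le> \<bar>x - c j\<bar> / w + \<bar>x - y\<bar> / w"
    using w by (simp add: divide_right_mono flip: add_divide_distrib)
  moreover have "0 \<le> \<bar>x - y\<bar> / w" using w by simp
  ultimately show ?thesis by (auto simp: tent_def max_def)
qed

lemma tent_measurable [measurable]: "tent j \<in> borel_measurable borel"
  unfolding tent_def by measurable

lemma deficit_nonneg: "deficit \<nu> \<ge> 0"
  unfolding deficit_def by (intro sum_nonneg) auto

text \<open>On the close event a tent changes by at most \<delta>/w; the remaining event has
  probability at most \<delta>, and there tents differ by at most 1. Summing over J tents gives the
  constant.\<close>

lemma deficit_coupling:
  assumes "prob_space \<Omega>" and a[measurable]: "a \<in> borel_measurable \<Omega>" and b[measurable]: "b \<in> borel_measurable \<Omega>"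
    and "\<delta> \<ge> 0" and close: "measure \<Omega> {\<omega> \<in> space \<Omega>. \<bar>a \<omega> - b \<omega>\<bar> \<le> \<delta>} \<ge> 1 - \<delta>"
  shows "deficit (distr \<Omega> borel a) \<le> deficit (distr \<Omega> borel b) + real J * (1 / w + 1) * \<delta>"
proof -
  interpret \<Omega>: prob_space \<Omega> by fact
  define E where "E = {\<omega> \<in> space \<Omega>. \<bar>a \<omega> - b \<omega>\<bar> \<le> \<delta>}"
  have E[measurable]: "E \<in> sets \<Omega>" unfolding E_def by measurable
  have int: "integrable \<Omega> (\<lambda>\<omega>. tent j (f \<omega>))" if [measurable]: "f \<in> borel_measurable \<Omega>" for f j
    by (rule \<Omega>.integrable_const_bound[of _ 1]) (auto simp: tent_bounds)
  have "(\<integral>x. tent j x \<partial>distr \<Omega> borel b) - (\<integral>x. tent j x \<partial>distr \<Omega> borel a) \<le> (1 / w + 1) * \<delta>" for j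
  proof -
    have "(\<integral>x. tent j x \<partial>distr \<Omega> borel b) - (\<integral>x. tent j x \<partial>distr \<Omega> borel a)
        = (\<integral>\<omega>. tent j (b \<omega>) - tent j (a \<omega>) \<partial>\<Omega>)"
      by (simp add: integral_distr int)
    also have "\<dots> \<le> (\<integral>\<omega>. \<delta> / w + indicator (space \<Omega> - E) \<omega> \<partial>\<Omega>)"
    proof (rule integral_mono)
      show "integrable \<Omega> (\<lambda>\<omega>. tent j (b \<omega>) - tent j (a \<omega>))" by (simp add: int)
      show "integrable \<Omega> (\<lambda>\<omega>. \<delta> / w + indicator (space \<Omega> - E) \<omega>)"
        by (intro Bochner_Integration.integrable_add) (auto simp: \<Omega>.emeasure_eq_measure)
      fix \<omega> assume "\<omega> \<in> space \<Omega>"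
      show "tent j (b \<omega>) - tent j (a \<omega>) \<le> \<delta> / w + indicator (space \<Omega> - E) \<omega>"
      proof (cases "\<omega> \<in> E")
        case True
        then have "\<bar>b \<omega> - a \<omega>\<bar> / w \<le> \<delta> / w" using w by (intro divide_right_mono) (auto simp: E_def)
        then show ?thesis using tent_lipschitz[of j "b \<omega>" "a \<omega>"] True by simp
      next
        case False
        have "tent j (b \<omega>) - tent j (a \<omega>) \<le> 1" using tent_bounds(2)[of j "b \<omega>"] tent_bounds(1)[of j "a \<omega>"] by simp
        moreover have "0 \<le> \<delta> / w" using w \<open>\<delta> \<ge> 0\<close> by simp
        ultimately show ?thesis using False \<open>\<omega> \<in> space \<Omega>\<close> by simp
      qed
    qed
    also have "\<dots> = \<delta> / w + \<Omega>.prob (space \<Omega> - E)"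
      by (subst Bochner_Integration.integral_add) (auto simp: \<Omega>.emeasure_eq_measure \<Omega>.prob_space)
    also have "\<Omega>.prob (space \<Omega> - E) \<le> \<delta>"
      using close by (simp add: \<Omega>.prob_compl E_def[symmetric])
    finally show ?thesis by (simp add: algebra_simps)
  qed
  then have "deficit (distr \<Omega> borel a) \<le> (\<Sum>j<J. max 0 (m j - (\<integral>x. tent j x \<partial>distr \<Omega> borel b)) + (1 / w + 1) * \<delta>)"
    unfolding deficit_def using w \<open>\<delta> \<ge> 0\<close>
    by (intro sum_mono) (smt (verit, best) divide_nonneg_pos mult_nonneg_nonneg)
  then show ?thesis by (simp add: deficit_def sum.distrib)
qed

lemma pyramid_deficit_le: "\<nu> \<in> observable_laws P R \<Longrightarrow> pyramid_deficit P \<le> deficit \<nu>"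
  unfolding pyramid_deficit_def
  by (intro cINF_lower) (auto intro!: bdd_belowI2[of _ 0] deficit_nonneg)

lemma pyramid_deficit_nonneg: "pyramid P \<Longrightarrow> pyramid_deficit P \<ge> 0"
  unfolding pyramid_deficit_def
  by (intro cINF_greatest observable_laws_ne R deficit_nonneg)

lemma pyramid_deficit_lessD:
  assumes "pyramid P" "pyramid_deficit P < a"
  obtains \<nu> where "\<nu> \<in> observable_laws P R" "deficit \<nu> < a"
proof -
  have "bdd_below (deficit ` observable_laws P R)"
    by (auto intro!: bdd_belowI2[of _ 0] deficit_nonneg)
  then have "\<exists>\<nu>\<in>observable_laws P R. deficit \<nu> < a"
    using assms observable_laws_ne[OF assms(1) R] cINF_less_iff[of "observable_laws P R" deficit a]
    by (simp add: pyramid_deficit_def)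
  then show ?thesis using that by blast
qed

lemma pyramid_deficit_antimono:
  assumes "pyramid P" "P \<subseteq> Q"
  shows "pyramid_deficit Q \<le> pyramid_deficit P"
proof (rule ccontr)
  assume "\<not> ?thesis"
  then obtain \<nu> where "\<nu> \<in> observable_laws P R" "deficit \<nu> < pyramid_deficit Q"
    using pyramid_deficit_lessD[OF assms(1)] by (auto simp: not_le)
  then show False
    using pyramid_deficit_le observable_laws_mono[OF assms(2)] by (metis not_le subsetD)
qed

text \<open>For a nearly optimal observable f of a member X of P, the function
  \<open>f \<circ> \<phi>\<close> is \<delta>-almost Lipschitz for the distances along \<psi> in a
  box-close Y. Its extension g to Y has nearly the same law, the two laws being coupled through the
  parameter.\<close>

lemma pyramid_deficit_upper:
  assumes Ps: "\<And>n. pyramid (Ps n)" and P: "pyramid P" and conv: "weak_conv Ps P"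
    and a: "pyramid_deficit P < a"
  shows "\<forall>\<^sub>F n in sequentially. pyramid_deficit (Ps n) < a"
proof -
  obtain \<nu> where \<nu>: "\<nu> \<in> observable_laws P R" "deficit \<nu> < a"
    using pyramid_deficit_lessD[OF P a] by blast
  obtain X f where X: "X \<in> P" "lipschitz_observable X f" "\<nu> = distr (mm_meas X) borel f"
    "\<And>x. x \<in> mm_carrier X \<Longrightarrow> 0 \<le> f x \<and> f x \<le> R"
    using \<nu>(1) unfolding observable_laws_def by blast
  interpret mm X by standard (rule pyramid_mm[OF P X(1)])
  define K where "K = real J * (1 / w + 1)"
  have "K \<ge> 0" using w by (simp add: K_def)
  \<comment> \<open>Chosen so that the coupling error \<open>K * \<delta>\<close> stays below the
    gap \<open>a - deficit \<nu>\<close>; the summand 1 makes the inequality strict and covers K =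
    0.\<close>
  define \<delta> where "\<delta> = (a - deficit \<nu>) / (K + 1)"
  have \<delta>: "\<delta> > 0" using \<nu>(2) \<open>K \<ge> 0\<close> by (simp add: \<delta>_def)
  have K\<delta>: "deficit \<nu> + K * \<delta> < a"
  proof -
    have "(K + 1) * \<delta> = a - deficit \<nu>" using \<open>K \<ge> 0\<close> by (simp add: \<delta>_def)
    then show ?thesis using \<delta> by (simp add: algebra_simps)
  qed
  have "\<forall>\<^sub>F n in sequentially. box_near X (Ps n) \<delta>"
    by (rule weak_conv_nearD[OF Ps P conv X(1) \<delta>])
  then show ?thesis
  proof eventually_elim
    case (elim n)
    then obtain Y where Y: "Y \<in> Ps n" "box_admissible X Y \<delta>" by (auto simp: box_near_def)
    interpret Y: mm Y by standard (rule pyramid_mm[OF Ps Y(1)])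
    interpret U: prob_space unit_interval_leb by (rule prob_space_unit_interval_leb)
    obtain \<phi> \<psi> I0 where *: "\<phi> \<in> measurable unit_interval_leb (mm_meas X)"
      "distr unit_interval_leb (mm_meas X) \<phi> = mm_meas X"
      "\<psi> \<in> measurable unit_interval_leb (mm_meas Y)"
      "distr unit_interval_leb (mm_meas Y) \<psi> = mm_meas Y" "I0 \<in> sets unit_interval_leb"
      "measure unit_interval_leb I0 \<ge> 1 - \<delta>"
      "\<And>s t. s\<in>I0 \<Longrightarrow> t\<in>I0 \<Longrightarrow> \<bar>mm_dist X (\<phi> s) (\<phi> t) - mm_dist Y (\<psi> s) (\<psi> t)\<bar> \<le> \<delta>"
      using Y(2) unfolding box_admissible_def by blast
    have I0: "s \<in> space unit_interval_leb" if "s \<in> I0" for s using sets.sets_into_space[OF *(5)] that by blast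
    have \<phi>X: "\<phi> s \<in> mm_carrier X" "\<psi> s \<in> mm_carrier Y" if "s \<in> I0" for s
      using measurable_space[OF *(1) I0[OF that]] measurable_space[OF *(3) I0[OF that]]
      by (auto simp: space_mm Y.space_mm)
    obtain g where g: "lipschitz_observable Y g" "\<And>y. 0 \<le> g y \<and> g y \<le> R"
      "\<And>s. s \<in> I0 \<Longrightarrow> \<bar>g (\<psi> s) - f (\<phi> s)\<bar> \<le> \<delta>"
    proof (rule mcshane_extension[where Y=Y and I=I0 and p=\<psi> and u="\<lambda>s. f (\<phi> s)" and R=R and \<delta>=\<delta>])
      fix s t assume st: "s \<in> I0" "t \<in> I0"
      show "f (\<phi> s) - f (\<phi> t) \<le> mm_dist Y (\<psi> s) (\<psi> t) + \<delta>"
        using lipschitz_observableD[OF X(2) \<phi>X(1)[OF st(1)] \<phi>X(1)[OF st(2)]] *(7)[OF st] by linarith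
    qed (use Y.mm_space \<phi>X X(4) R \<delta> in auto)
    have gm: "g \<in> borel_measurable (mm_meas Y)" by (rule Y.observable_measurable[OF g(1)])
    have fm: "f \<in> borel_measurable (mm_meas X)" by (rule observable_measurable[OF X(2)])
    have m1[measurable]: "(\<lambda>s. g (\<psi> s)) \<in> borel_measurable unit_interval_leb"
      by (rule measurable_compose[OF *(3) gm])
    have m2[measurable]: "(\<lambda>s. f (\<phi> s)) \<in> borel_measurable unit_interval_leb"
      by (rule measurable_compose[OF *(1) fm])
    have "distr (mm_meas Y) borel g = distr unit_interval_leb borel (\<lambda>s. g (\<psi> s))"
      by (subst *(4)[symmetric], subst distr_distr[OF gm *(3)]) (simp add: comp_def)
    moreover have "\<nu> = distr unit_interval_leb borel (\<lambda>s. f (\<phi> s))"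
      unfolding X(3) by (subst *(2)[symmetric], subst distr_distr[OF fm *(1)]) (simp add: comp_def)
    moreover have "deficit (distr unit_interval_leb borel (\<lambda>s. g (\<psi> s))) \<le>
        deficit (distr unit_interval_leb borel (\<lambda>s. f (\<phi> s))) + K * \<delta>"
      unfolding K_def
    proof (rule deficit_coupling[OF prob_space_unit_interval_leb m1 m2])
      have "1 - \<delta> \<le> U.prob I0" by (rule *(6))
      also have "\<dots> \<le> U.prob {\<omega> \<in> space unit_interval_leb. \<bar>g (\<psi> \<omega>) - f (\<phi> \<omega>)\<bar> \<le> \<delta>}"
        using I0 g(3) by (intro U.finite_measure_mono) (auto simp del: space_unit_interval_leb)
      finally show "1 - \<delta> \<le> U.prob {\<omega> \<in> space unit_interval_leb. \<bar>g (\<psi> \<omega>) - f (\<phi> \<omega>)\<bar> \<le> \<delta>}" .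
    qed (use \<delta> in simp)
    ultimately have "deficit (distr (mm_meas Y) borel g) < a" using K\<delta> by simp
    moreover have "distr (mm_meas Y) borel g \<in> observable_laws (Ps n) R"
      using Y(1) g by (intro observable_lawsI) auto
    ultimately show "pyramid_deficit (Ps n) < a"
      using pyramid_deficit_le by (meson le_less_trans)
  qed
qed

text \<open>Otherwise laws from a subsequence have deficit below b; a weak limit M of them is a law
  of P with too small a deficit. That M belongs to P uses the second clause of weak convergence: a
  space outside P is eventually far from \<open>Ps n\<close>, whereas M is box-close to laws of the
  subsequence.\<close>

lemma pyramid_deficit_lower:
  assumes Ps: "\<And>n. pyramid (Ps n)" and P: "pyramid P" and conv: "weak_conv Ps P"
    and a: "a < pyramid_deficit P"
  shows "\<forall>\<^sub>F n in sequentially. a < pyramid_deficit (Ps n)"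
proof (rule ccontr)
  \<comment> \<open>The infimum need not be attained, so laws of the subsequence are taken below b,
    which still leaves a gap up to the deficit of P.\<close>
  define b where "b = (a + pyramid_deficit P) / 2"
  have b: "a < b" "b < pyramid_deficit P" using a by (auto simp: b_def field_simps)
  assume "\<not> ?thesis"
  from not_eventually_sequentiallyD[OF this]
  obtain r :: "nat \<Rightarrow> nat" where "strict_mono r \<and> (\<forall>n. \<not> a < pyramid_deficit (Ps (r n)))"
    by blast
  then have r: "strict_mono r" "\<And>k. pyramid_deficit (Ps (r k)) \<le> a"
    by (auto simp: not_less)
  have "\<exists>\<nu>. \<nu> \<in> observable_laws (Ps (r k)) R \<and> deficit \<nu> < b" for k
  proof -
    have "pyramid_deficit (Ps (r k)) < b" using r(2)[of k] b(1) by linarith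
    from pyramid_deficit_lessD[OF Ps this] show ?thesis by blast
  qed
  then obtain \<nu> where \<nu>: "\<And>k. \<nu> k \<in> observable_laws (Ps (r k)) R" "\<And>k. deficit (\<nu> k) < b"
    by metis
  note \<nu>P = observable_laws_distribution[OF Ps \<nu>(1)]
  interpret \<nu>: real_distribution "\<nu> k" for k by (rule \<nu>P)
  have "tight \<nu>"
    unfolding tight_def
  proof (intro conjI allI impI \<nu>P(1))
    fix \<epsilon> :: real assume "\<epsilon> > 0"
    have "\<nu>.prob n {-1<..R} = 1" for n
      using \<nu>P(3)[of n] by (subst \<nu>.prob_eq_1) (auto elim!: eventually_mono)
    then show "\<exists>a b. a < b \<and> (\<forall>n. 1 - \<epsilon> < \<nu>.prob n {a<..b})"
      using \<open>\<epsilon> > 0\<close> R by (intro exI[of _ "-1"] exI[of _ R]) auto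
  qed
  then obtain q M where q: "strict_mono (q :: nat \<Rightarrow> nat)" "real_distribution M" "weak_conv_m (\<nu> \<circ> id \<circ> q) M"
    using tight_imp_convergent_subsubsequence[of \<nu> id] strict_mono_id by blast
  interpret M: real_distribution M by fact
  have dist_q: "real_distribution ((\<nu> \<circ> id \<circ> q) n)" for n using \<nu>P(1) by simp
  \<comment> \<open>Weakly convergent laws are realized by pointwise convergent variables on one
    space, which supplies the couplings for \<open>law_box_admissible\<close> and
    \<open>deficit_coupling\<close>.\<close>
  obtain \<Omega> :: "real measure" and A :: "nat \<Rightarrow> real \<Rightarrow> real" and B :: "real \<Rightarrow> real" where \<Omega>: "prob_space \<Omega>"
    and A[measurable]: "\<And>n. A n \<in> borel_measurable \<Omega>" and A_distr': "\<And>n. distr \<Omega> borel (A n) = (\<nu> \<circ> id \<circ> q) n"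
    and B': "B \<in> measurable \<Omega> lborel" and B_distr: "distr \<Omega> borel B = M"
    and AB: "\<And>x. x \<in> space \<Omega> \<Longrightarrow> (\<lambda>n. A n x) \<longlonglongrightarrow> B x"
    using Skorohod[OF dist_q q(2,3)] by blast
  have B[measurable]: "B \<in> borel_measurable \<Omega>" using B' by simp
  have A_distr: "distr \<Omega> borel (A n) = \<nu> (q n)" for n using A_distr'[of n] by simp
  interpret \<Omega>: prob_space \<Omega> by fact
  \<comment> \<open>Pointwise convergence gives convergence in probability, by dominated convergence
    for the indicators of the close events.\<close>
  have close: "\<forall>\<^sub>F n in sequentially. \<Omega>.prob {\<omega> \<in> space \<Omega>. \<bar>B \<omega> - A n \<omega>\<bar> \<le> \<delta>} \<ge> 1 - \<delta>" if "\<delta> > 0" for \<delta>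
  proof -
    have "(\<lambda>n. \<integral>\<omega>. indicator {\<omega> \<in> space \<Omega>. \<bar>B \<omega> - A n \<omega>\<bar> \<le> \<delta>} \<omega> \<partial>\<Omega>) \<longlonglongrightarrow> (\<integral>\<omega>. (1::real) \<partial>\<Omega>)"
    proof (rule integral_dominated_convergence[where w="\<lambda>_. 1"])
      show "AE \<omega> in \<Omega>. (\<lambda>n. indicator {\<omega> \<in> space \<Omega>. \<bar>B \<omega> - A n \<omega>\<bar> \<le> \<delta>} \<omega>) \<longlonglongrightarrow> (1::real)"
      proof (rule AE_I2)
        fix \<omega> assume \<omega>: "\<omega> \<in> space \<Omega>"
        have "\<forall>\<^sub>F n in sequentially. dist (A n \<omega>) (B \<omega>) < \<delta>" using AB[OF \<omega>] that by (rule tendstoD)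
        then have "\<forall>\<^sub>F n in sequentially. indicator {\<omega> \<in> space \<Omega>. \<bar>B \<omega> - A n \<omega>\<bar> \<le> \<delta>} \<omega> = (1::real)"
          by eventually_elim (use \<omega> in \<open>auto simp: dist_real_def indicator_def\<close>)
        then show "(\<lambda>n. indicator {\<omega> \<in> space \<Omega>. \<bar>B \<omega> - A n \<omega>\<bar> \<le> \<delta>} \<omega>) \<longlonglongrightarrow> (1::real)"
          by (rule tendsto_eventually)
      qed
    qed (auto simp: indicator_def)
    then have "(\<lambda>n. \<Omega>.prob {\<omega> \<in> space \<Omega>. \<bar>B \<omega> - A n \<omega>\<bar> \<le> \<delta>}) \<longlonglongrightarrow> 1"
      by (simp add: \<Omega>.prob_space)
    then have "\<forall>\<^sub>F n in sequentially. \<Omega>.prob {\<omega> \<in> space \<Omega>. \<bar>B \<omega> - A n \<omega>\<bar> \<le> \<delta>} > 1 - \<delta>"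
      using that by (intro order_tendstoD) auto
    then show ?thesis by eventually_elim simp
  qed
  have sub: "strict_mono (\<lambda>n. r (q n))" using r(1) q(1) by (simp add: strict_mono_def)
  have law_P: "law_space M \<in> P"
  proof (rule ccontr)
    assume "law_space M \<notin> P"
    then obtain \<epsilon> where \<epsilon>: "\<epsilon> > 0" "\<forall>\<^sub>F n in sequentially. \<not> box_near (law_space M) (Ps n) \<epsilon>"
      using weak_conv_farD[OF Ps P conv M.mm_space_law] by blast
    have "\<forall>\<^sub>F n in sequentially. \<not> box_near (law_space M) (Ps (r (q n))) \<epsilon>"
      using eventually_subseq[OF sub \<epsilon>(2)] .
    moreover have "\<forall>\<^sub>F n in sequentially. \<Omega>.prob {\<omega> \<in> space \<Omega>. \<bar>B \<omega> - A n \<omega>\<bar> \<le> \<epsilon> / 2} \<ge> 1 - \<epsilon> / 2"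
      using \<epsilon>(1) by (intro close) simp
    ultimately have "\<forall>\<^sub>F n in sequentially. False"
    proof eventually_elim
      case (elim n)
      have "box_admissible (law_space (distr \<Omega> borel B)) (law_space (distr \<Omega> borel (A n))) (2 * (\<epsilon> / 2))"
        using elim(2) \<epsilon>(1) by (intro law_box_admissible \<Omega> A B) auto
      then have "box_near (law_space M) (Ps (r (q n))) \<epsilon>"
        unfolding box_near_def A_distr B_distr using \<nu>P(2)[of "q n"] by auto
      then show False using elim(1) by simp
    qed
    then show False by simp
  qed
  have "AE \<omega> in \<Omega>. \<forall>n. 0 \<le> A n \<omega> \<and> A n \<omega> \<le> R"
    unfolding AE_all_countable
  proof
    fix n
    have "AE x in distr \<Omega> borel (A n). 0 \<le> x \<and> x \<le> R" unfolding A_distr by (rule \<nu>P(3))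
    then show "AE \<omega> in \<Omega>. 0 \<le> A n \<omega> \<and> A n \<omega> \<le> R" by (simp add: AE_distr_iff)
  qed
  then have "AE \<omega> in \<Omega>. 0 \<le> B \<omega> \<and> B \<omega> \<le> R"
    using AE_space
  proof eventually_elim
    case (elim \<omega>)
    then show ?case
      using LIMSEQ_le_const[OF AB, of \<omega> 0] LIMSEQ_le_const2[OF AB, of \<omega> R] by blast
  qed
  then have "AE x in M. 0 \<le> x \<and> x \<le> R"
    unfolding B_distr[symmetric] by (simp add: AE_distr_iff)
  then have M_laws: "M \<in> observable_laws P R"
    using law_P M.real_distribution_axioms by (intro observable_lawsI_law_space)
  define K where "K = real J * (1 / w + 1)"
  have "K \<ge> 0" using w by (simp add: K_def)
  define \<delta> where "\<delta> = (pyramid_deficit P - b) / (K + 1)"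
  have \<delta>: "\<delta> > 0" using b \<open>K \<ge> 0\<close> by (simp add: \<delta>_def)
  have "(K + 1) * \<delta> = pyramid_deficit P - b" using \<open>K \<ge> 0\<close> by (simp add: \<delta>_def)
  then have K\<delta>: "b + K * \<delta> < pyramid_deficit P" using \<delta> by (simp add: algebra_simps)
  obtain n where n: "\<Omega>.prob {\<omega> \<in> space \<Omega>. \<bar>B \<omega> - A n \<omega>\<bar> \<le> \<delta>} \<ge> 1 - \<delta>"
    using eventually_happens[OF close[OF \<delta>]] by auto
  have "deficit (distr \<Omega> borel B) \<le> deficit (distr \<Omega> borel (A n)) + K * \<delta>"
    unfolding K_def using n \<delta> by (intro deficit_coupling \<Omega> A B) auto
  also have "\<dots> < pyramid_deficit P"
    using \<nu>(2)[of "q n"] K\<delta> by (simp add: A_distr)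
  also have "\<dots> \<le> deficit M" by (rule pyramid_deficit_le[OF M_laws])
  finally show False by (simp add: B_distr)
qed

theorem pyramid_deficit_tendsto:
  assumes "\<And>n. pyramid (Ps n)" "pyramid P" "weak_conv Ps P"
  shows "(\<lambda>n. pyramid_deficit (Ps n)) \<longlonglongrightarrow> pyramid_deficit P"
  using pyramid_deficit_upper[OF assms] pyramid_deficit_lower[OF assms] by (intro order_tendstoI)

end

section \<open>Nearly dominated spaces\<close>

lemma sum_indicator_disjoint_le:
  fixes a :: "nat \<Rightarrow> real"
  assumes "disjoint_family_on K {..<J}" "\<And>j. j < J \<Longrightarrow> 0 \<le> a j \<and> a j \<le> 1"
  shows "(\<Sum>j<J. a j * indicator (K j) x) \<le> 1"
proof (cases "\<exists>j<J. x \<in> K j")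
  case True
  then obtain j where j: "j < J" "x \<in> K j" by blast
  have "(\<Sum>i<J. a i * indicator (K i) x) = (\<Sum>i<J. if i = j then a j else 0)"
    using j disjoint_family_onD[OF assms(1)] by (intro sum.cong) (auto simp: indicator_def)
  then show ?thesis using j assms(2) by simp
next
  case False
  then have "(\<Sum>j<J. a j * indicator (K j) x) = 0" by (intro sum.neutral) (auto simp: indicator_def)
  then show ?thesis by simp
qed

text \<open>Inside the rectangles \<open>K j \<times> L j\<close> the coupling is a multiple of the product measure; what
  remains of the two marginals is coupled independently. The factor \<open>\<theta> < 1\<close> keeps the remaining
  mass positive.\<close>

lemma partial_coupling:
  fixes M :: "'a measure" and N :: "'b measure" and J :: nat
  assumes "prob_space M" "prob_space N"
    and K[measurable]: "\<And>j. K j \<in> sets M" and L[measurable]: "\<And>j. L j \<in> sets N"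
    and dK: "disjoint_family_on K {..<J}" and dL: "disjoint_family_on L {..<J}"
    and \<theta>: "0 \<le> \<theta>" "\<theta> < 1"
  obtains \<Omega> where "prob_space \<Omega>" "sets \<Omega> = sets (M \<Otimes>\<^sub>M N)" "distr \<Omega> M fst = M" "distr \<Omega> N snd = N"
    "measure \<Omega> {z \<in> space (M \<Otimes>\<^sub>M N). \<exists>j<J. fst z \<in> K j \<and> snd z \<in> L j} \<ge>
      \<theta> * (\<Sum>j<J. min (measure M (K j)) (measure N (L j)))"
proof -
  interpret M: prob_space M by fact
  interpret N: prob_space N by fact
  interpret pair_prob_space M N by standard
  \<comment> \<open>\<open>q j\<close> is the mass put on the rectangle
    \<open>K j \<times> L j\<close>; s is the total of these masses, and \<alpha> and \<beta> are
    the densities of the two marginals of that part.\<close>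
  define q where "q j = \<theta> * min (M.prob (K j)) (N.prob (L j))" for j
  define s where "s = (\<Sum>j<J. q j)"
  define \<alpha> where "\<alpha> x = (\<Sum>j<J. q j / M.prob (K j) * indicator (K j) x)" for x
  define \<beta> where "\<beta> y = (\<Sum>j<J. q j / N.prob (L j) * indicator (L j) y)" for y
  define h where "h z = (\<Sum>j<J. q j / (M.prob (K j) * N.prob (L j)) * (indicator (K j) (fst z) * indicator (L j) (snd z)))" for z
  \<comment> \<open>The leftover marginal densities 1 - \<alpha> and 1 - \<beta> both have mass 1 -
    s > 0, so their product divided by 1 - s restores both marginals.\<close>
  define g where "g z = h z + (1 - \<alpha> (fst z)) * (1 - \<beta> (snd z)) / (1 - s)" for z
  have [measurable]: "\<alpha> \<in> borel_measurable M" "\<beta> \<in> borel_measurable N" "h \<in> borel_measurable (M \<Otimes>\<^sub>M N)"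
    unfolding \<alpha>_def \<beta>_def h_def by measurable
  have g_meas[measurable]: "g \<in> borel_measurable (M \<Otimes>\<^sub>M N)"
    unfolding g_def by measurable
  have q: "0 \<le> q j" "q j \<le> M.prob (K j)" "q j \<le> N.prob (L j)" "q j \<le> \<theta> * M.prob (K j)" for j
  proof -
    show "0 \<le> q j" using \<theta> by (simp add: q_def)
    show "q j \<le> \<theta> * M.prob (K j)" using \<theta> by (auto simp: q_def intro: mult_left_mono)
    have "q j \<le> 1 * min (M.prob (K j)) (N.prob (L j))"
      unfolding q_def using \<theta> by (intro mult_right_mono) auto
    then show "q j \<le> M.prob (K j)" "q j \<le> N.prob (L j)" by auto
  qed
  have s: "s < 1"
  proof -
    have "s \<le> \<theta> * (\<Sum>j<J. M.prob (K j))"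
      unfolding s_def sum_distrib_left using q(4) by (intro sum_mono)
    also have "(\<Sum>j<J. M.prob (K j)) = M.prob (\<Union>j<J. K j)"
      using dK by (intro M.finite_measure_finite_Union[symmetric]) auto
    also have "\<theta> * \<dots> \<le> \<theta> * 1" using \<theta> by (intro mult_left_mono) auto
    finally show ?thesis using \<theta> by simp
  qed
  have ratio: "0 \<le> q j / M.prob (K j) \<and> q j / M.prob (K j) \<le> 1"
    "0 \<le> q j / N.prob (L j) \<and> q j / N.prob (L j) \<le> 1" for j
  proof -
    have "0 \<le> a / b \<and> a / b \<le> 1" if "0 \<le> a" "a \<le> b" for a b :: real
      using that by (cases "b = 0") (auto simp: divide_le_eq_1)
    then show "0 \<le> q j / M.prob (K j) \<and> q j / M.prob (K j) \<le> 1" "0 \<le> q j / N.prob (L j) \<and> q j / N.prob (L j) \<le> 1"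
      using q by auto
  qed
  have \<alpha>: "\<alpha> x \<le> 1" "\<alpha> x \<ge> 0" for x
    unfolding \<alpha>_def
    by (rule sum_indicator_disjoint_le[OF dK ratio(1)],
        intro sum_nonneg mult_nonneg_nonneg conjunct1[OF ratio(1)]) simp
  have \<beta>: "\<beta> y \<le> 1" "\<beta> y \<ge> 0" for y
    unfolding \<beta>_def
    by (rule sum_indicator_disjoint_le[OF dL ratio(2)],
        intro sum_nonneg mult_nonneg_nonneg conjunct1[OF ratio(2)]) simp
  have h0: "h z \<ge> 0" for z
    unfolding h_def using q(1) by (intro sum_nonneg) auto
  have rest0: "0 \<le> (1 - \<alpha> x) * (1 - \<beta> y) / (1 - s)" for x y
    using \<alpha>[of x] \<beta>[of y] s by (intro divide_nonneg_pos mult_nonneg_nonneg) auto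
  have g0: "g z \<ge> 0" for z
    unfolding g_def using h0 rest0 by (intro add_nonneg_nonneg)
  \<comment> \<open>Division by zero is harmless here: a null \<open>K j\<close> or
    \<open>L j\<close> forces \<open>q j = 0\<close>.\<close>
  have cancel: "q j / (M.prob (K j) * N.prob (L j)) * N.prob (L j) = q j / M.prob (K j)"
    "q j / (M.prob (K j) * N.prob (L j)) * M.prob (K j) = q j / N.prob (L j)"
    "q j / M.prob (K j) * M.prob (K j) = q j" "q j / N.prob (L j) * N.prob (L j) = q j" for j
    using q[of j] by (auto simp: divide_simps)
  have inner_N: "(\<integral>\<^sup>+y. ennreal (g (x, y)) \<partial>N) = 1" if [measurable]: "x \<in> space M" for x
  proof -
    have int1: "integrable N (\<lambda>y. h (x, y))"
      unfolding h_def by (intro Bochner_Integration.integrable_sum integrable_mult_right) (auto simp: N.emeasure_eq_measure)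
    have int2: "integrable N \<beta>"
      unfolding \<beta>_def by (intro Bochner_Integration.integrable_sum integrable_mult_right) (auto simp: N.emeasure_eq_measure)
    have i1: "(\<integral>y. h (x, y) \<partial>N) = \<alpha> x"
    proof -
      have "(\<integral>y. h (x, y) \<partial>N) =
          (\<Sum>j<J. q j / (M.prob (K j) * N.prob (L j)) * (indicator (K j) x * N.prob (L j)))"
        unfolding h_def by (subst Bochner_Integration.integral_sum) (auto simp: N.emeasure_eq_measure)
      also have "\<dots> = (\<Sum>j<J. q j / (M.prob (K j) * N.prob (L j)) * N.prob (L j) * indicator (K j) x)"
        by (intro sum.cong refl) (simp only: mult_ac)
      also have "\<dots> = \<alpha> x" unfolding cancel \<alpha>_def ..
      finally show ?thesis .
    qed
    have i2: "(\<integral>y. \<beta> y \<partial>N) = s"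
    proof -
      have "(\<integral>y. \<beta> y \<partial>N) = (\<Sum>j<J. q j / N.prob (L j) * N.prob (L j))"
        unfolding \<beta>_def by (subst Bochner_Integration.integral_sum) (auto simp: N.emeasure_eq_measure)
      then show ?thesis unfolding cancel s_def .
    qed
    have "(\<integral>\<^sup>+y. ennreal (g (x, y)) \<partial>N) = ennreal (\<integral>y. g (x, y) \<partial>N)"
      using int1 int2 g0 unfolding g_def by (intro nn_integral_eq_integral) auto
    also have "(\<integral>y. g (x, y) \<partial>N) = \<alpha> x + (1 - \<alpha> x) * (1 - s) / (1 - s)"
      using int1 int2 by (simp add: g_def i1 i2 N.prob_space)
    also have "\<dots> = 1" using s by simp
    finally show ?thesis by simp
  qed
  have inner_M: "(\<integral>\<^sup>+x. ennreal (g (x, y)) \<partial>M) = 1" if [measurable]: "y \<in> space N" for y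
  proof -
    have int1: "integrable M (\<lambda>x. h (x, y))"
      unfolding h_def by (intro Bochner_Integration.integrable_sum integrable_mult_right integrable_mult_left) (auto simp: M.emeasure_eq_measure)
    have int2: "integrable M \<alpha>"
      unfolding \<alpha>_def by (intro Bochner_Integration.integrable_sum integrable_mult_right) (auto simp: M.emeasure_eq_measure)
    have i1: "(\<integral>x. h (x, y) \<partial>M) = \<beta> y"
    proof -
      have "(\<integral>x. h (x, y) \<partial>M) =
          (\<Sum>j<J. q j / (M.prob (K j) * N.prob (L j)) * (M.prob (K j) * indicator (L j) y))"
        unfolding h_def by (subst Bochner_Integration.integral_sum) (auto simp: M.emeasure_eq_measure)
      also have "\<dots> = (\<Sum>j<J. q j / (M.prob (K j) * N.prob (L j)) * M.prob (K j) * indicator (L j) y)"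
        by (intro sum.cong refl) (simp only: mult_ac)
      also have "\<dots> = \<beta> y" unfolding cancel \<beta>_def ..
      finally show ?thesis .
    qed
    have i2: "(\<integral>x. \<alpha> x \<partial>M) = s"
    proof -
      have "(\<integral>x. \<alpha> x \<partial>M) = (\<Sum>j<J. q j / M.prob (K j) * M.prob (K j))"
        unfolding \<alpha>_def by (subst Bochner_Integration.integral_sum) (auto simp: M.emeasure_eq_measure)
      then show ?thesis unfolding cancel s_def .
    qed
    have "(\<integral>\<^sup>+x. ennreal (g (x, y)) \<partial>M) = ennreal (\<integral>x. g (x, y) \<partial>M)"
      using int1 int2 g0 unfolding g_def by (intro nn_integral_eq_integral) auto
    also have "(\<integral>x. g (x, y) \<partial>M) = \<beta> y + (1 - s) * (1 - \<beta> y) / (1 - s)"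
      using int1 int2 by (simp add: g_def i1 i2 M.prob_space)
    also have "\<dots> = 1" using s by simp
    finally show ?thesis by simp
  qed
  define \<Omega> where "\<Omega> = density (M \<Otimes>\<^sub>M N) (\<lambda>z. ennreal (g z))"
  have sets\<Omega>: "sets \<Omega> = sets (M \<Otimes>\<^sub>M N)" by (simp add: \<Omega>_def)
  have marg_M: "distr \<Omega> M fst = M"
  proof (rule measure_eqI)
    fix A assume "A \<in> sets (distr \<Omega> M fst)"
    then have A[measurable]: "A \<in> sets M" by simp
    have "emeasure (distr \<Omega> M fst) A = (\<integral>\<^sup>+z. ennreal (g z) * indicator A (fst z) \<partial>(M \<Otimes>\<^sub>M N))"
      by (simp add: \<Omega>_def emeasure_distr emeasure_density)
         (auto intro!: nn_integral_cong simp: indicator_def)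
    also have "\<dots> = (\<integral>\<^sup>+x. (\<integral>\<^sup>+y. ennreal (g (x, y)) * indicator A (fst (x, y)) \<partial>N) \<partial>M)"
      by (rule N.nn_integral_fst[symmetric]) measurable
    also have "\<dots> = (\<integral>\<^sup>+x. indicator A x \<partial>M)"
      by (intro nn_integral_cong) (simp add: nn_integral_multc inner_N)
    finally show "emeasure (distr \<Omega> M fst) A = emeasure M A" by simp
  qed simp
  have marg_N: "distr \<Omega> N snd = N"
  proof (rule measure_eqI)
    fix A assume "A \<in> sets (distr \<Omega> N snd)"
    then have A[measurable]: "A \<in> sets N" by simp
    have "emeasure (distr \<Omega> N snd) A = (\<integral>\<^sup>+z. ennreal (g z) * indicator A (snd z) \<partial>(M \<Otimes>\<^sub>M N))"
      by (simp add: \<Omega>_def emeasure_distr emeasure_density)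
         (auto intro!: nn_integral_cong simp: indicator_def)
    also have "\<dots> = (\<integral>\<^sup>+y. (\<integral>\<^sup>+x. ennreal (g (x, y)) * indicator A (snd (x, y)) \<partial>M) \<partial>N)"
      by (rule nn_integral_snd[symmetric]) measurable
    also have "\<dots> = (\<integral>\<^sup>+y. indicator A y \<partial>N)"
      by (intro nn_integral_cong) (simp add: nn_integral_multc inner_M)
    finally show "emeasure (distr \<Omega> N snd) A = emeasure N A" by simp
  qed simp
  have "emeasure \<Omega> (space \<Omega>) = emeasure (distr \<Omega> M fst) (space M)"
    by (subst emeasure_distr) (auto simp: \<Omega>_def space_pair_measure intro!: arg_cong2[where f=emeasure])
  then have prob\<Omega>: "prob_space \<Omega>"
    by (intro prob_spaceI) (simp add: marg_M M.emeasure_space_1)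
  interpret \<Omega>: prob_space \<Omega> by fact
  define W where "W = {z \<in> space (M \<Otimes>\<^sub>M N). \<exists>j<J. fst z \<in> K j \<and> snd z \<in> L j}"
  have W[measurable]: "W \<in> sets (M \<Otimes>\<^sub>M N)" unfolding W_def by measurable
  have "ennreal s = (\<Sum>j<J. ennreal (q j / (M.prob (K j) * N.prob (L j))) * emeasure (M \<Otimes>\<^sub>M N) (K j \<times> L j))"
  proof -
    have "ennreal (q j / (M.prob (K j) * N.prob (L j))) * emeasure (M \<Otimes>\<^sub>M N) (K j \<times> L j) = ennreal (q j)" for j
    proof -
      have "q j / (M.prob (K j) * N.prob (L j)) * (M.prob (K j) * N.prob (L j)) = q j"
        using q[of j] by (auto simp: divide_simps)
      then show ?thesis
        using q(1)[of j] by (simp add: N.emeasure_pair_measure_Times M.emeasure_eq_measure N.emeasure_eq_measure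
            flip: ennreal_mult')
    qed
    then show ?thesis using q(1) by (simp add: s_def sum_ennreal)
  qed
  also have "\<dots> = (\<integral>\<^sup>+z. (\<Sum>j<J. ennreal (q j / (M.prob (K j) * N.prob (L j))) * indicator (K j \<times> L j) z) \<partial>(M \<Otimes>\<^sub>M N))"
    by (subst nn_integral_sum) (auto simp: nn_integral_cmult_indicator)
  also have "\<dots> \<le> (\<integral>\<^sup>+z. ennreal (g z) * indicator W z \<partial>(M \<Otimes>\<^sub>M N))"
  proof (rule nn_integral_mono)
    fix z assume z: "z \<in> space (M \<Otimes>\<^sub>M N)"
    have eq: "(\<Sum>j<J. ennreal (q j / (M.prob (K j) * N.prob (L j))) * indicator (K j \<times> L j) z) = ennreal (h z)"
    proof -
      have "ennreal a * indicator (K j \<times> L j) z = ennreal (a * (indicator (K j) (fst z) * indicator (L j) (snd z)))" for a j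
        by (cases z) (auto simp: indicator_def)
      then have "(\<Sum>j<J. ennreal (q j / (M.prob (K j) * N.prob (L j))) * indicator (K j \<times> L j) z) =
          (\<Sum>j<J. ennreal (q j / (M.prob (K j) * N.prob (L j)) * (indicator (K j) (fst z) * indicator (L j) (snd z))))"
        by (intro sum.cong refl) blast
      also have "\<dots> = ennreal (h z)"
        unfolding h_def using q(1) by (intro sum_ennreal) auto
      finally show ?thesis .
    qed
    show "(\<Sum>j<J. ennreal (q j / (M.prob (K j) * N.prob (L j))) * indicator (K j \<times> L j) z) \<le> ennreal (g z) * indicator W z"
    proof (cases "z \<in> W")
      case True
      then show ?thesis unfolding eq using rest0[of "fst z" "snd z"] by (simp add: g_def ennreal_leI)
    next
      case False
      then have "h z = 0" unfolding h_def using z by (intro sum.neutral) (auto simp: W_def indicator_def)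
      then show ?thesis unfolding eq by simp
    qed
  qed
  also have "\<dots> = emeasure \<Omega> W" by (simp add: \<Omega>_def emeasure_density)
  finally have "s \<le> \<Omega>.prob W"
    by (simp add: \<Omega>.emeasure_eq_measure)
  then have "\<theta> * (\<Sum>j<J. min (measure M (K j)) (measure N (L j))) \<le> measure \<Omega> W"
    by (simp add: s_def q_def sum_distrib_left)
  then show ?thesis
    using that[OF prob\<Omega> sets\<Omega> marg_M marg_N] unfolding W_def by blast
qed

text \<open>Finitely many balls of radius r about a dense sequence carry nearly all the mass. Each
  piece drops the earlier open balls, and its own radius is diminished by 1/(k+1): points of an
  earlier piece are within r - 1/(k+1) of its centre, points of later pieces at distance at least r
  from it, which separates them by 1/(k+1).\<close>

lemma (in mm) separated_pieces:
  assumes "r > 0" "\<epsilon> > 0"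
  obtains J :: nat and x K \<eta> where "J > 0" "\<eta> > 0" "\<And>j. x j \<in> mm_carrier X" "\<And>j. K j \<in> events"
    "\<And>j. K j \<subseteq> mcball (x j) r"
    "\<And>i j y z. i < j \<Longrightarrow> y \<in> K i \<Longrightarrow> z \<in> K j \<Longrightarrow> \<eta> \<le> mm_dist X y z"
    "(\<Sum>j<J. prob (K j)) > 1 - \<epsilon>"
proof -
  obtain q where q: "range q \<subseteq> mm_carrier X" "\<And>x r. x \<in> mm_carrier X \<Longrightarrow> r > 0 \<Longrightarrow> \<exists>i::nat. mm_dist X x (q i) < r"
    using dense_sequence[OF mm_separable carrier_ne] by blast
  have qM: "q i \<in> mm_carrier X" for i using q(1) by auto
  have "(\<lambda>n. prob (\<Union>i<n. mball (q i) r)) \<longlonglongrightarrow> prob (\<Union>n. \<Union>i<n. mball (q i) r)"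
  proof (intro finite_Lim_measure_incseq)
    show "incseq (\<lambda>n. \<Union>i<n. mball (q i) r)"
      unfolding incseq_def by (intro allI impI UN_mono) auto
  qed (auto simp: openin_sets intro!: sets.finite_UN)
  also have "(\<Union>n. \<Union>i<n. mball (q i) r) = space (mm_meas X)"
  proof
    show "space (mm_meas X) \<subseteq> (\<Union>n. \<Union>i<n. mball (q i) r)"
    proof
      fix y assume "y \<in> space (mm_meas X)"
      then have y: "y \<in> mm_carrier X" by (simp add: space_mm)
      then obtain i where "mm_dist X y (q i) < r" using q(2) \<open>r > 0\<close> by blast
      then show "y \<in> (\<Union>n. \<Union>i<n. mball (q i) r)"
        using y qM by (auto intro!: exI[of _ "Suc i"] bexI[of _ i] simp: commute)
    qed
  qed (auto simp: space_mm)
  finally have "(\<lambda>n. prob (\<Union>i<n. mball (q i) r)) \<longlonglongrightarrow> 1" by (simp add: prob_space)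
  then have "\<forall>\<^sub>F n in sequentially. prob (\<Union>i<n. mball (q i) r) > 1 - \<epsilon>"
    using \<open>\<epsilon> > 0\<close> by (intro order_tendstoD) auto
  then have "\<forall>\<^sub>F n in sequentially. prob (\<Union>i<n. mball (q i) r) > 1 - \<epsilon> \<and> n > 0"
    by (intro eventually_conj eventually_gt_at_top)
  then obtain J where J: "prob (\<Union>i<J. mball (q i) r) > 1 - \<epsilon>" "J > 0"
    using eventually_happens by fastforce
  define K where "K k j = mcball (q j) (r - 1 / real (Suc k)) \<inter> (mm_carrier X - (\<Union>i<j. mball (q i) r))" for k j :: nat
  have K_sets: "K k j \<in> events" for k j
  proof -
    have "mcball (q j) (r - 1 / real (Suc k)) \<in> events" by (intro closedin_sets) simp
    moreover have "space (mm_meas X) - (\<Union>i<j. mball (q i) r) \<in> events"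
      by (intro sets.compl_sets sets.finite_UN openin_sets) auto
    ultimately show ?thesis unfolding K_def space_mm[symmetric] by blast
  qed
  have "(\<lambda>k. prob (\<Union>j<J. K k j)) \<longlonglongrightarrow> prob (\<Union>k. \<Union>j<J. K k j)"
  proof (intro finite_Lim_measure_incseq)
    show "incseq (\<lambda>k. \<Union>j<J. K k j)"
    proof (rule incseq_SucI)
      fix k
      have "K k j \<subseteq> K (Suc k) j" for j
      proof -
        have "1 / real (Suc (Suc k)) \<le> 1 / real (Suc k)" by (simp add: field_simps)
        then have "mcball (q j) (r - 1 / real (Suc k)) \<subseteq> mcball (q j) (r - 1 / real (Suc (Suc k)))"
          by (intro mcball_subset_concentric) linarith
        then show ?thesis unfolding K_def by blast
      qed
      then show "(\<Union>j<J. K k j) \<subseteq> (\<Union>j<J. K (Suc k) j)" by blast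
    qed
  qed (use K_sets in auto)
  moreover have "prob (\<Union>i<J. mball (q i) r) \<le> prob (\<Union>k. \<Union>j<J. K k j)"
  proof (rule finite_measure_mono)
    show "(\<Union>i<J. mball (q i) r) \<subseteq> (\<Union>k. \<Union>j<J. K k j)"
    proof
      fix y assume "y \<in> (\<Union>i<J. mball (q i) r)"
      then obtain i0 where i0: "i0 < J" "y \<in> mball (q i0) r" by blast
      \<comment> \<open>The first ball containing y selects the piece; membership in an open ball is
        strict, so some k leaves enough room.\<close>
      define i where "i = (LEAST i. y \<in> mball (q i) r)"
      have i: "y \<in> mball (q i) r" unfolding i_def using i0(2) by (rule LeastI)
      have "i \<le> i0" unfolding i_def using i0(2) by (rule Least_le)
      have notin: "y \<notin> mball (q i') r" if "i' < i" for i' using not_less_Least that unfolding i_def by blast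
      have "r - mm_dist X (q i) y > 0" using i by simp
      then obtain k where "1 / real (Suc k) < r - mm_dist X (q i) y" by (metis nat_approx_posE)
      then have "y \<in> K k i" unfolding K_def using i notin by auto
      moreover have "i < J" using \<open>i \<le> i0\<close> i0(1) by simp
      ultimately show "y \<in> (\<Union>k. \<Union>j<J. K k j)" by blast
    qed
    show "(\<Union>k. \<Union>j<J. K k j) \<in> events" using K_sets by (intro sets.countable_UN'' sets.finite_UN) auto
  qed
  ultimately have "\<forall>\<^sub>F k in sequentially. prob (\<Union>j<J. K k j) > 1 - \<epsilon>"
    using J(1) by - (erule order_tendstoD(1), linarith)
  then obtain k where k: "prob (\<Union>j<J. K k j) > 1 - \<epsilon>"
    using eventually_happens by fastforce
  show ?thesis
  proof (rule that[of J "1 / real (Suc k)" q "K k"])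
    show "K k j \<subseteq> mcball (q j) r" for j
    proof -
      have "mcball (q j) (r - 1 / real (Suc k)) \<subseteq> mcball (q j) r"
        by (intro mcball_subset_concentric) simp
      then show ?thesis unfolding K_def by blast
    qed
    show "1 / real (Suc k) \<le> mm_dist X y z" if "i < j" "y \<in> K k i" "z \<in> K k j" for i j y z
    proof -
      have "mm_dist X (q i) y \<le> r - 1 / real (Suc k)" "y \<in> mm_carrier X" "z \<in> mm_carrier X" "r \<le> mm_dist X (q i) z"
        using that qM by (auto simp: K_def not_less)
      then show ?thesis using triangle[OF qM, of y z i] by simp
    qed
    have "prob (\<Union>j<J. K k j) \<le> (\<Sum>j<J. prob (K k j))"
      using K_sets by (intro finite_measure_subadditive_finite) auto
    then show "1 - \<epsilon> < (\<Sum>j<J. prob (K k j))" using k by linarith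
  qed (use J qM K_sets in auto)
qed

text \<open>McShane extension with error 0, the index set being the pairs of a piece and a point in
  it.\<close>

lemma piecewise_constant_observable:
  assumes "mm_space Y" "R \<ge> 0" "\<And>j. j < J \<Longrightarrow> L j \<subseteq> mm_carrier Y" "\<And>j. j < J \<Longrightarrow> 0 \<le> v j \<and> v j \<le> R"
    and "\<And>i j y z. i < J \<Longrightarrow> j < J \<Longrightarrow> y \<in> L i \<Longrightarrow> z \<in> L j \<Longrightarrow> v i - v j \<le> mm_dist Y y z"
  obtains g where "lipschitz_observable Y g" "\<And>y. 0 \<le> g y \<and> g y \<le> R"
    "\<And>j y. j < (J::nat) \<Longrightarrow> y \<in> L j \<Longrightarrow> g y = v j"
proof -
  obtain g where g: "lipschitz_observable Y g" "\<And>y. 0 \<le> g y \<and> g y \<le> R"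
    "\<And>s. s \<in> {(j, y). j < J \<and> y \<in> L j} \<Longrightarrow> \<bar>g (snd s) - v (fst s)\<bar> \<le> 0"
    by (rule mcshane_extension[of Y "{(j, y). j < J \<and> y \<in> L j}" snd "\<lambda>s. v (fst s)" R 0])
       (use assms in \<open>auto simp: subset_iff\<close>)
  show ?thesis
    by (rule that[OF g(1,2)]) (use g(3)[of "(_, _)"] in auto)
qed

lemma Max_abs_diff_metric:
  fixes F :: "nat \<Rightarrow> real \<Rightarrow> real"
  assumes "J > 0"
  defines "D \<equiv> \<lambda>y z. Max ((\<lambda>i. \<bar>F i y - F i z\<bar>) ` {..<J})"
  shows Max_abs_diff_ge: "i < J \<Longrightarrow> \<bar>F i y - F i z\<bar> \<le> D y z"
    and Max_abs_diff_le: "(\<And>i. i < J \<Longrightarrow> \<bar>F i y - F i z\<bar> \<le> a) \<Longrightarrow> D y z \<le> a"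
    and Max_abs_diff_commute: "D y z = D z y"
    and Max_abs_diff_triangle: "D x z \<le> D x y + D y z"
proof -
  have ne: "(\<lambda>i. \<bar>F i y - F i z\<bar>) ` {..<J} \<noteq> {}" for y z using \<open>J > 0\<close> by auto
  show ge: "\<bar>F i y - F i z\<bar> \<le> D y z" if "i < J" for i y z
    unfolding D_def using that by (intro Max_ge) auto
  show le: "D y z \<le> a" if "\<And>i. i < J \<Longrightarrow> \<bar>F i y - F i z\<bar> \<le> a" for y z a
    unfolding D_def using that ne by (intro Max.boundedI) auto
  show "D y z = D z y" unfolding D_def by (simp add: abs_minus_commute)
  show "D x z \<le> D x y + D y z"
  proof (rule le)
    fix i assume "i < J"
    then show "\<bar>F i x - F i z\<bar> \<le> D x y + D y z" using ge[of i x y] ge[of i y z] by linarith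
  qed
qed

text \<open>Adding a small multiple of the original distance turns the pseudometric of finitely many
  1-Lipschitz functions into an equivalent metric on the same carrier, so that no quotient has to
  be completed.\<close>

lemma (in mm) finite_observation_space:
  fixes F :: "nat \<Rightarrow> real \<Rightarrow> real"
  assumes "J > 0" "0 < b" "b \<le> 1" and F: "\<And>i. i < J \<Longrightarrow> lipschitz_observable X (F i)"
  defines "d' \<equiv> \<lambda>y z. max (b * mm_dist X y z) (Max ((\<lambda>i. \<bar>F i y - F i z\<bar>) ` {..<J}))"
  shows "mm_space (d', mm_meas X)" "lip_le (d', mm_meas X) X"
proof -
  let ?D = "\<lambda>y z. Max ((\<lambda>i. \<bar>F i y - F i z\<bar>) ` {..<J})"
  have le: "d' y z \<le> mm_dist X y z" if "y \<in> mm_carrier X" "z \<in> mm_carrier X" for y z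
  proof -
    have "?D y z \<le> mm_dist X y z"
      using F that by (intro Max_abs_diff_le[OF \<open>J > 0\<close>]) (auto intro: lipschitz_observableD)
    moreover have "b * mm_dist X y z \<le> 1 * mm_dist X y z"
      using \<open>b \<le> 1\<close> by (intro mult_right_mono) auto
    ultimately show ?thesis by (simp add: d'_def)
  qed
  have "Metric_space (mm_carrier X) d'"
  proof
    fix x y z
    show "0 \<le> d' x y" using \<open>0 < b\<close> by (simp add: d'_def le_max_iff_disj)
    show "d' x y = d' y x"
      unfolding d'_def using Max_abs_diff_commute[OF \<open>J > 0\<close>, of F x y] by (simp add: commute)
    assume x: "x \<in> mm_carrier X" and y: "y \<in> mm_carrier X"
    show "(d' x y = 0) = (x = y)"
    proof
      assume "d' x y = 0"
      then have "b * mm_dist X x y \<le> 0" by (metis d'_def max.cobounded1)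
      then have "mm_dist X x y \<le> 0" using \<open>0 < b\<close> by (simp add: mult_le_0_iff)
      then show "x = y" using x y nonneg[of x y] zero[OF x y] by simp
    next
      assume "x = y"
      then show "d' x y = 0" using le[OF x y] x \<open>0 < b\<close> by (simp add: d'_def)
    qed
    assume z: "z \<in> mm_carrier X"
    have "b * mm_dist X x z \<le> b * mm_dist X x y + b * mm_dist X y z"
      using triangle[OF x y z] \<open>0 < b\<close> by (metis distrib_left mult_le_cancel_left_pos)
    moreover have "?D x z \<le> ?D x y + ?D y z" by (rule Max_abs_diff_triangle[OF \<open>J > 0\<close>])
    ultimately show "d' x z \<le> d' x y + d' y z" unfolding d'_def by linarith
  qed
  then show "mm_space (d', mm_meas X)"
  proof (rule bilipschitz_mm_space)
    show "b * mm_dist X x y \<le> d' x y" for x y by (simp add: d'_def)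
    show "d' x y \<le> 1 * mm_dist X x y" if "x \<in> mm_carrier X" "y \<in> mm_carrier X" for x y
      using le[OF that] by simp
  qed (use \<open>0 < b\<close> in auto)
  show "lip_le (d', mm_meas X) X" using mm_space le by (rule lip_le_identity)
qed

text \<open>If \<open>Y\<close> has pieces of about the same masses as the small pieces of \<open>X\<close>, and the pieces of \<open>Y\<close>
  are further apart than the centres of the pieces of \<open>X\<close>, then \<open>Y\<close> nearly dominates \<open>X\<close>.\<close>

lemma box_near_of_separated_pieces:
  fixes J :: nat
  assumes P: "pyramid P" and YP: "Y \<in> P" and X: "mm_space X" and J: "J > 0"
    and x: "\<And>j. x j \<in> mm_carrier X" and K: "\<And>j. K j \<in> sets (mm_meas X)"
    and K_ball: "\<And>j y. j < J \<Longrightarrow> y \<in> K j \<Longrightarrow> mm_dist X (x j) y \<le> \<epsilon> / 2"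
    and K_disj: "disjoint_family_on K {..<J}" and \<epsilon>: "0 < \<epsilon>" "\<epsilon> < 1"
    and L: "\<And>j. L j \<in> sets (mm_meas Y)" and L_disj: "disjoint_family_on L {..<J}"
    and L_far: "\<And>i j y z. i < J \<Longrightarrow> j < J \<Longrightarrow> y \<in> L i \<Longrightarrow> z \<in> L j \<Longrightarrow> mm_dist X (x i) (x j) \<le> mm_dist Y y z"
    and mass: "\<And>j. j < J \<Longrightarrow> measure (mm_meas X) (K j) \<le> measure (mm_meas Y) (L j) + \<epsilon> / J"
    and total: "(\<Sum>j<J. measure (mm_meas X) (K j)) \<ge> 1 - \<epsilon>"
  shows "box_near X P (4 * \<epsilon>)"
proof -
  interpret X: mm X by standard fact
  interpret Y: mm Y by standard (rule pyramid_mm[OF P YP])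
  have L_carrier: "L j \<subseteq> mm_carrier Y" for j
    using sets.sets_into_space[OF L] by (simp add: Y.space_mm)
  \<comment> \<open>A crude common bound for the distances between centres; it serves as the finite
    range of the observables.\<close>
  define S where "S = (\<Sum>i<J. \<Sum>j<J. mm_dist X (x i) (x j))"
  have S_ge: "mm_dist X (x i) (x j) \<le> S" if "i < J" "j < J" for i j
  proof -
    have "mm_dist X (x i) (x j) \<le> (\<Sum>j<J. mm_dist X (x i) (x j))"
      using that by (intro member_le_sum) auto
    also have "\<dots> \<le> S"
      unfolding S_def using that by (intro member_le_sum sum_nonneg) auto
    finally show ?thesis .
  qed
  have "S \<ge> 0" unfolding S_def by (intro sum_nonneg) auto
  \<comment> \<open>Frechet embedding: the i-th observable takes on the piece \<open>L j\<close> the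
    distance from \<open>x i\<close> to \<open>x j\<close>. The separation of the pieces of Y makes
    it 1-Lipschitz.\<close>
  have "\<exists>g. lipschitz_observable Y g \<and> (\<forall>j<J. \<forall>y\<in>L j. g y = mm_dist X (x i) (x j))" if i: "i < J" for i
  proof -
    obtain g where "lipschitz_observable Y g" "\<And>j y. j < J \<Longrightarrow> y \<in> L j \<Longrightarrow> g y = mm_dist X (x i) (x j)"
    proof (rule piecewise_constant_observable[of Y S J L "\<lambda>j. mm_dist X (x i) (x j)"])
      fix k j y z assume *: "k < J" "j < J" "y \<in> L k" "z \<in> L j"
      have "mm_dist X (x i) (x k) - mm_dist X (x i) (x j) \<le> mm_dist X (x k) (x j)"
        using X.triangle[OF x[of i] x[of j] x[of k]] by (simp add: X.commute)
      also have "\<dots> \<le> mm_dist Y y z" by (rule L_far[OF *])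
      finally show "mm_dist X (x i) (x k) - mm_dist X (x i) (x j) \<le> mm_dist Y y z" .
    qed (use Y.mm_space \<open>S \<ge> 0\<close> L_carrier S_ge i in auto)
    then show ?thesis by blast
  qed
  then obtain F where F: "\<And>i. i < J \<Longrightarrow> lipschitz_observable Y (F i)"
    "\<And>i j y. i < J \<Longrightarrow> j < J \<Longrightarrow> y \<in> L j \<Longrightarrow> F i y = mm_dist X (x i) (x j)"
    by metis
  obtain y0 where y0: "y0 \<in> mm_carrier Y" using Y.carrier_ne by blast
  obtain \<rho> where \<rho>: "\<rho> > 0" "Y.prob (Y.mball y0 \<rho>) > 1 - \<epsilon>"
    using Y.mm_big_ball[OF \<epsilon>(1) y0] by blast
  \<comment> \<open>In the ball of radius \<rho> distances are at most 2\<rho>, so the added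
    multiple of the original metric contributes at most \<epsilon> there.\<close>
  define b where "b = min 1 (\<epsilon> / (2 * \<rho>))"
  have b: "0 < b" "b \<le> 1" "b * (2 * \<rho>) \<le> \<epsilon>"
  proof -
    have "b \<le> \<epsilon> / (2 * \<rho>)" by (simp add: b_def)
    then show "b * (2 * \<rho>) \<le> \<epsilon>" using \<rho>(1) by (simp add: field_simps)
  qed (use \<epsilon> \<rho>(1) in \<open>auto simp: b_def\<close>)
  define D where "D y z = Max ((\<lambda>i. \<bar>F i y - F i z\<bar>) ` {..<J})" for y z
  define d' where "d' y z = max (b * mm_dist Y y z) (D y z)" for y z
  have Z: "mm_space (d', mm_meas Y)" "lip_le (d', mm_meas Y) Y"
    using Y.finite_observation_space[OF J b(1,2) F(1)] unfolding d'_def[abs_def] D_def[abs_def] by auto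
  define B where "B = Y.mball y0 \<rho>"
  have B[measurable]: "B \<in> Y.events" unfolding B_def by (intro Y.openin_sets) simp
  define L' where "L' j = L j \<inter> B" for j
  have L'[measurable]: "L' j \<in> Y.events" for j using L B by (auto simp: L'_def)
  note [measurable] = K L
  have L'_disj: "disjoint_family_on L' {..<J}"
    using L_disj by (auto simp: disjoint_family_on_def L'_def)
  define \<theta> where "\<theta> = 1 - \<epsilon>"
  obtain \<Omega> where \<Omega>: "prob_space \<Omega>" "sets \<Omega> = sets (mm_meas X \<Otimes>\<^sub>M mm_meas Y)"
    "distr \<Omega> (mm_meas X) fst = mm_meas X" "distr \<Omega> (mm_meas Y) snd = mm_meas Y"
    "measure \<Omega> {z \<in> space (mm_meas X \<Otimes>\<^sub>M mm_meas Y). \<exists>j<J. fst z \<in> K j \<and> snd z \<in> L' j} \<ge>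
      \<theta> * (\<Sum>j<J. min (X.prob (K j)) (Y.prob (L' j)))"
    by (rule partial_coupling[OF X.prob_space_axioms Y.prob_space_axioms K L' K_disj L'_disj, of \<theta>])
       (use \<epsilon> in \<open>auto simp: \<theta>_def\<close>)
  define W where "W = {z \<in> space (mm_meas X \<Otimes>\<^sub>M mm_meas Y). \<exists>j<J. fst z \<in> K j \<and> snd z \<in> L' j}"
  have W: "W \<in> sets (mm_meas X \<Otimes>\<^sub>M mm_meas Y)" unfolding W_def by measurable
  have lost: "(\<Sum>j<J. Y.prob (L j) - Y.prob (L' j)) \<le> \<epsilon>"
  proof -
    have "(\<Sum>j<J. Y.prob (L j) - Y.prob (L' j)) = (\<Sum>j<J. Y.prob (L j - B))"
    proof (rule sum.cong)
      fix j
      have "Y.prob (L j - B) = Y.prob (L j - L' j)" by (rule arg_cong[where f=Y.prob]) (auto simp: L'_def)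
      also have "\<dots> = Y.prob (L j) - Y.prob (L' j)"
        by (intro Y.finite_measure_Diff) (use L L' in \<open>auto simp: L'_def\<close>)
      finally show "Y.prob (L j) - Y.prob (L' j) = Y.prob (L j - B)" by simp
    qed simp
    also have "\<dots> = Y.prob (\<Union>j<J. L j - B)"
      using L_disj L B by (intro Y.finite_measure_finite_Union[symmetric]) (auto simp: disjoint_family_on_def)
    also have "\<dots> \<le> Y.prob (space (mm_meas Y) - B)"
      using L_carrier
      by (intro Y.finite_measure_mono[OF _ sets.compl_sets[OF B]]) (auto simp: Y.space_mm)
    also have "\<dots> \<le> \<epsilon>" using \<rho>(2) B by (simp add: Y.prob_compl B_def)
    finally show ?thesis .
  qed
  \<comment> \<open>Four losses of \<epsilon> each: the mass of X outside the pieces, the deficient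
    masses of the \<open>L j\<close>, the mass of Y outside the ball, and the factor
    \<theta>.\<close>
  have "1 - 4 * \<epsilon> \<le> \<theta> * (1 - 3 * \<epsilon>)"
    using \<epsilon> by (simp add: \<theta>_def algebra_simps)
  also have "\<dots> \<le> \<theta> * (\<Sum>j<J. min (X.prob (K j)) (Y.prob (L' j)))"
  proof (rule mult_left_mono)
    have "1 - 3 * \<epsilon> \<le> (\<Sum>j<J. X.prob (K j)) - (\<Sum>j<J. \<epsilon> / J) - (\<Sum>j<J. Y.prob (L j) - Y.prob (L' j))"
      using total lost J by simp
    also have "\<dots> = (\<Sum>j<J. X.prob (K j) - \<epsilon> / J - (Y.prob (L j) - Y.prob (L' j)))"
      by (simp only: sum_subtractf)
    also have "\<dots> \<le> (\<Sum>j<J. min (X.prob (K j)) (Y.prob (L' j)))"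
    proof (rule sum_mono)
      fix j assume j: "j \<in> {..<J}"
      have "Y.prob (L' j) \<le> Y.prob (L j)"
        using L by (intro Y.finite_measure_mono) (auto simp: L'_def)
      moreover have "0 \<le> \<epsilon> / J" using \<epsilon> by simp
      ultimately show "X.prob (K j) - \<epsilon> / J - (Y.prob (L j) - Y.prob (L' j)) \<le> min (X.prob (K j)) (Y.prob (L' j))"
        using mass[of j] j by simp
    qed
    finally show "1 - 3 * \<epsilon> \<le> (\<Sum>j<J. min (X.prob (K j)) (Y.prob (L' j)))" .
  qed (use \<epsilon> in \<open>simp add: \<theta>_def\<close>)
  also have "\<dots> \<le> measure \<Omega> W" using \<Omega>(5) by (simp add: W_def)
  finally have W_mass: "1 - 4 * \<epsilon> \<le> measure \<Omega> W" .
  \<comment> \<open>The triangle inequality bounds every coordinate of the embedding by the distance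
    of the centres, and coordinate i attains it.\<close>
  have D_eq: "D y z = mm_dist X (x i) (x j)" if "i < J" "j < J" "y \<in> L i" "z \<in> L j" for i j y z
  proof (rule antisym)
    show "D y z \<le> mm_dist X (x i) (x j)"
      unfolding D_def
    proof (rule Max_abs_diff_le[OF J])
      fix k assume "k < J"
      then show "\<bar>F k y - F k z\<bar> \<le> mm_dist X (x i) (x j)"
        using that X.mdist_reverse_triangle[OF x[of i] x[of k] x[of j]] by (simp add: F(2) X.commute)
    qed
    have "\<bar>F i y - F i z\<bar> \<le> D y z" unfolding D_def by (rule Max_abs_diff_ge[OF J that(1)])
    then show "mm_dist X (x i) (x j) \<le> D y z" using that x by (simp add: F(2))
  qed
  have "box_admissible X (d', mm_meas Y) (4 * \<epsilon>)"
  proof (rule box_admissible_coupling[OF X Z(1) \<Omega>(1)])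
    show "fst \<in> measurable \<Omega> (mm_meas X)" "snd \<in> measurable \<Omega> (mm_meas (d', mm_meas Y))"
      by (auto simp: measurable_cong_sets[OF \<Omega>(2) refl])
    have "{\<omega> \<in> space \<Omega>. (fst \<omega>, snd \<omega>) \<in> W} = W"
      using sets_eq_imp_space_eq[OF \<Omega>(2)] by (auto simp: W_def)
    then show "1 - 4 * \<epsilon> \<le> measure \<Omega> {\<omega> \<in> space \<Omega>. (fst \<omega>, snd \<omega>) \<in> W}" using W_mass by simp
    fix u y u' y' assume "(u, y) \<in> W" "(u', y') \<in> W"
    then obtain i j where ij: "i < J" "j < J" "u \<in> K i" "y \<in> L' i" "u' \<in> K j" "y' \<in> L' j"
      by (auto simp: W_def)
    have uK: "u \<in> mm_carrier X" "u' \<in> mm_carrier X"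
      using ij sets.sets_into_space[OF K] by (auto simp: X.space_mm)
    have yB: "y \<in> B" "y' \<in> B" "y \<in> L i" "y' \<in> L j" using ij by (auto simp: L'_def)
    have "mm_dist Y y y' \<le> 2 * \<rho>"
      using Y.triangle''[of y y0 y'] yB by (auto simp: B_def)
    then have "b * mm_dist Y y y' \<le> b * (2 * \<rho>)" using b(1) by simp
    then have "b * mm_dist Y y y' \<le> \<epsilon>" using b(3) by linarith
    moreover have "D y y' = mm_dist X (x i) (x j)" using D_eq ij yB by blast
    moreover have "0 \<le> mm_dist X (x i) (x j)" by simp
    ultimately have d': "mm_dist X (x i) (x j) \<le> d' y y'" "d' y y' \<le> mm_dist X (x i) (x j) + \<epsilon>"
      using \<epsilon>(1) unfolding d'_def by linarith+
    have near: "mm_dist X (x i) u \<le> \<epsilon> / 2" "mm_dist X (x j) u' \<le> \<epsilon> / 2"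
      using K_ball ij by auto
    have "mm_dist X u u' \<le> mm_dist X (x i) u + mm_dist X (x i) (x j) + mm_dist X (x j) u'"
      using X.triangle[OF uK(1) x[of i] uK(2)] X.triangle[OF x[of i] x[of j] uK(2)] X.commute[of u "x i"] by linarith
    moreover have "mm_dist X (x i) (x j) \<le> mm_dist X (x i) u + mm_dist X u u' + mm_dist X (x j) u'"
      using X.triangle[OF x[of i] uK(1) x[of j]] X.triangle[OF uK(1) uK(2) x[of j]] X.commute[of u' "x j"] by linarith
    ultimately show "\<bar>mm_dist X u u' - mm_dist (d', mm_meas Y) y y'\<bar> \<le> 4 * \<epsilon>"
      using d' near \<epsilon>(1) unfolding mm_dist_Pair by linarith
  qed (use \<Omega> W \<epsilon> in auto)
  moreover have "(d', mm_meas Y) \<in> P"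
    by (rule pyramid_down[OF P YP Z])
  ultimately show ?thesis unfolding box_near_def by blast
qed

section \<open>Local size functions\<close>

text \<open>Contrapositive for the last claim: a law of \<open>pyr_scale (1 / v) P\<close> with
  small deficit comes from an observable whose values near distinct \<open>c j\<close> pull back to
  pieces of some Y in P, and the factor v magnifies the gaps between the \<open>c j\<close> to at
  least the distances between the centres in tX.\<close>

lemma pyramid_deficit_separates:
  assumes P: "pyramid P" and XP: "X \<in> P" and "t > 0" and notin: "mm_scale t X \<notin> P"
  obtains J m c w R \<delta> v where "law_deficit w R" "\<delta> > 0" "v > 0"
    "law_deficit.pyramid_deficit J m c w R P \<le> 0"
    "law_deficit.pyramid_deficit J m c w R (pyr_scale (1 / v) P) \<ge> \<delta>"
proof -
  interpret X: mm X by standard (rule pyramid_mm[OF P XP])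
  have tX: "mm_space (mm_scale t X)" using X.mm_space \<open>t > 0\<close> by (rule mm_space_scale)
  obtain e where e: "e > 0" "\<not> box_near (mm_scale t X) P e"
    using pyramid_closed[OF P tX] notin by blast
  define \<epsilon> where "\<epsilon> = min (e / 4) (1 / 2)"
  have \<epsilon>: "0 < \<epsilon>" "\<epsilon> < 1" "4 * \<epsilon> \<le> e" using e(1) by (auto simp: \<epsilon>_def)
  have far: "\<not> box_near (mm_scale t X) P (4 * \<epsilon>)"
    using e(2) \<epsilon>(3) box_near_mono by blast
  \<comment> \<open>Pieces of radius r in X have radius \<epsilon>/2 after scaling by t.\<close>
  define r where "r = \<epsilon> / (2 * t)"
  have r: "r > 0" "t * r = \<epsilon> / 2" using \<epsilon>(1) \<open>t > 0\<close> by (auto simp: r_def)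
  obtain J :: nat and x K \<eta> where J: "J > 0" and \<eta>: "\<eta> > 0" and x: "\<And>j. x j \<in> mm_carrier X"
    and K: "\<And>j. K j \<in> X.events" and K_ball: "\<And>j. K j \<subseteq> X.mcball (x j) r"
    and K_sep: "\<And>i j y z. i < j \<Longrightarrow> y \<in> K i \<Longrightarrow> z \<in> K j \<Longrightarrow> \<eta> \<le> mm_dist X y z"
    and K_total: "(\<Sum>j<J. X.prob (K j)) > 1 - \<epsilon>"
    by (rule X.separated_pieces[OF r(1) \<epsilon>(1)]) blast
  have K_carrier: "K j \<subseteq> mm_carrier X" for j
    using sets.sets_into_space[OF K] by (simp add: X.space_mm)
  have K_sep': "\<eta> \<le> mm_dist X y z" if "i \<noteq> j" "y \<in> K i" "z \<in> K j" for i j y z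
    using K_sep[of i j y z] K_sep[of j i z y] that X.commute[of y z] by (cases "i < j") auto
  \<comment> \<open>The J values \<open>c j\<close> are equally spaced in [0,\<eta>], so they differ
    by at most the separation of the pieces and define a 1-Lipschitz function on them. The width
    \<kappa>/4 leaves gaps of at least \<kappa>/2 between the supports of the tents.\<close>
  define \<kappa> where "\<kappa> = \<eta> / J"
  have \<kappa>: "\<kappa> > 0" "J * \<kappa> = \<eta>" using \<eta> J by (auto simp: \<kappa>_def)
  define c where "c j = real j * \<kappa>" for j
  define w where "w = \<kappa> / 4"
  define m where "m j = X.prob (K j)" for j
  have c_range: "0 \<le> c j \<and> c j \<le> \<eta>" if "j < J" for j
  proof -
    have "real j * \<kappa> \<le> real J * \<kappa>" using that \<kappa>(1) by (intro mult_right_mono) auto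
    then show ?thesis using \<kappa> by (simp add: c_def)
  qed
  have c_gap: "\<kappa> \<le> \<bar>c i - c j\<bar>" if "i \<noteq> j" for i j
  proof -
    have "1 \<le> \<bar>real i - real j\<bar>" using that by linarith
    then have "1 * \<kappa> \<le> \<bar>real i - real j\<bar> * \<kappa>" using \<kappa>(1) by (intro mult_right_mono) auto
    then show ?thesis using \<kappa>(1) by (simp add: c_def abs_mult flip: left_diff_distrib)
  qed
  interpret D: law_deficit J m c w \<eta>
    by standard (use \<kappa> \<eta> in \<open>auto simp: w_def\<close>)
  obtain f where f: "lipschitz_observable X f" "\<And>y. 0 \<le> f y \<and> f y \<le> \<eta>"
    "\<And>j y. j < J \<Longrightarrow> y \<in> K j \<Longrightarrow> f y = c j"
  proof (rule piecewise_constant_observable[of X \<eta> J K c])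
    fix i j y z assume *: "i < J" "j < J" "y \<in> K i" "z \<in> K j"
    show "c i - c j \<le> mm_dist X y z"
    proof (cases "i = j")
      case False
      then show ?thesis using K_sep'[OF False *(3,4)] c_range[OF *(1)] c_range[OF *(2)] by linarith
    qed simp
  qed (use X.mm_space \<eta> K_carrier c_range in auto)
  have fm[measurable]: "f \<in> borel_measurable (mm_meas X)" by (rule X.observable_measurable[OF f(1)])
  have zero: "D.deficit (distr (mm_meas X) borel f) = 0"
    unfolding D.deficit_def
  proof (rule sum.neutral, rule ballI)
    fix j assume j: "j \<in> {..<J}"
    have "m j = (\<integral>y. indicator (K j) y \<partial>mm_meas X)" using K by (simp add: m_def)
    also have "\<dots> \<le> (\<integral>y. D.tent j (f y) \<partial>mm_meas X)"
    proof (rule integral_mono)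
      show "integrable (mm_meas X) (\<lambda>y. D.tent j (f y))"
        by (rule X.integrable_const_bound[of _ 1]) (auto simp: D.tent_bounds)
      show "indicator (K j) y \<le> D.tent j (f y)" for y
        using f(3)[of j y] j by (cases "y \<in> K j") (auto simp: D.tent_bounds D.tent_def)
    qed (use K in \<open>auto simp: X.emeasure_eq_measure\<close>)
    also have "\<dots> = (\<integral>x. D.tent j x \<partial>distr (mm_meas X) borel f)"
      by (simp add: integral_distr)
    finally show "max 0 (m j - (\<integral>x. D.tent j x \<partial>distr (mm_meas X) borel f)) = 0" by simp
  qed
  have le0: "D.pyramid_deficit P \<le> 0"
    using D.pyramid_deficit_le[OF observable_lawsI[OF XP f(1) f(2)]] zero by simp
  define S where "S = (\<Sum>i<J. \<Sum>j<J. t * mm_dist X (x i) (x j))"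
  have S_ge: "t * mm_dist X (x i) (x j) \<le> S" if "i < J" "j < J" for i j
  proof -
    have "t * mm_dist X (x i) (x j) \<le> (\<Sum>j<J. t * mm_dist X (x i) (x j))"
      using that \<open>t > 0\<close> by (intro member_le_sum) auto
    also have "\<dots> \<le> S"
      unfolding S_def using that \<open>t > 0\<close> by (intro member_le_sum sum_nonneg) auto
    finally show ?thesis .
  qed
  have "S \<ge> 0" unfolding S_def using \<open>t > 0\<close> by (intro sum_nonneg) auto
  \<comment> \<open>v magnifies the gap \<kappa>/2 to at least S, the bound for all scaled distances
    between centres; the summand 1 keeps v positive when S = 0.\<close>
  define v where "v = 2 * S / \<kappa> + 1"
  have v: "v > 0" "v * (\<kappa> / 2) \<ge> S"
  proof -
    show "v > 0" unfolding v_def using \<open>S \<ge> 0\<close> \<kappa>(1) by (simp add: add_nonneg_pos)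
    have "v * (\<kappa> / 2) = S + \<kappa> / 2" using \<kappa>(1) by (simp add: v_def field_simps)
    then show "v * (\<kappa> / 2) \<ge> S" using \<kappa>(1) by simp
  qed
  \<comment> \<open>The deficit is a sum of nonnegative terms, so a total below \<epsilon>/J bounds
    the missing mass of every single piece, as \<open>box_near_of_separated_pieces\<close>
    requires.\<close>
  define \<delta> where "\<delta> = \<epsilon> / J"
  have "\<delta> > 0" using \<epsilon> J by (simp add: \<delta>_def)
  have "D.pyramid_deficit (pyr_scale (1 / v) P) \<ge> \<delta>"
  proof (rule ccontr)
    assume "\<not> ?thesis"
    moreover have P': "pyramid (pyr_scale (1 / v) P)" using P v(1) by (intro pyramid_scale) auto
    ultimately obtain \<nu> where \<nu>: "\<nu> \<in> observable_laws (pyr_scale (1 / v) P) \<eta>" "D.deficit \<nu> < \<delta>"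
      using D.pyramid_deficit_lessD[OF P'] by (auto simp: not_le)
    then obtain Z g where Z: "Z \<in> pyr_scale (1 / v) P" "lipschitz_observable Z g" "\<nu> = distr (mm_meas Z) borel g"
      unfolding observable_laws_def by blast
    then obtain Y where Y: "Y \<in> P" "Z = mm_scale (1 / v) Y" by (auto simp: pyr_scale_def)
    interpret Y: mm Y by standard (rule pyramid_mm[OF P Y(1)])
    interpret Z: mm Z by standard (rule pyramid_mm[OF P' Z(1)])
    have gm[measurable]: "g \<in> borel_measurable (mm_meas Y)"
      using Z.observable_measurable[OF Z(2)] Y(2) by simp
    have g_lip: "v * \<bar>g y - g z\<bar> \<le> mm_dist Y y z" if "y \<in> mm_carrier Y" "z \<in> mm_carrier Y" for y z
      using lipschitz_observableD[OF Z(2), of y z] that v(1) Y(2) by (simp add: field_simps)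
    define L where "L j = {y \<in> space (mm_meas Y). \<bar>g y - c j\<bar> < w}" for j
    have L: "L j \<in> Y.events" for j unfolding L_def by measurable
    have L_gap: "S \<le> mm_dist Y y z" "y \<noteq> z" if "i \<noteq> j" "y \<in> L i" "z \<in> L j" for i j y z
    proof -
      have yz: "\<bar>g y - c i\<bar> < \<kappa> / 4" "\<bar>g z - c j\<bar> < \<kappa> / 4" "y \<in> mm_carrier Y" "z \<in> mm_carrier Y"
        using that by (auto simp: L_def w_def Y.space_mm)
      then have gap: "\<kappa> / 2 \<le> \<bar>g y - g z\<bar>" using c_gap[OF that(1)] by linarith
      then show "y \<noteq> z" using \<kappa>(1) by auto
      have "v * (\<kappa> / 2) \<le> v * \<bar>g y - g z\<bar>" using gap v(1) by (intro mult_left_mono) auto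
      then show "S \<le> mm_dist Y y z" using v(2) g_lip[OF yz(3,4)] by linarith
    qed
    have "box_near (mm_scale t X) P (4 * \<epsilon>)"
    proof (rule box_near_of_separated_pieces[OF P Y(1) tX J, of x K \<epsilon> L])
      show "mm_dist (mm_scale t X) (x j) y \<le> \<epsilon> / 2" if "j < J" "y \<in> K j" for j y
      proof -
        have "t * mm_dist X (x j) y \<le> t * r" using K_ball[of j] that \<open>t > 0\<close> by (intro mult_left_mono) auto
        then show ?thesis using r(2) by simp
      qed
      show "disjoint_family_on K {..<J}"
      proof (unfold disjoint_family_on_def, intro ballI impI)
        fix i j :: nat assume "i \<noteq> j"
        then show "K i \<inter> K j = {}"
          using K_sep'[of i j] \<eta> K_carrier[of i] by (force simp: not_le[symmetric])
      qed
      show "disjoint_family_on L {..<J}"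
        unfolding disjoint_family_on_def using L_gap(2) by blast
      show "mm_dist (mm_scale t X) (x i) (x j) \<le> mm_dist Y y z"
        if "i < J" "j < J" "y \<in> L i" "z \<in> L j" for i j y z
      proof (cases "i = j")
        case True
        then show ?thesis using x by simp
      next
        case False
        then show ?thesis using L_gap(1)[OF False that(3,4)] S_ge[OF that(1,2)] by simp
      qed
      show "measure (mm_meas (mm_scale t X)) (K j) \<le> Y.prob (L j) + \<epsilon> / J" if j: "j < J" for j
      proof -
        have "max 0 (m j - (\<integral>x. D.tent j x \<partial>\<nu>)) \<le> D.deficit \<nu>"
          unfolding D.deficit_def using j by (intro member_le_sum) auto
        then have "m j - (\<integral>x. D.tent j x \<partial>\<nu>) \<le> \<epsilon> / J" using \<nu>(2) unfolding \<delta>_def by linarith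
        moreover have "(\<integral>x. D.tent j x \<partial>\<nu>) = (\<integral>y. D.tent j (g y) \<partial>mm_meas Y)"
          unfolding Z(3) Y(2) by (simp add: integral_distr)
        moreover have "\<dots> \<le> (\<integral>y. indicator (L j) y \<partial>mm_meas Y)"
        proof (rule integral_mono)
          show "integrable (mm_meas Y) (\<lambda>y. D.tent j (g y))"
            by (rule Y.integrable_const_bound[of _ 1]) (auto simp: D.tent_bounds)
          show "D.tent j (g y) \<le> indicator (L j) y" if "y \<in> space (mm_meas Y)" for y
            using that D.w D.tent_bounds(2)[of j "g y"]
            by (cases "y \<in> L j") (auto simp: L_def D.tent_def not_less)
        qed (use L in \<open>auto simp: Y.emeasure_eq_measure\<close>)
        ultimately show ?thesis using L by (simp add: m_def)
      qed
    qed (use x K K_total \<epsilon> L in auto)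
    then show False using far by blast
  qed
  then show ?thesis
    using that[OF D.law_deficit_axioms \<open>\<delta> > 0\<close> v(1) le0] by blast
qed

section \<open>Scaling along an orbit\<close>

lemma pyr_scale_antimono:
  assumes "pyramid P" "0 < s" "s \<le> t"
  shows "pyr_scale s P \<subseteq> pyr_scale t P"
proof -
  have "pyr_scale (s / t) (pyr_scale t P) \<subseteq> pyr_scale t P"
    using assms by (intro pyr_scale_subset pyramid_scale) auto
  then show ?thesis using assms by simp
qed

lemma nonfixed_witness:
  assumes P: "pyramid P" and nonfix: "\<not> (\<forall>t>0. pyr_scale t P = P)"
  obtains X t where "X \<in> P" "t > 0" "mm_scale t X \<notin> P"
proof -
  have "\<exists>X\<in>P. \<exists>t>0. mm_scale t X \<notin> P"
  proof (rule ccontr)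
    assume "\<not> ?thesis"
    then have sub: "pyr_scale t P \<subseteq> P" if "t > 0" for t using that by (auto simp: pyr_scale_def)
    have "pyr_scale t P = P" if "t > 0" for t
    proof
      show "pyr_scale t P \<subseteq> P" using sub that .
      have "pyr_scale t (pyr_scale (1 / t) P) \<subseteq> pyr_scale t P"
        using that by (intro pyr_scale_mono sub) simp
      then show "P \<subseteq> pyr_scale t P" using that by simp
    qed
    then show False using nonfix by blast
  qed
  then show ?thesis using that by blast
qed

text \<open>The orbit is a chain: if tP = P for one t \<noteq> 1, then all powers of some a < 1 fix
  P, and a power below s gives P \<subseteq> sP for every s; the inclusion for 1/s, rescaled, is the
  converse.\<close>

lemma nonfixed_free:
  assumes P: "pyramid P" and t: "t > 0" "t \<noteq> 1" and fix_t: "pyr_scale t P = P"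
  shows "\<forall>s>0. pyr_scale s P = P"
proof -
  define a where "a = (if t < 1 then t else 1 / t)"
  have a: "0 < a" "a < 1" using t by (auto simp: a_def field_simps)
  have fix_inv: "pyr_scale (1 / t) P = P"
  proof -
    have "pyr_scale (1 / t) (pyr_scale t P) = pyr_scale (1 / t) P" by (simp only: fix_t)
    then show ?thesis using t(1) by simp
  qed
  have "pyr_scale a P = P" using fix_t fix_inv by (simp add: a_def)
  then have pow: "pyr_scale (a ^ n) P = P" for n
  proof (induction n)
    case (Suc n)
    have "pyr_scale (a ^ Suc n) P = pyr_scale a (pyr_scale (a ^ n) P)" by simp
    then show ?case using Suc by simp
  qed simp
  have sup: "P \<subseteq> pyr_scale s P" if s: "s > 0" for s
  proof -
    obtain n where "a ^ n < s" using real_arch_pow_inv[OF s a(2)] by blast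
    then have "pyr_scale (a ^ n) P \<subseteq> pyr_scale s P"
      using a(1) by (intro pyr_scale_antimono[OF P]) auto
    then show ?thesis by (simp add: pow)
  qed
  show ?thesis
  proof (intro allI impI equalityI)
    fix s :: real assume s: "s > 0"
    have "pyr_scale s P \<subseteq> pyr_scale s (pyr_scale (1 / s) P)"
      using s by (intro pyr_scale_mono sup) simp
    then show "pyr_scale s P \<subseteq> P" using s by simp
    show "P \<subseteq> pyr_scale s P" using sup[OF s] .
  qed
qed

section \<open>Integrating a monotone functional over all scales\<close>

locale pyramid_functional =
  fixes H :: "mmspace set \<Rightarrow> real" and a :: real
  assumes H_conv: "\<And>Ps P. (\<And>n. pyramid (Ps n)) \<Longrightarrow> pyramid P \<Longrightarrow> weak_conv Ps P \<Longrightarrow>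
      (\<lambda>n. H (Ps n)) \<longlonglongrightarrow> H P"
    and H_antimono: "\<And>P Q. pyramid P \<Longrightarrow> P \<subseteq> Q \<Longrightarrow> H Q \<le> H P"
    and H_nonneg: "\<And>P. pyramid P \<Longrightarrow> 0 \<le> H P"
begin

text \<open>Since \<open>H (pyr_scale (1 / s) P)\<close> is nondecreasing in s, a value below a
  makes the integral of the profile positive, and a value above a confines the profile to a bounded
  interval. Strictness of both inequalities makes the domain open.\<close>

definition section_domain :: "mmspace set set" where
  "section_domain = {P. pyramid P \<and> (\<exists>u>0. H (pyr_scale (1 / u) P) < a) \<and>
    (\<exists>v>0. H (pyr_scale (1 / v) P) > a)}"

definition profile :: "mmspace set \<Rightarrow> real \<Rightarrow> real" where
  "profile P s = indicator {0<..} s * max 0 (a - H (pyr_scale (1 / s) P))"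

definition size_fun :: "mmspace set \<Rightarrow> real" where
  "size_fun P = (\<integral>s. profile P s \<partial>lborel)"

lemma H_scale_mono:
  assumes "pyramid P" "0 < s" "s \<le> s'"
  shows "H (pyr_scale (1 / s) P) \<le> H (pyr_scale (1 / s') P)"
  using assms by (intro H_antimono pyramid_scale pyr_scale_antimono) (auto simp: field_simps)

lemma profile_nonneg: "0 \<le> profile P s"
  by (simp add: profile_def)

lemma profile_le:
  assumes "pyramid P" "v > 0" "H (pyr_scale (1 / v) P) > a"
  shows "profile P s \<le> \<bar>a\<bar> * indicator {0..v} s"
proof (cases "0 < s")
  case True
  have 0: "0 \<le> H (pyr_scale (1 / s) P)" using assms(1) True by (intro H_nonneg pyramid_scale) auto
  show ?thesis
  proof (cases "s \<le> v")
    case False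
    then have "H (pyr_scale (1 / v) P) \<le> H (pyr_scale (1 / s) P)"
      using assms by (intro H_scale_mono) auto
    then show ?thesis using assms(3) False by (simp add: profile_def)
  qed (use True 0 in \<open>simp add: profile_def\<close>)
qed (simp add: profile_def indicator_def)

text \<open>The functional is monotone in the scale, and monotone functions are Borel.\<close>

lemma profile_measurable:
  assumes "pyramid P"
  shows "profile P \<in> borel_measurable borel"
proof -
  have "mono_on {0<..} (\<lambda>s. H (pyr_scale (1 / s) P))"
    by (intro mono_onI H_scale_mono[OF assms]) auto
  then have "(\<lambda>s. H (pyr_scale (1 / s) P)) \<in> borel_measurable (restrict_space borel {0<..})"
    by (rule borel_measurable_mono_on_fnc)
  then have "(\<lambda>s. max 0 (a - H (pyr_scale (1 / s) P))) \<in> borel_measurable (restrict_space borel {0<..})"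
    by measurable
  then show ?thesis
    by (subst (asm) borel_measurable_restrict_space_iff) (auto simp: profile_def[abs_def])
qed

lemma profile_integrable:
  assumes "P \<in> section_domain"
  shows "integrable lborel (profile P)"
proof -
  obtain v where v: "pyramid P" "v > 0" "H (pyr_scale (1 / v) P) > a"
    using assms by (auto simp: section_domain_def)
  show ?thesis
  proof (rule Bochner_Integration.integrable_bound)
    show "integrable lborel (\<lambda>s. \<bar>a\<bar> * indicator {0..v} s :: real)" using v(2) by auto
    show "profile P \<in> borel_measurable lborel" using profile_measurable[OF v(1)] by simp
    show "AE s in lborel. norm (profile P s) \<le> norm (\<bar>a\<bar> * indicator {0..v} s :: real)"
      using profile_le[OF v] profile_nonneg by (intro AE_I2) (simp add: abs_mult)
  qed
qed

text \<open>Up to the scale u the profile is at least a positive constant, so its integral is at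
  least the area of a rectangle.\<close>

lemma size_fun_pos:
  assumes "P \<in> section_domain"
  shows "size_fun P > 0"
proof -
  obtain u where u: "pyramid P" "u > 0" "H (pyr_scale (1 / u) P) < a"
    using assms by (auto simp: section_domain_def)
  define b where "b = a - H (pyr_scale (1 / u) P)"
  have "0 < b * u" using u by (simp add: b_def)
  also have "b * u = (\<integral>s. b * indicator {0<..u} s \<partial>lborel)" using u(2) by simp
  also have "\<dots> \<le> (\<integral>s. profile P s \<partial>lborel)"
  proof (rule integral_mono)
    show "integrable lborel (\<lambda>s. b * indicator {0<..u} s :: real)" using u(2) by auto
    show "b * indicator {0<..u} s \<le> profile P s" for s
    proof (cases "s \<in> {0<..u}")
      case True
      then have "H (pyr_scale (1 / s) P) \<le> H (pyr_scale (1 / u) P)" using u by (intro H_scale_mono) auto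
      then show ?thesis using True by (simp add: profile_def b_def)
    qed (simp add: profile_nonneg)
  qed (rule profile_integrable[OF assms])
  finally show ?thesis by (simp add: size_fun_def)
qed

lemma section_domain_scale:
  assumes "P \<in> section_domain" "t > 0"
  shows "pyr_scale t P \<in> section_domain"
proof -
  obtain u v where *: "pyramid P" "u > 0" "H (pyr_scale (1 / u) P) < a" "v > 0" "H (pyr_scale (1 / v) P) > a"
    using assms by (auto simp: section_domain_def)
  show ?thesis
    unfolding section_domain_def
  proof (intro CollectI conjI exI)
    show "0 < t * u" "0 < t * v" using * \<open>t > 0\<close> by auto
    show "H (pyr_scale (1 / (t * u)) (pyr_scale t P)) < a" "a < H (pyr_scale (1 / (t * v)) (pyr_scale t P))"
      using * \<open>t > 0\<close> by auto
  qed (use * \<open>t > 0\<close> in \<open>auto intro: pyramid_scale\<close>)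
qed

text \<open>The profile of tP at ts is the profile of P at s, so the substitution by t yields the
  factor.\<close>

lemma size_fun_scale:
  assumes "t > 0"
  shows "size_fun (pyr_scale t P) = t * size_fun P"
proof -
  have "profile (pyr_scale t P) (0 + t * s) = profile P s" for s
    using assms by (simp add: profile_def indicator_def zero_less_mult_iff)
  then show ?thesis
    unfolding size_fun_def using assms
    by (subst lborel_integral_real_affine[where c=t and t=0]) auto
qed

lemma H_scale_conv:
  assumes "\<And>n. pyramid (Ps n)" "pyramid P" "weak_conv Ps P" "s > 0"
  shows "(\<lambda>n. H (pyr_scale (1 / s) (Ps n))) \<longlonglongrightarrow> H (pyr_scale (1 / s) P)"
  using assms by (intro H_conv pyramid_scale weak_conv_scale) auto

lemma section_domain_open:
  assumes Ps: "\<And>n. pyramid (Ps n)" and P: "P \<in> section_domain" and conv: "weak_conv Ps P"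
  shows "\<forall>\<^sub>F n in sequentially. Ps n \<in> section_domain"
proof -
  obtain u v where *: "pyramid P" "u > 0" "H (pyr_scale (1 / u) P) < a" "v > 0" "H (pyr_scale (1 / v) P) > a"
    using P by (auto simp: section_domain_def)
  have "\<forall>\<^sub>F n in sequentially. H (pyr_scale (1 / u) (Ps n)) < a"
    using H_scale_conv[OF Ps *(1) conv *(2)] *(3) by (rule order_tendstoD)
  moreover have "\<forall>\<^sub>F n in sequentially. H (pyr_scale (1 / v) (Ps n)) > a"
    using H_scale_conv[OF Ps *(1) conv *(4)] *(5) by (rule order_tendstoD)
  ultimately show ?thesis
    by eventually_elim (use Ps * in \<open>auto simp: section_domain_def\<close>)
qed

text \<open>Dominated convergence. The cut-off v of P works for all late members of the sequence as
  well, which gives a common integrable bound; the shift by N discards the early ones.\<close>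

lemma size_fun_conv:
  assumes Ps: "\<And>n. pyramid (Ps n)" and P: "P \<in> section_domain" and conv: "weak_conv Ps P"
  shows "(\<lambda>n. size_fun (Ps n)) \<longlonglongrightarrow> size_fun P"
proof -
  obtain v where v: "pyramid P" "v > 0" "H (pyr_scale (1 / v) P) > a"
    using P by (auto simp: section_domain_def)
  have "\<forall>\<^sub>F n in sequentially. H (pyr_scale (1 / v) (Ps n)) > a"
    using H_scale_conv[OF Ps v(1) conv v(2)] v(3) by (rule order_tendstoD)
  then obtain N where N: "\<And>n. n \<ge> N \<Longrightarrow> H (pyr_scale (1 / v) (Ps n)) > a"
    by (auto simp: eventually_sequentially)
  have "(\<lambda>n. size_fun (Ps (n + N))) \<longlonglongrightarrow> size_fun P"
    unfolding size_fun_def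
  proof (rule integral_dominated_convergence)
    show "integrable lborel (\<lambda>s. \<bar>a\<bar> * indicator {0..v} s :: real)" using v(2) by auto
    show "AE s in lborel. norm (profile (Ps (n + N)) s) \<le> \<bar>a\<bar> * indicator {0..v} s" for n
      using profile_le[OF Ps v(2) N[of "n + N"]] profile_nonneg by (intro AE_I2) simp
    show "AE s in lborel. (\<lambda>n. profile (Ps (n + N)) s) \<longlonglongrightarrow> profile P s"
    proof (rule AE_I2)
      fix s :: real
      show "(\<lambda>n. profile (Ps (n + N)) s) \<longlonglongrightarrow> profile P s"
      proof (cases "s > 0")
        case True
        have "(\<lambda>n. H (pyr_scale (1 / s) (Ps (n + N)))) \<longlonglongrightarrow> H (pyr_scale (1 / s) P)"
          using H_scale_conv[OF Ps v(1) conv True] by (rule LIMSEQ_ignore_initial_segment)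
        then show ?thesis unfolding profile_def by (intro tendsto_intros)
      qed (simp add: profile_def)
    qed
  qed (use profile_measurable[OF Ps] profile_measurable[OF v(1)] in simp_all)
  then show ?thesis by (rule LIMSEQ_offset)
qed

end

text \<open>A local section of the bundle is the level set \<open>f P = 1\<close> of a local size function.\<close>

locale size_section =
  fixes V :: "mmspace set set" and f :: "mmspace set \<Rightarrow> real"
  assumes V_pyramid: "\<And>P. P \<in> V \<Longrightarrow> pyramid P"
    and V_scale: "\<And>P t. P \<in> V \<Longrightarrow> t > 0 \<Longrightarrow> pyr_scale t P \<in> V"
    and V_open: "\<And>Ps P. (\<And>n. pyramid (Ps n)) \<Longrightarrow> P \<in> V \<Longrightarrow> weak_conv Ps P \<Longrightarrow> \<forall>\<^sub>F n in sequentially. Ps n \<in> V"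
    and f_pos: "\<And>P. P \<in> V \<Longrightarrow> f P > 0"
    and f_scale: "\<And>P t. t > 0 \<Longrightarrow> f (pyr_scale t P) = t * f P"
    and f_conv: "\<And>Ps P. (\<And>n. pyramid (Ps n)) \<Longrightarrow> P \<in> V \<Longrightarrow> weak_conv Ps P \<Longrightarrow> (\<lambda>n. f (Ps n)) \<longlonglongrightarrow> f P"

text \<open>The functional is at most 0 at P0 and at least \<delta> at its multiple by 1/v, so the
  level \<delta>/2 lies strictly between the two values.\<close>

lemma local_size_function:
  assumes P0: "pyramid P0" and nonfix: "\<not> (\<forall>t>0. pyr_scale t P0 = P0)"
  obtains V f where "P0 \<in> V" "size_section V f"
proof -
  obtain X t where "X \<in> P0" "t > 0" "mm_scale t X \<notin> P0"
    by (rule nonfixed_witness[OF P0 nonfix])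
  then obtain J m c w R \<delta> v where D: "law_deficit w R" "\<delta> > 0" "v > 0"
    "law_deficit.pyramid_deficit J m c w R P0 \<le> 0"
    "law_deficit.pyramid_deficit J m c w R (pyr_scale (1 / v) P0) \<ge> \<delta>"
    by (rule pyramid_deficit_separates[OF P0])
  interpret D: law_deficit J m c w R by fact
  interpret F: pyramid_functional D.pyramid_deficit "\<delta> / 2"
    by standard (auto intro: D.pyramid_deficit_tendsto D.pyramid_deficit_antimono D.pyramid_deficit_nonneg)
  show ?thesis
  proof (rule that[of F.section_domain F.size_fun])
    show "P0 \<in> F.section_domain"
      unfolding F.section_domain_def using P0 D(2-5)
      by (intro CollectI conjI exI[of _ 1] exI[of _ v]) auto
    show "size_section F.section_domain F.size_fun"
    proof (rule size_section.intro)
      show "\<And>P. P \<in> F.section_domain \<Longrightarrow> pyramid P" by (simp add: F.section_domain_def)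
    qed (fact F.section_domain_scale F.section_domain_open F.size_fun_pos F.size_fun_scale F.size_fun_conv)+
  qed
qed

section \<open>The bundle\<close>

lemma weak_conv_const:
  assumes "pyramid P"
  shows "weak_conv (\<lambda>_. P) P"
proof (subst weak_conv_iff, goal_cases)
  case 3
  show ?case
  proof (intro conjI ballI allI impI)
    fix X and \<epsilon> :: real assume "X \<in> P" "\<epsilon> > 0"
    then have "box_near X P \<epsilon>"
      unfolding box_near_def using box_admissible_refl[OF pyramid_mm[OF assms]] by (metis less_imp_le)
    then show "\<forall>\<^sub>F n in sequentially. box_near X P \<epsilon>" by simp
  next
    fix X assume "mm_space X \<and> X \<notin> P"
    then obtain \<epsilon> where "\<epsilon> > 0" "\<not> box_near X P \<epsilon>" using pyramid_closed[OF assms] by blast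
    then show "\<exists>\<epsilon>>0. \<forall>\<^sub>F n in sequentially. \<not> box_near X P \<epsilon>" by auto
  qed
qed (use assms in auto)

lemma weak_conv_subseq:
  assumes Ps: "\<And>n. pyramid (Ps n)" and P: "pyramid P" and conv: "weak_conv Ps P" and r: "strict_mono r"
  shows "weak_conv (\<lambda>n. Ps (r n)) P"
  unfolding weak_conv_iff[of "\<lambda>n. Ps (r n)", OF Ps P]
proof (intro conjI ballI allI impI)
  fix X and \<epsilon> :: real assume "X \<in> P" "\<epsilon> > 0"
  from weak_conv_nearD[OF Ps P conv this] show "\<forall>\<^sub>F n in sequentially. box_near X (Ps (r n)) \<epsilon>"
    by (rule eventually_subseq[OF r])
next
  fix X assume "mm_space X \<and> X \<notin> P"
  then obtain \<epsilon> where \<epsilon>: "\<epsilon> > 0" "\<forall>\<^sub>F n in sequentially. \<not> box_near X (Ps n) \<epsilon>"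
    using weak_conv_farD[OF Ps P conv] by blast
  from eventually_subseq[OF r \<epsilon>(2)] \<epsilon>(1)
  show "\<exists>\<epsilon>>0. \<forall>\<^sub>F n in sequentially. \<not> box_near X (Ps (r n)) \<epsilon>" by blast
qed

lemma istopology_pyr:
  "istopology (\<lambda>U. U \<subseteq> Pyramids \<and>
     (\<forall>P\<in>U. \<forall>Ps. (\<forall>n. Ps n \<in> Pyramids) \<and> weak_conv Ps P \<longrightarrow> eventually (\<lambda>n. Ps n \<in> U) sequentially))"
  unfolding istopology_def
proof (intro conjI allI impI ballI)
  fix S T P Ps
  assume "S \<subseteq> Pyramids \<and> (\<forall>P\<in>S. \<forall>Ps. (\<forall>n. Ps n \<in> Pyramids) \<and> weak_conv Ps P \<longrightarrow> (\<forall>\<^sub>F n in sequentially. Ps n \<in> S))"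
    "T \<subseteq> Pyramids \<and> (\<forall>P\<in>T. \<forall>Ps. (\<forall>n. Ps n \<in> Pyramids) \<and> weak_conv Ps P \<longrightarrow> (\<forall>\<^sub>F n in sequentially. Ps n \<in> T))"
    "P \<in> S \<inter> T" "(\<forall>n. Ps n \<in> Pyramids) \<and> weak_conv Ps P"
  then have "\<forall>\<^sub>F n in sequentially. Ps n \<in> S" "\<forall>\<^sub>F n in sequentially. Ps n \<in> T" by blast+
  then show "\<forall>\<^sub>F n in sequentially. Ps n \<in> S \<inter> T" by eventually_elim blast
next
  fix \<K> P Ps
  assume *: "\<forall>K\<in>\<K>. K \<subseteq> Pyramids \<and> (\<forall>P\<in>K. \<forall>Ps. (\<forall>n. Ps n \<in> Pyramids) \<and> weak_conv Ps P \<longrightarrow> (\<forall>\<^sub>F n in sequentially. Ps n \<in> K))"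
    "P \<in> \<Union>\<K>" "(\<forall>n. Ps n \<in> Pyramids) \<and> weak_conv Ps P"
  then obtain K where "K \<in> \<K>" "P \<in> K" by blast
  then have "\<forall>\<^sub>F n in sequentially. Ps n \<in> K" using * by blast
  then show "\<forall>\<^sub>F n in sequentially. Ps n \<in> \<Union>\<K>" by eventually_elim (use \<open>K \<in> \<K>\<close> in blast)
qed auto

lemma openin_pyr_topology:
  "openin pyr_topology U \<longleftrightarrow> U \<subseteq> Pyramids \<and>
     (\<forall>P\<in>U. \<forall>Ps. (\<forall>n. pyramid (Ps n)) \<and> weak_conv Ps P \<longrightarrow> (\<forall>\<^sub>F n in sequentially. Ps n \<in> U))"
  unfolding pyr_topology_def topology_inverse'[OF istopology_pyr] by (simp add: Pyramids_def)

lemma Pyr_star_iff: "P \<in> Pyr_star \<longleftrightarrow> pyramid P \<and> \<not> (\<forall>t>0. pyr_scale t P = P)"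
  by (auto simp: Pyr_star_def Fix_Pyr_def Pyramids_def)

context size_section
begin

text \<open>A positive size differs from its double, so every pyramid in V is moved by the factor
  2.\<close>

lemma V_sub: "V \<subseteq> Pyr_star"
proof
  fix P assume P: "P \<in> V"
  have "f (pyr_scale 2 P) \<noteq> f P" using f_pos[OF P] f_scale[of 2 P] by simp
  then have "pyr_scale 2 P \<noteq> P" by metis
  then show "P \<in> Pyr_star" unfolding Pyr_star_iff using V_pyramid[OF P] by (metis zero_less_numeral)
qed

end

lemma size_section_exists:
  assumes "P \<in> Pyr_star"
  obtains V f where "P \<in> V" "size_section V f"
proof -
  have P: "pyramid P" "\<not> (\<forall>t>0. pyr_scale t P = P)" using assms by (auto simp: Pyr_star_iff)
  show ?thesis
    by (rule local_size_function[OF P]) (rule that)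
qed

text \<open>The domains of the local size functions cover \<open>Pyr_star\<close>, consist of
  nonfixed pyramids and absorb convergent sequences.\<close>

lemma openin_Pyr_star: "openin pyr_topology Pyr_star"
  unfolding openin_pyr_topology
proof (intro conjI ballI allI impI)
  show "Pyr_star \<subseteq> Pyramids" by (auto simp: Pyr_star_def)
  fix P Ps assume P: "P \<in> Pyr_star" and Ps: "(\<forall>n. pyramid (Ps n)) \<and> weak_conv Ps P"
  obtain V f where "P \<in> V" "size_section V f" by (rule size_section_exists[OF P])
  interpret size_section V f by fact
  have "\<forall>\<^sub>F n in sequentially. Ps n \<in> V" using Ps \<open>P \<in> V\<close> by (intro V_open) auto
  then show "\<forall>\<^sub>F n in sequentially. Ps n \<in> Pyr_star" by eventually_elim (use V_sub in blast)
qed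

text \<open>A subspace of a sequential space need not be sequential, but an open one is; this is
  where the openness of \<open>Pyr_star\<close> enters.\<close>

lemma openin_Pyr_star_top:
  "openin Pyr_star_top U \<longleftrightarrow> U \<subseteq> Pyr_star \<and>
     (\<forall>P\<in>U. \<forall>Ps. (\<forall>n. pyramid (Ps n)) \<and> weak_conv Ps P \<longrightarrow> (\<forall>\<^sub>F n in sequentially. Ps n \<in> U))"
  unfolding Pyr_star_top_def openin_open_subtopology[OF openin_Pyr_star]
  by (auto simp: openin_pyr_topology Pyr_star_def)

lemma openin_Pyr_star_topD:
  assumes "openin Pyr_star_top U" "P \<in> U" "\<And>n. pyramid (Ps n)" "weak_conv Ps P"
  shows "\<forall>\<^sub>F n in sequentially. Ps n \<in> U"
  using openin_Pyr_star_top[THEN iffD1, OF assms(1), THEN conjunct2, rule_format, OF assms(2), of Ps] assms(3,4)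
  by blast

lemma topspace_Pyr_star_top [simp]: "topspace Pyr_star_top = Pyr_star"
proof -
  have "topspace Pyr_star_top = topspace pyr_topology \<inter> Pyr_star"
    by (simp add: Pyr_star_top_def)
  then show ?thesis using openin_subset[OF openin_Pyr_star] by blast
qed

lemma orbit_scale [simp]: "t > 0 \<Longrightarrow> orbit (pyr_scale t P) = orbit P"
proof -
  assume t: "t > 0"
  have "\<exists>s'. pyr_scale s P = pyr_scale s' (pyr_scale t P) \<and> s' > 0" if "s > 0" for s
    using t that by (intro exI[of _ "s / t"]) simp
  moreover have "\<exists>s'. pyr_scale s (pyr_scale t P) = pyr_scale s' P \<and> s' > 0" if "s > 0" for s
    using t that by (intro exI[of _ "s * t"]) simp
  ultimately show ?thesis unfolding orbit_def by blast
qed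

lemma orbit_self: "P \<in> orbit P"
  unfolding orbit_def by (intro CollectI exI[of _ 1]) simp

lemma orbit_eqD: "orbit P = orbit Q \<Longrightarrow> \<exists>t>0. Q = pyr_scale t P"
proof -
  assume "orbit P = orbit Q"
  then have "Q \<in> orbit P" using orbit_self by metis
  then show ?thesis by (auto simp: orbit_def)
qed

lemma istopology_quot:
  "istopology (\<lambda>U. U \<subseteq> Orbits \<and> openin Pyr_star_top {P \<in> Pyr_star. orbit P \<in> U})"
  unfolding istopology_def
proof (intro conjI allI impI)
  fix S T
  assume *: "S \<subseteq> Orbits \<and> openin Pyr_star_top {P \<in> Pyr_star. orbit P \<in> S}"
    "T \<subseteq> Orbits \<and> openin Pyr_star_top {P \<in> Pyr_star. orbit P \<in> T}"
  have "{P \<in> Pyr_star. orbit P \<in> S \<inter> T} = {P \<in> Pyr_star. orbit P \<in> S} \<inter> {P \<in> Pyr_star. orbit P \<in> T}" by auto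
  then show "openin Pyr_star_top {P \<in> Pyr_star. orbit P \<in> S \<inter> T}" using * by auto
next
  fix \<K> assume *: "\<forall>K\<in>\<K>. K \<subseteq> Orbits \<and> openin Pyr_star_top {P \<in> Pyr_star. orbit P \<in> K}"
  have "{P \<in> Pyr_star. orbit P \<in> \<Union>\<K>} = (\<Union>K\<in>\<K>. {P \<in> Pyr_star. orbit P \<in> K})" by auto
  then show "openin Pyr_star_top {P \<in> Pyr_star. orbit P \<in> \<Union>\<K>}" using * by auto
qed auto

lemma openin_quot_top:
  "openin quot_top U \<longleftrightarrow> U \<subseteq> Orbits \<and> openin Pyr_star_top {P \<in> Pyr_star. orbit P \<in> U}"
  unfolding quot_top_def topology_inverse'[OF istopology_quot] ..

lemma topspace_quot_top [simp]: "topspace quot_top = Orbits"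
proof
  show "topspace quot_top \<subseteq> Orbits"
    using openin_topspace[of quot_top] unfolding openin_quot_top by blast
  have "{P \<in> Pyr_star. orbit P \<in> Orbits} = topspace Pyr_star_top" by (auto simp: Orbits_def)
  then have "openin quot_top Orbits" unfolding openin_quot_top by (metis openin_topspace order_refl)
  then show "Orbits \<subseteq> topspace quot_top" by (rule openin_subset)
qed

lemma topspace_pos_reals_top [simp]: "topspace pos_reals_top = {0<..}"
  by (simp add: pos_reals_top_def)

section \<open>Trivialization over the domain of a size function\<close>

context size_section
begin

lemma openin_V: "openin Pyr_star_top V"
  unfolding openin_Pyr_star_top using V_sub V_open by blast

text \<open>V is invariant under scaling, hence a union of orbits; this makes its image in the
  quotient open.\<close>

lemma preimage_orbits: "{P \<in> Pyr_star. orbit P \<in> orbit ` V} = V"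
proof (intro equalityI subsetI)
  fix P assume "P \<in> {P \<in> Pyr_star. orbit P \<in> orbit ` V}"
  then obtain Q where "Q \<in> V" "orbit Q = orbit P" by auto
  then show "P \<in> V" using orbit_eqD V_scale by blast
qed (use V_sub in auto)

lemma openin_orbits: "openin quot_top (orbit ` V)"
  unfolding openin_quot_top preimage_orbits using openin_V V_sub by (auto simp: Orbits_def)

lemma continuous_f: "continuous_map (subtopology Pyr_star_top V) euclideanreal f"
  unfolding continuous_map_def
proof (intro conjI allI impI)
  fix T :: "real set" assume "openin euclideanreal T"
  then have T: "open T" by simp
  have "openin Pyr_star_top {P \<in> V. f P \<in> T}"
    unfolding openin_Pyr_star_top
  proof (intro conjI ballI allI impI)
    fix P Ps assume P: "P \<in> {P \<in> V. f P \<in> T}" and Ps: "(\<forall>n. pyramid (Ps n)) \<and> weak_conv Ps P"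
    have "\<forall>\<^sub>F n in sequentially. Ps n \<in> V" using Ps P by (intro V_open) auto
    moreover have "\<forall>\<^sub>F n in sequentially. f (Ps n) \<in> T"
      using Ps P T by (intro topological_tendstoD[OF f_conv]) auto
    ultimately show "\<forall>\<^sub>F n in sequentially. Ps n \<in> {P \<in> V. f P \<in> T}" by eventually_elim simp
  qed (use V_sub in auto)
  then show "openin (subtopology Pyr_star_top V) {P \<in> topspace (subtopology Pyr_star_top V). f P \<in> T}"
    using V_sub by (simp add: openin_open_subtopology[OF openin_V] Int_absorb1 Collect_conj_eq)
qed auto

definition normalize :: "mmspace set \<Rightarrow> mmspace set" where
  "normalize P = pyr_scale (1 / f P) P"

lemma normalize_orbit:
  assumes "P \<in> V" "Q \<in> V" "orbit P = orbit Q"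
  shows "normalize P = normalize Q"
proof -
  obtain t where t: "t > 0" "Q = pyr_scale t P" using orbit_eqD[OF assms(3)] by blast
  then show ?thesis using f_pos[OF assms(1)] by (simp add: normalize_def f_scale)
qed

lemma scale_normalize_V: "P \<in> V \<Longrightarrow> t > 0 \<Longrightarrow> pyr_scale t (normalize P) \<in> V"
  unfolding normalize_def using f_pos by (simp add: V_scale)

lemma scale_normalize_conv:
  assumes Ps: "\<And>n. Ps n \<in> V" and P: "P \<in> V" and conv: "weak_conv Ps P" and ts: "ts \<longlonglongrightarrow> t" "\<And>n. ts n > 0" "t > 0"
  shows "weak_conv (\<lambda>n. pyr_scale (ts n) (normalize (Ps n))) (pyr_scale t (normalize P))"
proof -
  have "(\<lambda>n. ts n * (1 / f (Ps n))) \<longlonglongrightarrow> t * (1 / f P)"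
    using f_conv[OF V_pyramid[OF Ps] P conv] f_pos[OF P] ts(1) by (intro tendsto_intros) auto
  from weak_conv_scale[OF V_pyramid[OF Ps] V_pyramid[OF P] conv this] show ?thesis
    unfolding normalize_def using f_pos[OF Ps] f_pos[OF P] ts(2,3) by simp
qed

text \<open>The action is jointly continuous although the topology of \<^term>\<open>pyr_topology\<close> is only known
  to be sequential: parameters may be kept in a compact interval.\<close>

lemma openin_normalized_tube:
  assumes W: "openin Pyr_star_top W" and "0 < b"
  shows "openin Pyr_star_top {P \<in> V. \<forall>t\<in>{b..c}. pyr_scale t (normalize P) \<in> W}"
  unfolding openin_Pyr_star_top
proof (intro conjI ballI allI impI)
  fix P Ps
  assume P: "P \<in> {P \<in> V. \<forall>t\<in>{b..c}. pyr_scale t (normalize P) \<in> W}" and Ps: "(\<forall>n. pyramid (Ps n)) \<and> weak_conv Ps P"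
  show "\<forall>\<^sub>F n in sequentially. Ps n \<in> {P \<in> V. \<forall>t\<in>{b..c}. pyr_scale t (normalize P) \<in> W}"
  proof (rule ccontr)
    assume notev: "\<not> ?thesis"
    have evV: "\<forall>\<^sub>F n in sequentially. Ps n \<in> V" using Ps P by (intro V_open) auto
    have "\<not> (\<forall>\<^sub>F n in sequentially. Ps n \<in> V \<longrightarrow> (\<forall>t\<in>{b..c}. pyr_scale t (normalize (Ps n)) \<in> W))"
    proof
      assume "\<forall>\<^sub>F n in sequentially. Ps n \<in> V \<longrightarrow> (\<forall>t\<in>{b..c}. pyr_scale t (normalize (Ps n)) \<in> W)"
      with evV have "\<forall>\<^sub>F n in sequentially. Ps n \<in> {P \<in> V. \<forall>t\<in>{b..c}. pyr_scale t (normalize P) \<in> W}"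
        by eventually_elim blast
      then show False using notev by blast
    qed
    from not_eventually_sequentiallyD[OF this] obtain r :: "nat \<Rightarrow> nat" where r: "strict_mono r \<and>
        (\<forall>n. \<not> (Ps (r n) \<in> V \<longrightarrow> (\<forall>t\<in>{b..c}. pyr_scale t (normalize (Ps (r n))) \<in> W)))"
      by blast
    then have "\<forall>n. \<exists>t. t \<in> {b..c} \<and> pyr_scale t (normalize (Ps (r n))) \<notin> W" by blast
    then obtain ts where ts: "\<forall>n. ts n \<in> {b..c} \<and> pyr_scale (ts n) (normalize (Ps (r n))) \<notin> W"
      by (rule choice[THEN exE])
    \<comment> \<open>Violating scales lie in a compact interval; along a convergent subsequence the
      scaled pyramids converge to a member of the open set W, although all of them avoid W.\<close>
    have "seq_compact {b..c}" using compact_imp_seq_compact compact_Icc by blast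
    then obtain t q where tq: "t \<in> {b..c}" "strict_mono (q :: nat \<Rightarrow> nat)" "(ts \<circ> q) \<longlonglongrightarrow> t"
      using ts seq_compactE[of "{b..c}" ts] by metis
    have sub: "strict_mono (\<lambda>n. r (q n))" using r tq(2) by (simp add: strict_mono_def)
    have "weak_conv (\<lambda>n. Ps (r (q n))) P"
      using Ps P V_pyramid by (intro weak_conv_subseq[OF _ _ _ sub]) auto
    then have "weak_conv (\<lambda>n. pyr_scale (ts (q n)) (normalize (Ps (r (q n))))) (pyr_scale t (normalize P))"
      using r ts tq P \<open>0 < b\<close> by (intro scale_normalize_conv) (auto simp: comp_def intro: less_le_trans)
    moreover have "pyr_scale t (normalize P) \<in> W" using P tq(1) by blast
    moreover have "pyramid (pyr_scale (ts (q n)) (normalize (Ps (r (q n)))))" for n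
      using r ts \<open>0 < b\<close> by (intro V_pyramid scale_normalize_V) (auto intro: less_le_trans)
    ultimately have "\<forall>\<^sub>F n in sequentially. pyr_scale (ts (q n)) (normalize (Ps (r (q n)))) \<in> W"
      by - (rule openin_Pyr_star_topD[OF W])
    then show False using ts by simp
  qed
qed (use V_sub in auto)

text \<open>Sequential continuity of the scaling at t: violating scales within
  \<open>t / 2 / real (Suc n)\<close> of t would converge to t. Radii of at most t/2 keep the scales
  positive.\<close>

lemma scale_interval_in_open:
  assumes W: "openin Pyr_star_top W" and P: "pyramid P" and t: "t > 0" "pyr_scale t P \<in> W"
  obtains b c where "0 < b" "b < t" "t < c" "\<forall>s\<in>{b..c}. pyr_scale s P \<in> W"
proof -
  have "\<forall>\<^sub>F n in sequentially. \<forall>s. \<bar>s - t\<bar> \<le> t / 2 / real (Suc n) \<longrightarrow> pyr_scale s P \<in> W"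
  proof (rule ccontr)
    assume "\<not> ?thesis"
    from not_eventually_sequentiallyD[OF this] obtain r :: "nat \<Rightarrow> nat" where r: "strict_mono r \<and>
        (\<forall>n. \<not> (\<forall>s. \<bar>s - t\<bar> \<le> t / 2 / real (Suc (r n)) \<longrightarrow> pyr_scale s P \<in> W))"
      by blast
    then have "\<forall>n. \<exists>s. \<bar>s - t\<bar> \<le> t / 2 / real (Suc (r n)) \<and> pyr_scale s P \<notin> W" by blast
    then obtain ts where ts: "\<forall>n. \<bar>ts n - t\<bar> \<le> t / 2 / real (Suc (r n)) \<and> pyr_scale (ts n) P \<notin> W"
      by (rule choice[THEN exE])
    have "(\<lambda>n. inverse (real (Suc (r n)))) \<longlonglongrightarrow> 0"
      using LIMSEQ_subseq_LIMSEQ[OF LIMSEQ_inverse_real_of_nat conjunct1[OF r]] by (simp add: comp_def)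
    then have lim0: "(\<lambda>n. t / 2 * inverse (real (Suc (r n)))) \<longlonglongrightarrow> 0"
      by (rule tendsto_mult_right_zero)
    have "\<forall>n. norm (ts n - t) \<le> t / 2 * inverse (real (Suc (r n)))"
      using ts unfolding divide_inverse real_norm_def by blast
    then have "(\<lambda>n. ts n - t) \<longlonglongrightarrow> 0"
      by (intro Lim_null_comparison[OF always_eventually lim0])
    then have lim: "ts \<longlonglongrightarrow> t" by (simp add: LIM_zero_iff)
    have pos: "ts n > 0" for n
    proof -
      have "t / 2 / real (Suc (r n)) \<le> t / 2 / 1" using t(1) by (intro divide_left_mono) auto
      then show ?thesis using ts[rule_format, of n] t(1) by linarith
    qed
    have "weak_conv (\<lambda>n. pyr_scale (ts n) P) (pyr_scale t P)"
      by (rule weak_conv_scale[OF P P weak_conv_const[OF P] lim pos t(1)])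
    then have "\<forall>\<^sub>F n in sequentially. pyr_scale (ts n) P \<in> W"
      using P pos by (intro openin_Pyr_star_topD[OF W t(2)] pyramid_scale)
    then show False using ts by simp
  qed
  then obtain n where n: "\<forall>s. \<bar>s - t\<bar> \<le> t / 2 / real (Suc n) \<longrightarrow> pyr_scale s P \<in> W"
    using eventually_happens by fastforce
  define \<rho> where "\<rho> = t / 2 / real (Suc n)"
  have \<rho>: "0 < \<rho>" "\<rho> \<le> t / 2"
  proof -
    have "t / 2 / real (Suc n) \<le> t / 2 / 1" using t(1) by (intro divide_left_mono) auto
    then show "\<rho> \<le> t / 2" by (simp add: \<rho>_def)
  qed (use t(1) in \<open>simp add: \<rho>_def\<close>)
  have "\<forall>s\<in>{t - \<rho>..t + \<rho>}. pyr_scale s P \<in> W"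
    using n unfolding \<rho>_def[symmetric] by (auto simp: abs_le_iff)
  then show ?thesis
    using that[of "t - \<rho>" "t + \<rho>"] \<rho> t(1) by simp
qed

text \<open>The inverse sends an orbit and a number t to the member of size t of the orbit; it is
  written with an arbitrary representative, and normalizing removes the choice.\<close>

lemma local_trivialization_V: "local_trivialization (orbit ` V) (\<lambda>P. (orbit P, f P))"
proof -
  define rep where "rep o' = (SOME P. P \<in> V \<and> orbit P = o')" for o'
  have rep: "rep (orbit P) \<in> V" "orbit (rep (orbit P)) = orbit P" if "P \<in> V" for P
    using someI[of "\<lambda>Q. Q \<in> V \<and> orbit Q = orbit P" P] that unfolding rep_def by auto
  define k where "k z = pyr_scale (snd z) (normalize (rep (fst z)))" for z :: "mmspace set set \<times> real"
  have k_orbit: "k (orbit P, t) = pyr_scale t (normalize P)" if "P \<in> V" for P t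
    using normalize_orbit[OF rep(1)[OF that] that rep(2)[OF that]] by (simp add: k_def)
  let ?X = "subtopology Pyr_star_top V" and ?Y = "prod_topology (subtopology quot_top (orbit ` V)) pos_reals_top"
  have topX: "topspace ?X = V" using V_sub by auto
  have orb_sub: "orbit ` V \<subseteq> Orbits" using V_sub by (auto simp: Orbits_def)
  have topY: "topspace ?Y = orbit ` V \<times> {0<..}" using orb_sub by auto
  have cont_h: "continuous_map ?X ?Y (\<lambda>P. (orbit P, f P))"
  proof (rule continuous_map_pairedI)
    show "continuous_map ?X pos_reals_top f"
      unfolding pos_reals_top_def continuous_map_in_subtopology
      using continuous_f f_pos topX by auto
    show "continuous_map ?X (subtopology quot_top (orbit ` V)) orbit"
      unfolding continuous_map_in_subtopology
    proof
      show "continuous_map ?X quot_top orbit"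
        unfolding continuous_map_def
      proof (intro conjI allI impI)
        fix U assume "openin quot_top U"
        then have "openin Pyr_star_top {P \<in> Pyr_star. orbit P \<in> U}" by (simp add: openin_quot_top)
        then have "openin ?X (V \<inter> {P \<in> Pyr_star. orbit P \<in> U})"
          using openin_subtopology_Int2 by blast
        moreover have "V \<inter> {P \<in> Pyr_star. orbit P \<in> U} = {P \<in> topspace ?X. orbit P \<in> U}"
          using topX V_sub by auto
        ultimately show "openin ?X {P \<in> topspace ?X. orbit P \<in> U}" by simp
      qed (use topX orb_sub in auto)
    qed (use topX in auto)
  qed
  have cont_k: "continuous_map ?Y ?X k"
    unfolding continuous_map_in_subtopology
  proof
    show kV: "k \<in> topspace ?Y \<rightarrow> V"
      unfolding topY by (auto simp: k_orbit scale_normalize_V)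
    show "continuous_map ?Y Pyr_star_top k"
      unfolding continuous_map_def
    proof (intro conjI allI impI)
      show "k \<in> topspace ?Y \<rightarrow> topspace Pyr_star_top" using kV V_sub by auto
      fix W assume W: "openin Pyr_star_top W"
      show "openin ?Y {z \<in> topspace ?Y. k z \<in> W}"
        unfolding openin_prod_topology_alt
      proof (intro allI impI)
        fix o' t assume "(o', t) \<in> {z \<in> topspace ?Y. k z \<in> W}"
        then obtain P where P: "P \<in> V" "o' = orbit P" "t > 0" "pyr_scale t (normalize P) \<in> W"
          unfolding topY by (auto simp: k_orbit)
        have "pyramid (normalize P)"
          using V_pyramid[OF P(1)] f_pos[OF P(1)] unfolding normalize_def by (intro pyramid_scale) auto
        then obtain b c where bc: "0 < b" "b < t" "t < c" "\<forall>s\<in>{b..c}. pyr_scale s (normalize P) \<in> W"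
          using scale_interval_in_open[OF W _ P(3,4)] by blast
        \<comment> \<open>Demanding W on a closed interval of scales turns a neighbourhood of one
          point into an open box around it. The condition refers to normalized pyramids only, so T
          is a union of orbits and its set of orbits is open.\<close>
        define T where "T = {P \<in> V. \<forall>t\<in>{b..c}. pyr_scale t (normalize P) \<in> W}"
        have T: "openin Pyr_star_top T" unfolding T_def using W bc(1) by (rule openin_normalized_tube)
        have sat: "{P \<in> Pyr_star. orbit P \<in> orbit ` T} = T"
        proof (intro equalityI subsetI)
          fix Q assume Q: "Q \<in> {P \<in> Pyr_star. orbit P \<in> orbit ` T}"
          then obtain Q' where Q': "Q' \<in> T" "orbit Q = orbit Q'" by auto
          then have "Q' \<in> V" by (simp add: T_def)
          then have "Q \<in> V" using preimage_orbits Q Q' by auto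
          then show "Q \<in> T"
            using Q' normalize_orbit[OF \<open>Q \<in> V\<close> \<open>Q' \<in> V\<close>] by (simp add: T_def)
        qed (use openin_subset[OF T] in auto)
        have openT: "openin quot_top (orbit ` T)"
          unfolding openin_quot_top sat using T orb_sub by (auto simp: T_def)
        show "\<exists>A B. openin (subtopology quot_top (orbit ` V)) A \<and> openin pos_reals_top B \<and> o' \<in> A \<and> t \<in> B \<and>
            A \<times> B \<subseteq> {z \<in> topspace ?Y. k z \<in> W}"
        proof (intro exI[of _ "orbit ` T"] exI[of _ "{b<..<c}"] conjI)
          show "openin (subtopology quot_top (orbit ` V)) (orbit ` T)"
            unfolding openin_open_subtopology[OF openin_orbits] using openT by (auto simp: T_def)
          show "openin pos_reals_top {b<..<c}"
            unfolding pos_reals_top_def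
            using bc(1) by (subst openin_open_subtopology) auto
          show "o' \<in> orbit ` T" using P bc by (auto simp: T_def)
          show "orbit ` T \<times> {b<..<c} \<subseteq> {z \<in> topspace ?Y. k z \<in> W}"
            unfolding topY using bc(1) by (auto simp: T_def k_orbit)
        qed (use bc in auto)
      qed
    qed
  qed
  have "homeomorphic_maps ?X ?Y (\<lambda>P. (orbit P, f P)) k"
    unfolding homeomorphic_maps_def
  proof (intro conjI ballI cont_h cont_k)
    fix P assume "P \<in> topspace ?X"
    then have "P \<in> V" by (simp add: topX)
    then show "k (orbit P, f P) = P" using f_pos[of P] by (simp add: k_orbit normalize_def)
  next
    fix z assume "z \<in> topspace ?Y"
    then obtain P t where z: "z = (orbit P, t)" "P \<in> V" "t > 0" unfolding topY by auto
    then show "(orbit (k z), f (k z)) = z"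
      using f_pos[OF z(2)] by (simp add: k_orbit normalize_def f_scale)
  qed
  then have "homeomorphic_map ?X ?Y (\<lambda>P. (orbit P, f P))"
    using homeomorphic_map_maps by blast
  then show ?thesis
    unfolding local_trivialization_def preimage_orbits by (simp add: f_scale)
qed

lemma translation_eq:
  assumes "P \<in> V" "Q \<in> V" "orbit P = orbit Q"
  shows "translation P Q = f Q / f P"
proof -
  obtain t where t: "t > 0" "Q = pyr_scale t P" using orbit_eqD[OF assms(3)] by blast
  have uniq: "s = f Q / f P" if "s > 0 \<and> Q = pyr_scale s P" for s
    using that f_pos[OF assms(1)] by (auto simp: f_scale)
  have "f Q / f P > 0 \<and> Q = pyr_scale (f Q / f P) P"
    using t uniq[of t] by simp
  then show ?thesis
    unfolding translation_def using uniq by (rule the_equality)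
qed

end

section \<open>Local triviality and the translation function\<close>

lemma locally_trivial_Pyr: locally_trivial
  unfolding locally_trivial_def
proof (intro exI[of _ "{orbit ` V | V. \<exists>f. size_section V f}"] conjI ballI)
  show "\<Union> {orbit ` V |V. \<exists>f. size_section V f} = Orbits"
  proof (intro equalityI subsetI)
    fix z assume "z \<in> \<Union> {orbit ` V |V. \<exists>f. size_section V f}"
    then obtain V f where "size_section V f" "z \<in> orbit ` V" by blast
    then show "z \<in> Orbits" using size_section.V_sub unfolding Orbits_def by blast
  next
    fix z assume "z \<in> Orbits"
    then obtain P where P: "P \<in> Pyr_star" "z = orbit P" by (auto simp: Orbits_def)
    obtain V f where "P \<in> V" "size_section V f" by (rule size_section_exists[OF P(1)])
    then show "z \<in> \<Union> {orbit ` V |V. \<exists>f. size_section V f}" using P(2) by blast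
  qed
next
  fix U assume "U \<in> {orbit ` V |V. \<exists>f. size_section V f}"
  then obtain V f where V: "size_section V f" "U = orbit ` V" by blast
  show "openin quot_top U" unfolding V(2) by (rule size_section.openin_orbits[OF V(1)])
  show "\<exists>h. local_trivialization U h"
    unfolding V(2) by (rule exI) (rule size_section.local_trivialization_V[OF V(1)])
qed

lemma free_action_Pyr: free_action
  unfolding free_action_def
proof (intro ballI allI impI)
  fix P and t :: real assume "P \<in> Pyr_star" "t > 0" "pyr_scale t P = P"
  then show "t = 1" using nonfixed_free[of P t] unfolding Pyr_star_iff by blast
qed

text \<open>On pairs of V \<times> V in one orbit the translation is f(Q)/f(P). Continuity is
  inherited from f through the two projections, as sequences need not decide openness in a
  product.\<close>

lemma principal_bundle_Pyr: principal_bundle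
  unfolding principal_bundle_def
proof (intro conjI free_action_Pyr)
  let ?PP = "prod_topology Pyr_star_top Pyr_star_top"
  let ?R = "{(P, Q). P \<in> Pyr_star \<and> Q \<in> Pyr_star \<and> orbit P = orbit Q}"
  have topR: "topspace (subtopology ?PP ?R) = ?R" by auto
  have pos: "translation P Q > 0" if "(P, Q) \<in> ?R" for P Q
  proof -
    have P: "P \<in> Pyr_star" and eq: "orbit P = orbit Q" using that by auto
    obtain V f where V: "P \<in> V" "size_section V f" by (rule size_section_exists[OF P])
    interpret size_section V f by fact
    have "Q \<in> V" using orbit_eqD[OF eq] V(1) V_scale by blast
    then show ?thesis using translation_eq[OF V(1) _ eq] f_pos V(1) by simp
  qed
  show "continuous_map (subtopology ?PP ?R) pos_reals_top (\<lambda>(P, Q). translation P Q)"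
    unfolding pos_reals_top_def continuous_map_in_subtopology
  proof
    show "(\<lambda>(P, Q). translation P Q) \<in> topspace (subtopology ?PP ?R) \<rightarrow> {0<..}"
      unfolding topR using pos by auto
    show "continuous_map (subtopology ?PP ?R) euclideanreal (\<lambda>(P, Q). translation P Q)"
      unfolding continuous_map_def
    proof (intro conjI allI impI)
      fix T :: "real set" assume T: "openin euclideanreal T"
      show "openin (subtopology ?PP ?R) {z \<in> topspace (subtopology ?PP ?R). (case z of (P, Q) \<Rightarrow> translation P Q) \<in> T}"
      proof (subst openin_subopen, intro ballI)
        fix z assume z: "z \<in> {z \<in> topspace (subtopology ?PP ?R). (case z of (P, Q) \<Rightarrow> translation P Q) \<in> T}"
        then obtain P0 Q0 where z0: "z = (P0, Q0)" "P0 \<in> Pyr_star" "orbit P0 = orbit Q0" "translation P0 Q0 \<in> T"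
          unfolding topR by auto
        obtain V f where V: "P0 \<in> V" "size_section V f" by (rule size_section_exists[OF z0(2)])
        interpret size_section V f by fact
        have Q0: "Q0 \<in> V" using orbit_eqD[OF z0(3)] V(1) V_scale by blast
        have topVV: "topspace (subtopology ?PP (V \<times> V)) = V \<times> V" using V_sub by auto
        have openVV: "openin ?PP (V \<times> V)" using openin_V by (simp add: openin_prod_Times_iff)
        have "continuous_map (subtopology ?PP (V \<times> V)) euclideanreal (\<lambda>z. f (snd z) / f (fst z))"
        proof (rule continuous_map_real_divide)
          show "continuous_map (subtopology ?PP (V \<times> V)) euclideanreal (\<lambda>z. f (snd z))"
          proof -
            have "continuous_map (subtopology ?PP (V \<times> V)) (subtopology Pyr_star_top V) snd"
              unfolding continuous_map_in_subtopology topVV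
              by (intro conjI continuous_map_from_subtopology continuous_map_snd) auto
            from continuous_map_compose[OF this continuous_f] show ?thesis by (simp add: comp_def)
          qed
          show "continuous_map (subtopology ?PP (V \<times> V)) euclideanreal (\<lambda>z. f (fst z))"
          proof -
            have "continuous_map (subtopology ?PP (V \<times> V)) (subtopology Pyr_star_top V) fst"
              unfolding continuous_map_in_subtopology topVV
              by (intro conjI continuous_map_from_subtopology continuous_map_fst) auto
            from continuous_map_compose[OF this continuous_f] show ?thesis by (simp add: comp_def)
          qed
          fix x assume "x \<in> topspace (subtopology ?PP (V \<times> V))"
          then show "f (fst x) \<noteq> 0" unfolding topVV using f_pos by fastforce
        qed
        then have "openin (subtopology ?PP (V \<times> V)) {z \<in> topspace (subtopology ?PP (V \<times> V)). f (snd z) / f (fst z) \<in> T}"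
          using T by (rule openin_continuous_map_preimage)
        then have N: "openin ?PP {z \<in> V \<times> V. f (snd z) / f (fst z) \<in> T}"
          unfolding topVV openin_open_subtopology[OF openVV] by simp
        show "\<exists>A. openin (subtopology ?PP ?R) A \<and> z \<in> A \<and>
            A \<subseteq> {z \<in> topspace (subtopology ?PP ?R). (case z of (P, Q) \<Rightarrow> translation P Q) \<in> T}"
        proof (intro exI conjI)
          show "openin (subtopology ?PP ?R) (?R \<inter> {z \<in> V \<times> V. f (snd z) / f (fst z) \<in> T})"
            using N by (rule openin_subtopology_Int2)
          show "z \<in> ?R \<inter> {z \<in> V \<times> V. f (snd z) / f (fst z) \<in> T}"
            using z V(1) Q0 z0 translation_eq[OF V(1) Q0 z0(3)] unfolding topR by auto
          show "?R \<inter> {z \<in> V \<times> V. f (snd z) / f (fst z) \<in> T} \<subseteq>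
              {z \<in> topspace (subtopology ?PP ?R). (case z of (P, Q) \<Rightarrow> translation P Q) \<in> T}"
            unfolding topR by (auto simp: translation_eq)
        qed
      qed
    qed auto
  qed
qed

text \<open>A globally defined size function would have to vanish at \<open>Q\<close>.\<close>

lemma nontrivial_criterion:
  assumes P: "P \<in> Pyr_star" and Q: "Q \<in> Pyr_star" and Ps: "\<And>n. pyramid (Ps n)" and ts: "\<And>n. ts n > 0" "ts \<longlonglongrightarrow> 0"
    and PsP: "weak_conv Ps P" and PsQ: "weak_conv (\<lambda>n. pyr_scale (ts n) (Ps n)) Q"
  shows "\<not> trivial_bundle"
proof
  assume trivial_bundle
  then obtain h where h: "local_trivialization Orbits h" by (auto simp: trivial_bundle_def)
  define f where "f P = snd (h P)" for P
  have all: "{P \<in> Pyr_star. orbit P \<in> Orbits} = Pyr_star" by (auto simp: Orbits_def)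
  have "homeomorphic_map (subtopology Pyr_star_top Pyr_star) (prod_topology (subtopology quot_top Orbits) pos_reals_top) h"
    using h unfolding local_trivialization_def all by blast
  then have "continuous_map (subtopology Pyr_star_top Pyr_star) (prod_topology (subtopology quot_top Orbits) pos_reals_top) h"
    by (rule homeomorphic_imp_continuous_map)
  then have "continuous_map (subtopology Pyr_star_top Pyr_star) pos_reals_top (snd \<circ> h)"
    by (rule continuous_map_compose) (rule continuous_map_snd)
  moreover have "subtopology Pyr_star_top Pyr_star = Pyr_star_top"
    by (metis subtopology_topspace topspace_Pyr_star_top)
  ultimately have cont: "continuous_map Pyr_star_top pos_reals_top f"
    by (simp add: comp_def f_def[abs_def])
  have f_pos: "f R > 0" if "R \<in> Pyr_star" for R
    using continuous_map_funspace[OF cont] that by auto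
  have f_scale: "f (pyr_scale t R) = t * f R" if "R \<in> Pyr_star" "t > 0" for R t
    using h that unfolding local_trivialization_def f_def by (auto simp: Orbits_def)
  have conv: "(\<lambda>n. f (Rs n)) \<longlonglongrightarrow> f R" "\<forall>\<^sub>F n in sequentially. Rs n \<in> Pyr_star"
    if R: "R \<in> Pyr_star" and Rs: "\<And>n. pyramid (Rs n)" "weak_conv Rs R" for R Rs
  proof -
    have ev: "\<forall>\<^sub>F n in sequentially. Rs n \<in> U" if "openin Pyr_star_top U" "R \<in> U" for U
      using that Rs by (rule openin_Pyr_star_topD)
    show "\<forall>\<^sub>F n in sequentially. Rs n \<in> Pyr_star"
      using ev[of Pyr_star] R by (metis openin_topspace topspace_Pyr_star_top)
    show "(\<lambda>n. f (Rs n)) \<longlonglongrightarrow> f R"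
    proof (rule topological_tendstoI)
      fix T assume T: "open T" "f R \<in> T"
      have "continuous_map Pyr_star_top euclideanreal f"
        using cont unfolding pos_reals_top_def continuous_map_in_subtopology by blast
      then have "openin Pyr_star_top {x \<in> topspace Pyr_star_top. f x \<in> T}"
        using T(1) by (intro openin_continuous_map_preimage) auto
      from ev[OF this] have "\<forall>\<^sub>F n in sequentially. Rs n \<in> {x \<in> topspace Pyr_star_top. f x \<in> T}"
        using R T(2) by simp
      then show "\<forall>\<^sub>F n in sequentially. f (Rs n) \<in> T" by eventually_elim simp
    qed
  qed
  have "(\<lambda>n. ts n * f (Ps n)) \<longlonglongrightarrow> 0 * f P"
    by (intro tendsto_mult ts conv(1)[OF P Ps PsP])
  \<comment> \<open>Homogeneity is available on \<open>Pyr_star\<close> only, and the pyramids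
    \<open>Ps n\<close> lie there eventually because \<open>Pyr_star\<close> absorbs sequences
    converging to P.\<close>
  moreover have "\<forall>\<^sub>F n in sequentially. ts n * f (Ps n) = f (pyr_scale (ts n) (Ps n))"
    using conv(2)[OF P Ps PsP] by eventually_elim (simp add: f_scale ts)
  ultimately have "(\<lambda>n. f (pyr_scale (ts n) (Ps n))) \<longlonglongrightarrow> 0"
    by (simp add: filterlim_cong)
  moreover have "(\<lambda>n. f (pyr_scale (ts n) (Ps n))) \<longlonglongrightarrow> f Q"
    using Ps ts by (intro conv(1)[OF Q _ PsQ] pyramid_scale)
  ultimately have "f Q = 0" by (metis LIMSEQ_unique)
  then show False using f_pos[OF Q] by simp
qed

section \<open>Nontriviality\<close>

lemma (in mm) singleton_sets: "x \<in> mm_carrier X \<Longrightarrow> {x} \<in> events"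
proof -
  assume x: "x \<in> mm_carrier X"
  have "mcball x 0 = {x}" using x nonneg zero by (auto simp: order_antisym_conv)
  then show ?thesis using closedin_sets[OF closedin_mcball[of x 0]] by simp
qed

lemma (in mm) finite_subset_events: "finite S \<Longrightarrow> S \<subseteq> mm_carrier X \<Longrightarrow> S \<in> events"
  using singleton_sets sets.finite_UN[of S "\<lambda>x. {x}" "mm_meas X"] by auto

lemma (in mm) finite_separation:
  assumes "finite S" "S \<subseteq> mm_carrier X"
  obtains r where "r > 0" "\<And>a b. a \<in> S \<Longrightarrow> b \<in> S \<Longrightarrow> mm_dist X a b < r \<Longrightarrow> a = b"
proof -
  \<comment> \<open>The element 1 keeps the set nonempty when S has fewer than two points.\<close>
  define T where "T = insert 1 ((\<lambda>(a, b). mm_dist X a b) ` {(a, b) \<in> S \<times> S. a \<noteq> b})"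
  have fin: "finite T" unfolding T_def using assms(1)
    by (intro finite.insertI finite_imageI) (rule finite_subset[of _ "S \<times> S"], auto)
  have pos: "x > 0" if "x \<in> T" for x
    using that mdist_pos_less assms(2)[THEN subsetD] by (auto simp: T_def)
  show ?thesis
  proof (rule that[of "Min T"])
    show "Min T > 0" using fin pos by (subst Min_gr_iff) (auto simp: T_def)
    fix a b assume ab: "a \<in> S" "b \<in> S" "mm_dist X a b < Min T"
    show "a = b"
    proof (rule ccontr)
      assume "a \<noteq> b"
      then have "mm_dist X a b \<in> T" using ab by (auto simp: T_def intro!: image_eqI[of _ _ "(a, b)"])
      then have "Min T \<le> mm_dist X a b" using fin by (intro Min_le)
      then show False using ab(3) by simp
    qed
  qed
qed

text \<open>The points \<open>y i\<close> may coincide: the last clause says that the measure is the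
  image of the uniform measure on the N indices, with multiplicity, so spaces with fewer than N
  points are included.\<close>

definition pairwise_bounded :: "nat \<Rightarrow> (nat \<Rightarrow> nat \<Rightarrow> ereal) \<Rightarrow> mmspace \<Rightarrow> (nat \<Rightarrow> real) \<Rightarrow> bool" where
  "pairwise_bounded N D Y y \<longleftrightarrow> (\<forall>i<N. y i \<in> mm_carrier Y) \<and>
    (\<forall>i<N. \<forall>j<N. ereal (mm_dist Y (y i) (y j)) \<le> D i j) \<and>
    (\<forall>A\<in>sets (mm_meas Y). measure (mm_meas Y) A = card {i. i < N \<and> y i \<in> A} / N)"

text \<open>The pyramid of all images of \<open>N\<close> atoms of equal mass whose mutual distances are at
  most \<open>D i j\<close>, where \<open>\<infinity>\<close> is allowed.\<close>

definition atom_pyramid :: "nat \<Rightarrow> (nat \<Rightarrow> nat \<Rightarrow> ereal) \<Rightarrow> mmspace set" where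
  "atom_pyramid N D = {Y. mm_space Y \<and> (\<exists>y. pairwise_bounded N D Y y)}"

lemma atom_pyramid_mono:
  assumes "\<And>i j. i < N \<Longrightarrow> j < N \<Longrightarrow> D i j \<le> D' i j"
  shows "atom_pyramid N D \<subseteq> atom_pyramid N D'"
proof
  fix Y assume "Y \<in> atom_pyramid N D"
  then obtain y where "mm_space Y" "pairwise_bounded N D Y y" by (auto simp: atom_pyramid_def)
  moreover from this(2) have "pairwise_bounded N D' Y y"
    unfolding pairwise_bounded_def using assms by (blast intro: order_trans)
  ultimately show "Y \<in> atom_pyramid N D'" by (auto simp: atom_pyramid_def)
qed

text \<open>\<delta> is only a pseudometric on the indices, and points have to be real numbers:
  every class of indices at distance 0 is represented by its least element, converted to a
  real.\<close>

lemma finite_mm_space_exists: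
  fixes N :: nat and \<delta> :: "nat \<Rightarrow> nat \<Rightarrow> real"
  assumes N: "N > 0" and nn: "\<And>i j. \<delta> i j \<ge> 0" and refl: "\<And>i. i < N \<Longrightarrow> \<delta> i i = 0" and sym: "\<And>i j. \<delta> i j = \<delta> j i"
    and tri: "\<And>i j k. i < N \<Longrightarrow> j < N \<Longrightarrow> k < N \<Longrightarrow> \<delta> i k \<le> \<delta> i j + \<delta> j k"
  obtains Z z where "mm_space Z" "mm_carrier Z = z ` {..<N}" "sets (mm_meas Z) = Pow (z ` {..<N})"
    "\<And>i j. i < N \<Longrightarrow> j < N \<Longrightarrow> mm_dist Z (z i) (z j) = \<delta> i j"
    "\<And>A. A \<in> sets (mm_meas Z) \<Longrightarrow> measure (mm_meas Z) A = card {i. i < N \<and> z i \<in> A} / N"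
proof -
  define \<rho> where "\<rho> i = (LEAST j. j < N \<and> \<delta> i j = 0)" for i
  have \<rho>: "\<rho> i < N" "\<delta> i (\<rho> i) = 0" if "i < N" for i
    using LeastI[of "\<lambda>j. j < N \<and> \<delta> i j = 0" i] refl[OF that] that unfolding \<rho>_def by auto
  have \<delta>\<rho>: "\<delta> (\<rho> i) (\<rho> j) = \<delta> i j" if "i < N" "j < N" for i j
  proof (rule antisym)
    have "\<delta> (\<rho> i) (\<rho> j) \<le> \<delta> (\<rho> i) i + (\<delta> i j + \<delta> j (\<rho> j))"
      using tri[of "\<rho> i" i "\<rho> j"] tri[of i j "\<rho> j"] that \<rho>(1) by force
    then show "\<delta> (\<rho> i) (\<rho> j) \<le> \<delta> i j" using \<rho>(2) that sym by simp
    have "\<delta> i j \<le> \<delta> i (\<rho> i) + (\<delta> (\<rho> i) (\<rho> j) + \<delta> (\<rho> j) j)"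
      using tri[of i "\<rho> i" j] tri[of "\<rho> i" "\<rho> j" j] that \<rho>(1) by force
    then show "\<delta> i j \<le> \<delta> (\<rho> i) (\<rho> j)" using \<rho>(2) that sym by simp
  qed
  have \<rho>_eq: "\<rho> i = \<rho> j" if "i < N" "j < N" "\<delta> i j = 0" for i j
  proof -
    have "(k < N \<and> \<delta> i k = 0) = (k < N \<and> \<delta> j k = 0)" for k
      using tri[of i j k] tri[of j i k] that nn[of i k] nn[of j k] sym[of i j] by auto
    then show ?thesis unfolding \<rho>_def by simp
  qed
  define z where "z i = real (\<rho> i)" for i
  define C where "C = z ` {..<N}"
  define d where "d x y = \<delta> (nat \<lfloor>x\<rfloor>) (nat \<lfloor>y\<rfloor>)" for x y :: real
  have d_z: "d (z i) (z j) = \<delta> i j" if "i < N" "j < N" for i j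
    using \<delta>\<rho>[OF that] by (simp add: d_def z_def)
  interpret Metric_space C d
  proof
    fix x y w
    show "0 \<le> d x y" by (simp add: d_def nn)
    show "d x y = d y x" using sym by (simp add: d_def)
    assume "x \<in> C" "y \<in> C"
    then obtain i j where ij: "i < N" "j < N" "x = z i" "y = z j" by (auto simp: C_def)
    show "(d x y = 0) = (x = y)"
      using \<rho>_eq[OF ij(1,2)] refl[OF ij(1)] d_z[OF ij(1,2)] d_z[OF ij(1,1)] unfolding ij(3,4)
      by (auto simp: z_def)
    assume "w \<in> C"
    then obtain k where k: "k < N" "w = z k" by (auto simp: C_def)
    show "d x w \<le> d x y + d y w" using tri[OF ij(1,2) k(1)] ij k by (simp add: d_z)
  qed
  have fin: "finite C" by (simp add: C_def)
  have top: "mtopology = discrete_topology C"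
    using fin by (intro finite_t1_space_imp_discrete_topology)
      (auto intro: Hausdorff_imp_t1_space Hausdorff_space_mtopology)
  define \<mu> where "\<mu> = distr (uniform_count_measure {..<N}) (count_space C) z"
  have z_meas: "z \<in> measurable (uniform_count_measure {..<N}) (count_space C)"
    by (rule measurableI) (auto simp: C_def sets_uniform_count_measure space_uniform_count_measure)
  interpret U: prob_space "uniform_count_measure {..<N}"
    using N by (intro prob_space_uniform_count_measure) auto
  interpret \<mu>: prob_space \<mu>
    unfolding \<mu>_def using z_meas by (rule U.prob_space_distr)
  have sets_\<mu>: "sets \<mu> = Pow C" and space_\<mu>: "space \<mu> = C" by (simp_all add: \<mu>_def)
  have meas: "\<mu>.prob A = card {i. i < N \<and> z i \<in> A} / N" if "A \<subseteq> C" for A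
  proof -
    have "\<mu>.prob A = U.prob (z -` A \<inter> space (uniform_count_measure {..<N}))"
      unfolding \<mu>_def using that by (intro measure_distr z_meas) auto
    also have "z -` A \<inter> space (uniform_count_measure {..<N}) = {i. i < N \<and> z i \<in> A}"
      by (auto simp: space_uniform_count_measure)
    also have "U.prob \<dots> = card {i. i < N \<and> z i \<in> A} / N"
      by (subst measure_uniform_count_measure) auto
    finally show ?thesis .
  qed
  have "mm_space (d, \<mu>)"
    unfolding mm_space_def mm_top_def mm_carrier_Pair mm_dist_Pair mm_meas_Pair space_\<mu>
  proof (intro conjI ballI allI impI)
    show "mcomplete"
      using fin by (intro compact_space_imp_mcomplete) (simp add: top compact_space_discrete_topology)
    show "separable_space mtopology"
      unfolding separable_space_def using fin closure_of_topspace[of mtopology]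
      by (intro exI[of _ C]) (simp add: countable_finite)
    show "sets \<mu> = sigma_sets C {U. openin mtopology U}"
      unfolding sets_\<mu> top by (simp add: sigma_sets_sigma_sets_eq Pow_def[symmetric])
         (metis Pow_UNIV sets_\<mu> sets.sigma_sets_eq space_\<mu>)
    fix x and r :: real assume "x \<in> C" "r > 0"
    then obtain i where i: "i < N" "x = z i" by (auto simp: C_def)
    have "mball x r \<subseteq> C" by auto
    have "{i. i < N \<and> z i \<in> mball x r} \<noteq> {}" using i \<open>x \<in> C\<close> \<open>r > 0\<close> by auto
    moreover have "finite {i. i < N \<and> z i \<in> mball x r}" by simp
    ultimately have "card {i. i < N \<and> z i \<in> mball x r} > 0" using card_gt_0_iff by blast
    then show "\<mu>.prob (mball x r) > 0"
      unfolding meas[OF \<open>mball x r \<subseteq> C\<close>] using N by simp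
  qed (fact Metric_space_axioms \<mu>.prob_space_axioms)+
  then show ?thesis
    using that[of "(d, \<mu>)" z] by (simp add: space_\<mu> sets_\<mu> C_def[symmetric] d_z meas)
qed

text \<open>The atoms are pushed forward by the dominating map: distances do not grow, and counting
  indices commutes with preimages.\<close>

lemma atom_pyramid_down:
  assumes Y: "Y \<in> atom_pyramid N D" and Y': "mm_space Y'" and le: "lip_le Y' Y"
  shows "Y' \<in> atom_pyramid N D"
proof -
  obtain y where y: "mm_space Y" "pairwise_bounded N D Y y" using Y by (auto simp: atom_pyramid_def)
  obtain f where f: "f \<in> measurable (mm_meas Y) (mm_meas Y')" "distr (mm_meas Y) (mm_meas Y') f = mm_meas Y'"
    "\<forall>x\<in>mm_carrier Y. \<forall>x'\<in>mm_carrier Y. mm_dist Y' (f x) (f x') \<le> mm_dist Y x x'"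
    using le unfolding lip_le_def by blast
  have yc: "y i \<in> mm_carrier Y" if "i < N" for i using y(2) that by (simp add: pairwise_bounded_def)
  have "pairwise_bounded N D Y' (\<lambda>i. f (y i))"
    unfolding pairwise_bounded_def
  proof (intro conjI allI impI ballI)
    fix i assume "i < N"
    then show "f (y i) \<in> mm_carrier Y'"
      using measurable_space[OF f(1), of "y i"] yc by (simp add: mm_carrier_def)
  next
    fix i j assume "i < N" "j < N"
    then have "mm_dist Y' (f (y i)) (f (y j)) \<le> mm_dist Y (y i) (y j)" using f(3) yc by blast
    then show "ereal (mm_dist Y' (f (y i)) (f (y j))) \<le> D i j"
      using y(2) \<open>i < N\<close> \<open>j < N\<close> unfolding pairwise_bounded_def by (meson ereal_less_eq(3) order_trans)
  next
    fix A assume A: "A \<in> sets (mm_meas Y')"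
    have "measure (mm_meas Y') A = measure (mm_meas Y) (f -` A \<inter> space (mm_meas Y))"
      by (subst f(2)[symmetric]) (rule measure_distr[OF f(1) A])
    also have "\<dots> = card {i. i < N \<and> y i \<in> f -` A \<inter> space (mm_meas Y)} / N"
      using y(2) measurable_sets[OF f(1) A] by (simp add: pairwise_bounded_def)
    also have "{i. i < N \<and> y i \<in> f -` A \<inter> space (mm_meas Y)} = {i. i < N \<and> f (y i) \<in> A}"
      using yc by (auto simp: mm_carrier_def)
    finally show "measure (mm_meas Y') A = card {i. i < N \<and> f (y i) \<in> A} / N" .
  qed
  then show ?thesis using Y' by (auto simp: atom_pyramid_def)
qed

text \<open>Sending \<open>z i\<close> to \<open>y i\<close> is well defined: coinciding z have
  distance 0, so the corresponding y coincide as well.\<close>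

lemma lip_le_finite:
  assumes Z: "mm_space Z" "mm_carrier Z = z ` {..<N}" "sets (mm_meas Z) = Pow (z ` {..<N})"
    "\<And>A. A \<in> sets (mm_meas Z) \<Longrightarrow> measure (mm_meas Z) A = card {i. i < N \<and> z i \<in> A} / N"
    and Y: "mm_space Y" "pairwise_bounded N D Y y"
    and le: "\<And>i j. i < N \<Longrightarrow> j < N \<Longrightarrow> mm_dist Y (y i) (y j) \<le> mm_dist Z (z i) (z j)"
  shows "lip_le Y Z"
proof -
  interpret Z: mm Z by standard fact
  interpret Y: mm Y by standard fact
  have yc: "y i \<in> mm_carrier Y" if "i < N" for i using Y(2) that by (simp add: pairwise_bounded_def)
  define f where "f x = y (SOME i. i < N \<and> z i = x)" for x
  have f: "f (z i) = y i" if i: "i < N" for i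
  proof -
    define j where "j = (SOME j. j < N \<and> z j = z i)"
    have j: "j < N" "z j = z i" using someI[of "\<lambda>j. j < N \<and> z j = z i" i] i by (auto simp: j_def)
    have "z i \<in> mm_carrier Z" using Z(2) i by simp
    then have "mm_dist Y (y j) (y i) \<le> 0" using le[OF j(1) i] j(2) by simp
    then have "y j = y i" using yc i j Y.nonneg[of "y j" "y i"] Y.zero[of "y j" "y i"] by simp
    then show ?thesis by (simp add: f_def j_def)
  qed
  have fm: "f \<in> measurable (mm_meas Z) (mm_meas Y)"
  proof (rule measurableI)
    show "f x \<in> space (mm_meas Y)" if "x \<in> space (mm_meas Z)" for x
      using that f yc by (auto simp: Z.space_mm Y.space_mm Z(2))
    show "f -` A \<inter> space (mm_meas Z) \<in> sets (mm_meas Z)" for A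
      by (auto simp: Z(3) Z.space_mm Z(2))
  qed
  have "distr (mm_meas Z) (mm_meas Y) f = mm_meas Y"
  proof (rule measure_eqI)
    fix A assume "A \<in> sets (distr (mm_meas Z) (mm_meas Y) f)"
    then have A: "A \<in> Y.events" by simp
    have "Z.prob (f -` A \<inter> space (mm_meas Z)) = card {i. i < N \<and> z i \<in> f -` A \<inter> space (mm_meas Z)} / N"
      by (rule Z(4)) (rule measurable_sets[OF fm A])
    also have "{i. i < N \<and> z i \<in> f -` A \<inter> space (mm_meas Z)} = {i. i < N \<and> y i \<in> A}"
      by (intro Collect_cong conj_cong refl) (simp add: f Z.space_mm Z(2))
    also have "card \<dots> / N = Y.prob A" using Y(2) A by (simp add: pairwise_bounded_def)
    finally show "emeasure (distr (mm_meas Z) (mm_meas Y) f) A = emeasure (mm_meas Y) A"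
      using A fm by (simp add: emeasure_distr Z.emeasure_eq_measure Y.emeasure_eq_measure)
  qed simp
  then show ?thesis
    unfolding lip_le_def using fm f le
    by (intro exI[of _ f]) (auto simp: Z(2))
qed

text \<open>The maximum of the two pseudometrics on the common index set is again a pseudometric and
  still bounded by D; its space dominates both.\<close>

lemma atom_pyramid_joint_bound:
  assumes N: "N > 0" and Y: "Y \<in> atom_pyramid N D" and Y': "Y' \<in> atom_pyramid N D"
  obtains Z where "Z \<in> atom_pyramid N D" "lip_le Y Z" "lip_le Y' Z"
proof -
  obtain y where y: "mm_space Y" "pairwise_bounded N D Y y" using Y by (auto simp: atom_pyramid_def)
  obtain y' where y': "mm_space Y'" "pairwise_bounded N D Y' y'" using Y' by (auto simp: atom_pyramid_def)
  interpret Y: mm Y by standard fact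
  interpret Y': mm Y' by standard fact
  have yc: "y i \<in> mm_carrier Y" "y' i \<in> mm_carrier Y'" if "i < N" for i
    using y(2) y'(2) that by (auto simp: pairwise_bounded_def)
  define \<delta> where "\<delta> i j = max (mm_dist Y (y i) (y j)) (mm_dist Y' (y' i) (y' j))" for i j
  obtain Z z where Z: "mm_space Z" "mm_carrier Z = z ` {..<N}" "sets (mm_meas Z) = Pow (z ` {..<N})"
    "\<And>i j. i < N \<Longrightarrow> j < N \<Longrightarrow> mm_dist Z (z i) (z j) = \<delta> i j"
    "\<And>A. A \<in> sets (mm_meas Z) \<Longrightarrow> measure (mm_meas Z) A = card {i. i < N \<and> z i \<in> A} / N"
  proof (rule finite_mm_space_exists[OF N, of \<delta>])
    show "0 \<le> \<delta> i j" for i j by (simp add: \<delta>_def le_max_iff_disj)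
    show "\<delta> i i = 0" if "i < N" for i using yc[OF that] by (simp add: \<delta>_def)
    show "\<delta> i j = \<delta> j i" for i j by (simp add: \<delta>_def Y.commute[of "y i"] Y'.commute[of "y' i"])
    show "\<delta> i k \<le> \<delta> i j + \<delta> j k" if "i < N" "j < N" "k < N" for i j k
      using Y.triangle[OF yc(1)[OF that(1)] yc(1)[OF that(2)] yc(1)[OF that(3)]]
        Y'.triangle[OF yc(2)[OF that(1)] yc(2)[OF that(2)] yc(2)[OF that(3)]]
      unfolding \<delta>_def by linarith
  qed blast
  have "pairwise_bounded N D Z z"
    unfolding pairwise_bounded_def
  proof (intro conjI allI impI ballI)
    show "z i \<in> mm_carrier Z" if "i < N" for i using that Z(2) by auto
    show "ereal (mm_dist Z (z i) (z j)) \<le> D i j" if "i < N" "j < N" for i j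
      using y(2) y'(2) that unfolding pairwise_bounded_def Z(4)[OF that] \<delta>_def by (simp add: max_def)
  qed (rule Z(5))
  then have "Z \<in> atom_pyramid N D" using Z(1) by (auto simp: atom_pyramid_def)
  moreover have "lip_le Y Z"
    by (rule lip_le_finite[OF Z(1-3,5) y]) (auto simp: Z(4) \<delta>_def)
  moreover have "lip_le Y' Z"
    by (rule lip_le_finite[OF Z(1-3,5) y']) (auto simp: Z(4) \<delta>_def)
  ultimately show ?thesis by (rule that)
qed

text \<open>An atom of the nearby space has mass at least 1/N > e, so the good parameters meet its
  preimage; \<open>z i\<close> is the image in Y of one such parameter. Good parameters over the
  same atom have distance 0 there, so their images in Y are e-close.\<close>

lemma atom_pyramid_approx:
  assumes N: "N > 0" and Y: "mm_space Y" and near: "box_near Y (atom_pyramid N D) e" and e: "e < 1 / N"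
  obtains z where "\<And>i. i < N \<Longrightarrow> z i \<in> mm_carrier Y"
    "\<And>i j. i < N \<Longrightarrow> j < N \<Longrightarrow> ereal (mm_dist Y (z i) (z j)) \<le> D i j + ereal e"
    "\<And>J. J \<subseteq> {..<N} \<Longrightarrow>
      measure (mm_meas Y) (\<Union>i\<in>J. {x \<in> mm_carrier Y. mm_dist Y (z i) x \<le> e}) \<ge> card J / N - e"
proof -
  interpret Y: mm Y by standard fact
  obtain Z where Z: "Z \<in> atom_pyramid N D" "box_admissible Y Z e" using near by (auto simp: box_near_def)
  then obtain y where y: "mm_space Z" "pairwise_bounded N D Z y" by (auto simp: atom_pyramid_def)
  interpret Z: mm Z by standard fact
  interpret U: prob_space unit_interval_leb by (rule prob_space_unit_interval_leb)
  let ?U = unit_interval_leb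
  obtain \<phi> \<psi> I0 where *: "\<phi> \<in> measurable ?U (mm_meas Y)" "distr ?U (mm_meas Y) \<phi> = mm_meas Y"
    "\<psi> \<in> measurable ?U (mm_meas Z)" "distr ?U (mm_meas Z) \<psi> = mm_meas Z" "I0 \<in> sets ?U" "measure ?U I0 \<ge> 1 - e"
    "\<And>s t. s\<in>I0 \<Longrightarrow> t\<in>I0 \<Longrightarrow> \<bar>mm_dist Y (\<phi> s) (\<phi> t) - mm_dist Z (\<psi> s) (\<psi> t)\<bar> \<le> e"
    using Z(2) unfolding box_admissible_def by blast
  have I0: "s \<in> space ?U" if "s \<in> I0" for s using sets.sets_into_space[OF *(5)] that by blast
  have yc: "y i \<in> mm_carrier Z" if "i < N" for i using y(2) that by (simp add: pairwise_bounded_def)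
  have lower: "U.prob (I0 \<inter> (\<psi> -` A \<inter> space ?U)) \<ge> Z.prob A - e" if A: "A \<in> Z.events" for A
  proof -
    have B: "\<psi> -` A \<inter> space ?U \<in> U.events" using *(3) A by (rule measurable_sets)
    have "Z.prob A = measure (distr ?U (mm_meas Z) \<psi>) A" by (simp add: *(4))
    also have "\<dots> = U.prob (\<psi> -` A \<inter> space ?U)" by (rule measure_distr[OF *(3) A])
    also have "\<dots> \<le> U.prob ((I0 \<inter> (\<psi> -` A \<inter> space ?U)) \<union> (space ?U - I0))"
      using B *(5) by (intro U.finite_measure_mono) blast+
    also have "\<dots> \<le> U.prob (I0 \<inter> (\<psi> -` A \<inter> space ?U)) + U.prob (space ?U - I0)"
      using B *(5) by (intro measure_Un_le) blast+
    also have "U.prob (space ?U - I0) \<le> e" using *(5,6) by (simp add: U.prob_compl del: space_unit_interval_leb)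
    finally show ?thesis by simp
  qed
  have "\<exists>s. s \<in> I0 \<and> \<psi> s = y i" if i: "i < N" for i
  proof -
    have ev: "{y i} \<in> Z.events" using yc[OF i] by (rule Z.singleton_sets)
    have "1 \<le> card {j. j < N \<and> y j \<in> {y i}}"
      using i card_gt_0_iff[of "{j. j < N \<and> y j \<in> {y i}}"] by (auto simp: Suc_le_eq)
    then have "1 / N \<le> Z.prob {y i}"
      using y(2) ev by (simp add: pairwise_bounded_def divide_right_mono)
    then have "U.prob (I0 \<inter> (\<psi> -` {y i} \<inter> space ?U)) > 0" using lower[OF ev] e by linarith
    then have "I0 \<inter> (\<psi> -` {y i} \<inter> space ?U) \<noteq> {}" by auto
    then show ?thesis by blast
  qed
  then have "\<forall>i. \<exists>s. i < N \<longrightarrow> s \<in> I0 \<and> \<psi> s = y i" by blast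
  then obtain s where "\<forall>i. i < N \<longrightarrow> s i \<in> I0 \<and> \<psi> (s i) = y i" by (rule choice[THEN exE])
  then have s: "s i \<in> I0" "\<psi> (s i) = y i" if "i < N" for i using that by auto
  show ?thesis
  proof (rule that[of "\<lambda>i. \<phi> (s i)"])
    show "\<phi> (s i) \<in> mm_carrier Y" if "i < N" for i
      using measurable_space[OF *(1) I0[OF s(1)[OF that]]] by (simp add: Y.space_mm)
    show "ereal (mm_dist Y (\<phi> (s i)) (\<phi> (s j))) \<le> D i j + ereal e" if "i < N" "j < N" for i j
    proof -
      have "mm_dist Y (\<phi> (s i)) (\<phi> (s j)) \<le> mm_dist Z (y i) (y j) + e"
        using *(7)[OF s(1)[OF that(1)] s(1)[OF that(2)]] s(2)[OF that(1)] s(2)[OF that(2)] by simp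
      then have "ereal (mm_dist Y (\<phi> (s i)) (\<phi> (s j))) \<le> ereal (mm_dist Z (y i) (y j)) + ereal e" by simp
      also have "\<dots> \<le> D i j + ereal e"
        using y(2) that by (intro add_right_mono) (simp add: pairwise_bounded_def)
      finally show ?thesis .
    qed
    fix J assume J: "J \<subseteq> {..<N}"
    define B where "B = (\<Union>i\<in>J. {x \<in> mm_carrier Y. mm_dist Y (\<phi> (s i)) x \<le> e})"
    have finJ: "finite J" using J finite_subset by blast
    have B: "B \<in> Y.events"
      unfolding B_def
    proof (intro sets.finite_UN finJ)
      fix i assume "i \<in> J"
      then have "\<phi> (s i) \<in> mm_carrier Y"
        using measurable_space[OF *(1) I0[OF s(1)]] J by (auto simp: Y.space_mm)
      then have "{x \<in> mm_carrier Y. mm_dist Y (\<phi> (s i)) x \<le> e} = Y.mcball (\<phi> (s i)) e" by auto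
      then show "{x \<in> mm_carrier Y. mm_dist Y (\<phi> (s i)) x \<le> e} \<in> Y.events"
        using Y.closedin_sets[OF Y.closedin_mcball] by simp
    qed
    have yJ: "y ` J \<in> Z.events"
      using finJ J yc by (intro Z.finite_subset_events) auto
    have "card J \<le> card {i. i < N \<and> y i \<in> y ` J}"
      using J by (intro card_mono) auto
    then have "card J / N \<le> Z.prob (y ` J)"
      using y(2) yJ by (simp add: pairwise_bounded_def divide_right_mono)
    then have "card J / N - e \<le> U.prob (I0 \<inter> (\<psi> -` (y ` J) \<inter> space ?U))"
      using lower[OF yJ] by linarith
    also have "\<dots> \<le> U.prob (\<phi> -` B \<inter> space ?U)"
    proof (rule U.finite_measure_mono)
      show "I0 \<inter> (\<psi> -` (y ` J) \<inter> space ?U) \<subseteq> \<phi> -` B \<inter> space ?U"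
      proof
        fix u assume u: "u \<in> I0 \<inter> (\<psi> -` (y ` J) \<inter> space ?U)"
        then obtain i where i: "i \<in> J" "\<psi> u = y i" by auto
        then have "i < N" using J by auto
        have "mm_dist Y (\<phi> (s i)) (\<phi> u) \<le> e"
          using *(7)[OF s(1)[OF \<open>i < N\<close>], of u] u s(2)[OF \<open>i < N\<close>] i(2) yc[OF \<open>i < N\<close>] by simp
        moreover have "\<phi> u \<in> mm_carrier Y" using measurable_space[OF *(1), of u] u by (simp add: Y.space_mm)
        ultimately show "u \<in> \<phi> -` B \<inter> space ?U" using i(1) u by (auto simp: B_def)
      qed
    qed (rule measurable_sets[OF *(1) B])
    also have "\<dots> = Y.prob B"
      using measure_distr[OF *(1) B] by (simp add: *(2))
    finally show "card J / N - e \<le> Y.prob (\<Union>i\<in>J. {x \<in> mm_carrier Y. mm_dist Y (\<phi> (s i)) x \<le> e})"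
      by (simp add: B_def)
  qed
qed

text \<open>Small balls about the points of S have mass above e, so each meets one of the N closed
  e-balls that carry mass at least 1 - e. The separation r makes the resulting map to indices
  injective.\<close>

lemma card_separated_le:
  assumes N: "N > 0" and Y: "mm_space Y" and near: "\<And>e. e > 0 \<Longrightarrow> \<exists>D. box_near Y (atom_pyramid N D) e"
    and S: "finite S" "S \<subseteq> mm_carrier Y"
  shows "card S \<le> N"
proof (cases "S = {}")
  case False
  interpret Y: mm Y by standard fact
  obtain r where r: "r > 0" "\<And>a b. a \<in> S \<Longrightarrow> b \<in> S \<Longrightarrow> mm_dist Y a b < r \<Longrightarrow> a = b"
    using Y.finite_separation[OF S] by blast
  define m where "m = Min ((\<lambda>a. Y.prob (Y.mball a (r / 4))) ` S)"
  have m: "m > 0" "\<And>a. a \<in> S \<Longrightarrow> m \<le> Y.prob (Y.mball a (r / 4))"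
  proof -
    show "m > 0"
      unfolding m_def using S False r(1) Y.mm_support by (subst Min_gr_iff) auto
    show "m \<le> Y.prob (Y.mball a (r / 4))" if "a \<in> S" for a
      unfolding m_def using S(1) that by (intro Min_le) auto
  qed
  \<comment> \<open>e < m forces every small ball to meet an e-ball, e \<le> r/4 keeps the centre of
    the latter within r/2, and e < 1/N is what \<open>atom_pyramid_approx\<close> asks for.\<close>
  define e where "e = min (m / 2) (min (r / 4) (1 / (2 * N)))"
  have e: "e > 0" "e < m" "e \<le> r / 4" "e < 1 / N"
  proof -
    show "e > 0" using m(1) r(1) N by (simp add: e_def)
    show "e < m" using m(1) by (simp add: e_def min_less_iff_disj)
    show "e \<le> r / 4" by (simp add: e_def min_le_iff_disj)
    have "1 / (2 * real N) < 1 / N" using N by (simp add: field_simps)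
    then show "e < 1 / N" by (simp add: e_def min_less_iff_disj)
  qed
  obtain D where "box_near Y (atom_pyramid N D) e" using near[OF e(1)] by blast
  then obtain z where z: "\<And>i. i < N \<Longrightarrow> z i \<in> mm_carrier Y"
    "\<And>J. J \<subseteq> {..<N} \<Longrightarrow>
      Y.prob (\<Union>i\<in>J. {x \<in> mm_carrier Y. mm_dist Y (z i) x \<le> e}) \<ge> card J / N - e"
    by (rule atom_pyramid_approx[OF N Y _ e(4)]) blast
  let ?B = "\<Union>i<N. {x \<in> mm_carrier Y. mm_dist Y (z i) x \<le> e}"
  have B: "?B \<in> Y.events"
  proof (intro sets.finite_UN)
    fix i assume "i \<in> {..<N}"
    then have "{x \<in> mm_carrier Y. mm_dist Y (z i) x \<le> e} = Y.mcball (z i) e" using z(1) by auto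
    then show "{x \<in> mm_carrier Y. mm_dist Y (z i) x \<le> e} \<in> Y.events"
      using Y.closedin_sets[OF Y.closedin_mcball] by simp
  qed simp
  have PB: "Y.prob ?B \<ge> 1 - e" using z(2)[of "{..<N}"] N by simp
  have "\<exists>i<N. mm_dist Y a (z i) < r / 2" if a: "a \<in> S" for a
  proof (rule ccontr)
    assume neg: "\<not> ?thesis"
    have "Y.mball a (r / 4) \<subseteq> space (mm_meas Y) - ?B"
    proof
      fix x assume x: "x \<in> Y.mball a (r / 4)"
      have "\<not> mm_dist Y (z i) x \<le> e" if "i < N" for i
      proof
        assume "mm_dist Y (z i) x \<le> e"
        then have "mm_dist Y a (z i) < r / 2"
          using Y.triangle'[of a x "z i"] x z(1)[OF that] e(3) by simp
        then show False using neg that by blast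
      qed
      then show "x \<in> space (mm_meas Y) - ?B" using x by (auto simp: Y.space_mm)
    qed
    then have "Y.prob (Y.mball a (r / 4)) \<le> Y.prob (space (mm_meas Y) - ?B)"
      by (rule Y.finite_measure_mono) (rule sets.compl_sets[OF B])
    also have "\<dots> \<le> e" using PB Y.prob_compl[OF B] by linarith
    finally show False using m(2)[OF a] e(2) by linarith
  qed
  then obtain g where g: "\<And>a. a \<in> S \<Longrightarrow> g a < N \<and> mm_dist Y a (z (g a)) < r / 2" by metis
  have "inj_on g S"
  proof (rule inj_onI)
    fix a b assume ab: "a \<in> S" "b \<in> S" "g a = g b"
    have "mm_dist Y a b < r"
      using Y.triangle'[of a "z (g a)" b] g[OF ab(1)] g[OF ab(2)] ab S(2) z(1)[of "g a"]
        Y.triangle'[of a b "z (g a)"] Y.commute[of b "z (g a)"] by (auto simp: subset_iff)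
    then show "a = b" using r(2) ab by blast
  qed
  then have "card S \<le> card {..<N}" using g by (intro card_inj_on_le) auto
  then show ?thesis by simp
qed simp

text \<open>Y has at most N points by \<open>card_separated_le\<close>, so there are finitely many
  maps from the indices to its carrier. One of them serves infinitely many k, and letting
  \<open>e k\<close> tend to 0 for this fixed map gives the exact conditions.\<close>

lemma atom_pyramid_limit:
  assumes N: "N > 0" and Y: "mm_space Y" and near: "\<And>k. box_near Y (atom_pyramid N (D' k)) (e k)"
    and e: "e \<longlonglongrightarrow> 0"
    and D': "\<And>i j \<eta>. i < N \<Longrightarrow> j < N \<Longrightarrow> \<eta> > 0 \<Longrightarrow> \<forall>\<^sub>F k in sequentially. D' k i j \<le> D i j + ereal \<eta>"
  shows "Y \<in> atom_pyramid N D"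
proof -
  interpret Y: mm Y by standard fact
  have small: "\<exists>D. box_near Y (atom_pyramid N D) \<epsilon>" if \<epsilon>: "\<epsilon> > 0" for \<epsilon>
  proof -
    have "\<forall>\<^sub>F k in sequentially. e k < \<epsilon>" using e \<epsilon> by (rule order_tendstoD)
    then obtain k where "e k < \<epsilon>" using eventually_happens by fastforce
    then show ?thesis using near[of k] box_near_mono by (metis less_imp_le)
  qed
  have card_le: "card S \<le> N" if "finite S" "S \<subseteq> mm_carrier Y" for S
    by (rule card_separated_le[OF N Y small that])
  have fin: "finite (mm_carrier Y)"
  proof (rule ccontr)
    assume "infinite (mm_carrier Y)"
    then obtain S where "S \<subseteq> mm_carrier Y" "finite S" "card S = Suc N"
      using infinite_arbitrarily_large by blast
    then show False using card_le[of S] by simp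
  qed
  \<comment> \<open>Below the separation r a closed e-ball about a point is that single point, so
    masses of balls become masses of sets of atoms.\<close>
  obtain r where r: "r > 0" "\<And>a b. a \<in> mm_carrier Y \<Longrightarrow> b \<in> mm_carrier Y \<Longrightarrow> mm_dist Y a b < r \<Longrightarrow> a = b"
    using Y.finite_separation[OF fin order_refl] by blast
  have "\<forall>\<^sub>F k in sequentially. e k < min r (1 / N)"
    using r(1) N by (intro order_tendstoD(2)[OF e]) simp
  then obtain k0 where k0: "\<And>k. k \<ge> k0 \<Longrightarrow> e k < r \<and> e k < 1 / N"
    by (auto simp: eventually_sequentially)
  have "\<exists>z. z \<in> {..<N} \<rightarrow>\<^sub>E mm_carrier Y \<and>
      (\<forall>i<N. \<forall>j<N. ereal (mm_dist Y (z i) (z j)) \<le> D' k i j + ereal (e k)) \<and>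
      (\<forall>J. J \<subseteq> {..<N} \<longrightarrow> Y.prob (z ` J) \<ge> card J / N - e k)" if k: "k \<ge> k0" for k
  proof -
    obtain z where z: "\<And>i. i < N \<Longrightarrow> z i \<in> mm_carrier Y"
      "\<And>i j. i < N \<Longrightarrow> j < N \<Longrightarrow> ereal (mm_dist Y (z i) (z j)) \<le> D' k i j + ereal (e k)"
      "\<And>J. J \<subseteq> {..<N} \<Longrightarrow>
        Y.prob (\<Union>i\<in>J. {x \<in> mm_carrier Y. mm_dist Y (z i) x \<le> e k}) \<ge> card J / N - e k"
      by (rule atom_pyramid_approx[OF N Y near[of k] conjunct2[OF k0[OF k]]]) blast
    have mass: "Y.prob (z ` J) \<ge> card J / N - e k" if J: "J \<subseteq> {..<N}" for J
    proof -
      have "(\<Union>i\<in>J. {x \<in> mm_carrier Y. mm_dist Y (z i) x \<le> e k}) \<subseteq> z ` J"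
      proof
        fix x assume "x \<in> (\<Union>i\<in>J. {x \<in> mm_carrier Y. mm_dist Y (z i) x \<le> e k})"
        then obtain i where i: "i \<in> J" "x \<in> mm_carrier Y" "mm_dist Y (z i) x \<le> e k" by blast
        then have "z i = x" using r(2)[of "z i" x] z(1)[of i] J k0[OF k] by auto
        then show "x \<in> z ` J" using i(1) by blast
      qed
      moreover have "z ` J \<in> Y.events"
        using J z(1) finite_subset[OF J] by (intro Y.finite_subset_events) auto
      ultimately show ?thesis using z(3)[OF J] Y.finite_measure_mono by (meson order_trans)
    qed
    \<comment> \<open>Restricting to the index set makes the maps extensional, so that the set of
      candidates is finite.\<close>
    have img: "restrict z {..<N} ` J = z ` J" if "J \<subseteq> {..<N}" for J using that by (auto simp: image_def)
    show ?thesis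
      using z(1,2) mass img by (intro exI[of _ "restrict z {..<N}"]) auto
  qed
  then have "\<forall>k. \<exists>z. k0 \<le> k \<longrightarrow> z \<in> {..<N} \<rightarrow>\<^sub>E mm_carrier Y \<and>
      (\<forall>i<N. \<forall>j<N. ereal (mm_dist Y (z i) (z j)) \<le> D' k i j + ereal (e k)) \<and>
      (\<forall>J. J \<subseteq> {..<N} \<longrightarrow> Y.prob (z ` J) \<ge> card J / N - e k)" by blast
  then obtain zz where zz0: "\<forall>k. k0 \<le> k \<longrightarrow> zz k \<in> {..<N} \<rightarrow>\<^sub>E mm_carrier Y \<and>
      (\<forall>i<N. \<forall>j<N. ereal (mm_dist Y (zz k i) (zz k j)) \<le> D' k i j + ereal (e k)) \<and>
      (\<forall>J. J \<subseteq> {..<N} \<longrightarrow> Y.prob (zz k ` J) \<ge> card J / N - e k)" by (rule choice[THEN exE])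
  have zz: "zz k \<in> {..<N} \<rightarrow>\<^sub>E mm_carrier Y"
    "\<And>i j. i < N \<Longrightarrow> j < N \<Longrightarrow> ereal (mm_dist Y (zz k i) (zz k j)) \<le> D' k i j + ereal (e k)"
    "\<And>J. J \<subseteq> {..<N} \<Longrightarrow> Y.prob (zz k ` J) \<ge> card J / N - e k" if k: "k0 \<le> k" for k
    using zz0[THEN spec, THEN mp, OF k] by simp_all
  have "finite (zz ` {k0..})"
    using zz(1) fin by (intro finite_subset[OF _ finite_PiE[of "{..<N}" "\<lambda>_. mm_carrier Y"]]) auto
  then obtain k1 where k1: "k1 \<in> {k0..}" "infinite {k \<in> {k0..}. zz k = zz k1}"
    using pigeonhole_infinite[OF infinite_Ici] by blast
  define z where "z = zz k1"
  have freq: "\<exists>k. k \<ge> k0 \<and> zz k = z \<and> Q k" if "\<forall>\<^sub>F k in sequentially. Q k" for Q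
  proof -
    obtain K where K: "\<And>k. k \<ge> K \<Longrightarrow> Q k" using \<open>\<forall>\<^sub>F k in sequentially. Q k\<close> by (auto simp: eventually_sequentially)
    obtain k where "k > K" "k \<in> {k \<in> {k0..}. zz k = zz k1}" using k1(2) by (auto simp: infinite_nat_iff_unbounded)
    then show ?thesis using K[of k] by (auto simp: z_def)
  qed
  have zc: "z i \<in> mm_carrier Y" if "i < N" for i
    using zz(1)[of k1] k1(1) that unfolding z_def by (auto simp: PiE_def Pi_def)
  have mass: "card J / N \<le> Y.prob (z ` J)" if J: "J \<subseteq> {..<N}" for J
  proof (rule field_le_epsilon)
    fix \<eta> :: real assume "\<eta> > 0"
    then have "\<forall>\<^sub>F k in sequentially. e k < \<eta>" by (rule order_tendstoD(2)[OF e])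
    then obtain k where "k \<ge> k0" "zz k = z" "e k < \<eta>" using freq by blast
    then show "card J / N \<le> Y.prob (z ` J) + \<eta>" using zz(3)[of k J] J by auto
  qed
  \<comment> \<open>Only lower bounds for masses pass to the limit; applied to A and to its
    complement they give equality.\<close>
  have mass': "card {i. i < N \<and> z i \<in> A} / N \<le> Y.prob A" if A: "A \<in> Y.events" for A
  proof -
    have "card {i. i < N \<and> z i \<in> A} / N \<le> Y.prob (z ` {i. i < N \<and> z i \<in> A})" by (intro mass) auto
    also have "\<dots> \<le> Y.prob A" using A by (intro Y.finite_measure_mono) auto
    finally show ?thesis .
  qed
  have "pairwise_bounded N D Y z"
    unfolding pairwise_bounded_def
  proof (intro conjI allI impI ballI zc)
    fix i j assume ij: "i < N" "j < N"
    show "ereal (mm_dist Y (z i) (z j)) \<le> D i j"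
    proof (rule ereal_le_epsilon2)
      fix \<eta> :: real assume "\<eta> > 0"
      have "\<forall>\<^sub>F k in sequentially. e k < \<eta> / 2"
        using \<open>\<eta> > 0\<close> by (intro order_tendstoD(2)[OF e]) simp
      moreover have "\<forall>\<^sub>F k in sequentially. D' k i j \<le> D i j + ereal (\<eta> / 2)"
        using \<open>\<eta> > 0\<close> by (intro D' ij) simp
      ultimately have "\<forall>\<^sub>F k in sequentially. e k < \<eta> / 2 \<and> D' k i j \<le> D i j + ereal (\<eta> / 2)"
        by (rule eventually_conj)
      then obtain k where k: "k \<ge> k0" "zz k = z" "e k < \<eta> / 2" "D' k i j \<le> D i j + ereal (\<eta> / 2)"
        using freq by blast
      have "ereal (mm_dist Y (z i) (z j)) \<le> D' k i j + ereal (e k)" using zz(2)[OF k(1) ij] k(2) by simp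
      also have "\<dots> \<le> (D i j + ereal (\<eta> / 2)) + ereal (\<eta> / 2)"
        using k(3,4) by (intro add_mono) auto
      also have "\<dots> = D i j + ereal \<eta>" by (simp add: add.assoc)
      finally show "ereal (mm_dist Y (z i) (z j)) \<le> D i j + ereal \<eta>" .
    qed
  next
    fix A assume A: "A \<in> Y.events"
    have "card {i. i < N \<and> z i \<in> space (mm_meas Y) - A} / N \<le> Y.prob (space (mm_meas Y) - A)"
      by (rule mass') (rule sets.compl_sets[OF A])
    then have "card {i. i < N \<and> z i \<in> space (mm_meas Y) - A} / N \<le> 1 - Y.prob A" by (simp add: Y.prob_compl[OF A])
    moreover have "card {i. i < N \<and> z i \<in> space (mm_meas Y) - A} = N - card {i. i < N \<and> z i \<in> A}"
    proof -
      have "{i. i < N \<and> z i \<in> space (mm_meas Y) - A} = {..<N} - {i. i < N \<and> z i \<in> A}"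
        using zc by (auto simp: Y.space_mm)
      then show ?thesis by (subst card_Diff_subset[symmetric, of _ "{..<N}", simplified]) auto
    qed
    moreover have "card {i. i < N \<and> z i \<in> A} \<le> N"
      using card_mono[of "{..<N}" "{i. i < N \<and> z i \<in> A}"] by auto
    ultimately have "1 - card {i. i < N \<and> z i \<in> A} / N \<le> 1 - Y.prob A"
      using N by (simp add: of_nat_diff diff_divide_distrib)
    then show "Y.prob A = card {i. i < N \<and> z i \<in> A} / N" using mass'[OF A] by linarith
  qed
  then show ?thesis using Y by (auto simp: atom_pyramid_def)
qed

text \<open>Closedness is the constant case of \<open>atom_pyramid_limit\<close>; a space with all
  distances 0 shows nonemptiness because D is nonnegative.\<close>

lemma pyramid_atom_pyramid:
  assumes N: "N > 0" and D: "\<And>i j. i < N \<Longrightarrow> j < N \<Longrightarrow> D i j \<ge> 0"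
  shows "pyramid (atom_pyramid N D)"
proof -
  have mm': "mm_space Y" if "Y \<in> atom_pyramid N D" for Y using that by (simp add: atom_pyramid_def)
  have ne: "atom_pyramid N D \<noteq> {}"
  proof -
    obtain Z z where Z: "mm_space Z" "mm_carrier Z = z ` {..<N}" "sets (mm_meas Z) = Pow (z ` {..<N})"
      "\<And>i j. i < N \<Longrightarrow> j < N \<Longrightarrow> mm_dist Z (z i) (z j) = 0"
      "\<And>A. A \<in> sets (mm_meas Z) \<Longrightarrow> measure (mm_meas Z) A = card {i. i < N \<and> z i \<in> A} / N"
      by (rule finite_mm_space_exists[OF N, of "\<lambda>_ _. 0"]) (simp; fail | blast)+
    have "pairwise_bounded N D Z z"
      unfolding pairwise_bounded_def
    proof (intro conjI allI impI ballI Z(5))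
      show "ereal (mm_dist Z (z i) (z j)) \<le> D i j" if "i < N" "j < N" for i j
        using D[OF that] Z(4)[OF that] by (simp add: zero_ereal_def)
    qed (use Z(2) in auto)
    then show ?thesis using Z(1) unfolding atom_pyramid_def by blast
  qed
  show ?thesis
    unfolding pyramid_def
  proof (intro conjI ballI allI impI)
    fix Y Y' assume "Y \<in> atom_pyramid N D" "Y' \<in> atom_pyramid N D"
    then show "\<exists>X\<in>atom_pyramid N D. lip_le Y X \<and> lip_le Y' X"
      using atom_pyramid_joint_bound[OF N] by metis
  next
    fix X assume X: "mm_space X \<and> box_set X (atom_pyramid N D) = 0"
    have "box_near X (atom_pyramid N D) (inverse (real (Suc k)))" for k
      using X by (intro box_set_lessD[OF ne mm']) auto
    then show "X \<in> atom_pyramid N D"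
      using X by (intro atom_pyramid_limit[OF N _ _ LIMSEQ_inverse_real_of_nat, of X "\<lambda>_. D"])
        (auto simp: add_increasing2)
  next
    show "mm_space X" if "X \<in> atom_pyramid N D" for X using mm'[OF that] .
    show "Y \<in> atom_pyramid N D" if "X \<in> atom_pyramid N D" "mm_space Y \<and> lip_le Y X" for X Y
      using atom_pyramid_down[OF that(1)] that(2) by blast
  qed (fact ne)
qed

text \<open>If a space outside the limit were not eventually far, its nearness at levels 1/(k+1)
  along indices \<open>r k\<close> \<ge> k would put it into the limit by
  \<open>atom_pyramid_limit\<close>.\<close>

lemma atom_pyramid_weak_conv:
  assumes N: "N > 0" and D: "\<And>i j. i < N \<Longrightarrow> j < N \<Longrightarrow> D i j \<ge> 0"
    and D0: "\<And>n i j. i < N \<Longrightarrow> j < N \<Longrightarrow> D' n i j \<ge> 0"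
    and sub: "\<And>Y. Y \<in> atom_pyramid N D \<Longrightarrow> \<forall>\<^sub>F n in sequentially. Y \<in> atom_pyramid N (D' n)"
    and le: "\<And>i j \<eta>. i < N \<Longrightarrow> j < N \<Longrightarrow> \<eta> > 0 \<Longrightarrow> \<forall>\<^sub>F n in sequentially. D' n i j \<le> D i j + ereal \<eta>"
  shows "weak_conv (\<lambda>n. atom_pyramid N (D' n)) (atom_pyramid N D)"
proof (subst weak_conv_iff, goal_cases)
  case (1 n) then show ?case using N D0 by (rule pyramid_atom_pyramid)
next
  case 2 then show ?case using N D by (rule pyramid_atom_pyramid)
next
  case 3
  show ?case
  proof (intro conjI ballI allI impI)
    fix Y and \<epsilon> :: real assume Y: "Y \<in> atom_pyramid N D" and "\<epsilon> > 0"
    have "mm_space Y" using Y by (simp add: atom_pyramid_def)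
    from sub[OF Y] show "\<forall>\<^sub>F n in sequentially. box_near Y (atom_pyramid N (D' n)) \<epsilon>"
      by eventually_elim (use box_admissible_refl[OF \<open>mm_space Y\<close>] \<open>\<epsilon> > 0\<close> in \<open>auto simp: box_near_def intro: bexI[of _ Y]\<close>)
  next
    fix Y assume Y: "mm_space Y \<and> Y \<notin> atom_pyramid N D"
    show "\<exists>\<epsilon>>0. \<forall>\<^sub>F n in sequentially. \<not> box_near Y (atom_pyramid N (D' n)) \<epsilon>"
    proof (rule ccontr)
      assume "\<not> ?thesis"
      then have "\<exists>n\<ge>k. box_near Y (atom_pyramid N (D' n)) (inverse (real (Suc k)))" for k
        by (force simp: eventually_sequentially)
      then have "\<forall>k. \<exists>n. n \<ge> k \<and> box_near Y (atom_pyramid N (D' n)) (inverse (real (Suc k)))" by blast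
      then obtain r where r: "\<forall>k. r k \<ge> k \<and> box_near Y (atom_pyramid N (D' (r k))) (inverse (real (Suc k)))"
        by (rule choice[THEN exE])
      have "Y \<in> atom_pyramid N D"
      proof (rule atom_pyramid_limit[OF N _ _ LIMSEQ_inverse_real_of_nat, of Y "\<lambda>k. D' (r k)"])
        fix i j and \<eta> :: real assume "i < N" "j < N" "\<eta> > 0"
        then obtain K where "\<And>n. n \<ge> K \<Longrightarrow> D' n i j \<le> D i j + ereal \<eta>"
          using le unfolding eventually_sequentially by blast
        then have "D' (r k) i j \<le> D i j + ereal \<eta>" if "k \<ge> K" for k
          using r that by (meson order_trans)
        then show "\<forall>\<^sub>F k in sequentially. D' (r k) i j \<le> D i j + ereal \<eta>"
          unfolding eventually_sequentially by blast
      next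
        show "box_near Y (atom_pyramid N (D' (r k))) (inverse (real (Suc k)))" for k
          using r by blast
      qed (use Y in blast)
      then show False using Y by blast
    qed
  qed
qed

text \<open>Three atoms, two of which are at distance \<open>a\<close> from each other and at distance \<open>b\<close> from the
  third: for \<open>a = 1\<close> and \<open>b \<rightarrow> \<infinity>\<close> these spaces, as well as their rescalings by \<open>1 / b\<close>, converge
  to pyramids that are not fixed by the action.\<close>

definition isosceles :: "'a::zero \<Rightarrow> 'a \<Rightarrow> nat \<Rightarrow> nat \<Rightarrow> 'a" where
  "isosceles a b i j = (if i = j then 0 else if i < 2 \<and> j < 2 then a else b)"

lemma isosceles_nonneg: "0 \<le> a \<Longrightarrow> 0 \<le> b \<Longrightarrow> 0 \<le> isosceles a b i (j :: nat)" for a b :: ereal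
  unfolding isosceles_def by (auto split: if_split)

lemma pyramid_isosceles: "0 \<le> a \<Longrightarrow> 0 \<le> b \<Longrightarrow> pyramid (atom_pyramid 3 (isosceles a b))"
  by (rule pyramid_atom_pyramid) (simp, rule isosceles_nonneg)

lemma isosceles_scale:
  assumes "t > 0"
  shows "pyr_scale t (atom_pyramid 3 (isosceles (ereal a) (ereal b))) =
    atom_pyramid 3 (isosceles (ereal (t * a)) (ereal (t * b)))"
proof -
  have "pairwise_bounded 3 (isosceles (ereal a) (ereal b)) (mm_scale (1 / t) X) =
      pairwise_bounded 3 (isosceles (ereal (t * a)) (ereal (t * b))) X" for X
  proof -
    have "ereal (1 / t * d) \<le> isosceles (ereal a) (ereal b) i j \<longleftrightarrow>
        ereal d \<le> isosceles (ereal (t * a)) (ereal (t * b)) i j" for d i j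
      using assms by (simp add: isosceles_def field_simps zero_ereal_def)
    then show ?thesis by (intro ext) (simp add: pairwise_bounded_def)
  qed
  moreover have "mm_space (mm_scale (1 / t) X) \<longleftrightarrow> mm_space X" for X
    using mm_space_scale[of "mm_scale (1 / t) X" t] mm_space_scale[of X "1 / t"] assms by auto
  ultimately show ?thesis
    using assms by (intro set_eqI) (simp add: in_pyr_scale_iff atom_pyramid_def)
qed

text \<open>The triangle inequality for base a and legs b amounts to a \<le> 2b; a = 0 merges the
  first two atoms.\<close>

lemma isosceles_space:
  fixes a b :: real
  assumes "0 \<le> a" "a \<le> 2 * b"
  obtains Z z where "mm_space Z" "mm_carrier Z = z ` {..<3}" "sets (mm_meas Z) = Pow (z ` {..<3})"
    "\<And>i j. i < 3 \<Longrightarrow> j < 3 \<Longrightarrow> mm_dist Z (z i) (z j) = isosceles a b i j"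
    "\<And>A. A \<in> sets (mm_meas Z) \<Longrightarrow> measure (mm_meas Z) A = card {i. i < 3 \<and> z i \<in> A} / 3"
proof -
  obtain Z z where "mm_space Z" "mm_carrier Z = z ` {..<3}" "sets (mm_meas Z) = Pow (z ` {..<3})"
    "\<And>i j. i < 3 \<Longrightarrow> j < 3 \<Longrightarrow> mm_dist Z (z i) (z j) = isosceles a b i j"
    "\<And>A. A \<in> sets (mm_meas Z) \<Longrightarrow> measure (mm_meas Z) A = card {i. i < 3 \<and> z i \<in> A} / real 3"
  proof (rule finite_mm_space_exists[of 3 "isosceles a b"])
    show "isosceles a b i k \<le> isosceles a b i j + isosceles a b j k" if "i < 3" "j < 3" "k < 3" for i j k
      using assms by (auto simp: isosceles_def)
    show "0 \<le> isosceles a b i j" for i j using assms by (auto simp: isosceles_def)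
    show "isosceles a b i j = isosceles a b j i" for i j by (auto simp: isosceles_def)
  qed (simp, simp add: isosceles_def, blast)
  then show ?thesis using that[of Z z] by simp
qed

lemma pairwise_boundedD:
  assumes "pairwise_bounded N D Y y" "i < N" "j < N"
  shows "y i \<in> mm_carrier Y" "ereal (mm_dist Y (y i) (y j)) \<le> D i j"
  using assms unfolding pairwise_bounded_def by blast+

text \<open>An equilateral triangle of side 1 is a member, its double is not: distinct points of the
  double are at distance 2, so the two atoms required at distance at most 1 coincide and give some
  point mass at least 2/3, while every point has mass 1/3.\<close>

lemma Pyr_star_isosceles_infinite: "atom_pyramid 3 (isosceles 1 \<infinity>) \<in> Pyr_star"
proof -
  obtain Z z where Z: "mm_space Z" "mm_carrier Z = z ` {..<3}" "sets (mm_meas Z) = Pow (z ` {..<3})"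
    "\<And>i j. i < 3 \<Longrightarrow> j < 3 \<Longrightarrow> mm_dist Z (z i) (z j) = isosceles 1 1 i j"
    "\<And>A. A \<in> sets (mm_meas Z) \<Longrightarrow> measure (mm_meas Z) A = card {i. i < 3 \<and> z i \<in> A} / 3"
    by (rule isosceles_space[of 1 1]) auto
  have ZP: "Z \<in> atom_pyramid 3 (isosceles 1 \<infinity>)"
    using Z unfolding atom_pyramid_def pairwise_bounded_def
    by (intro CollectI conjI exI[of _ z]) (auto simp: isosceles_def one_ereal_def)
  have inj: "z i = z j \<longleftrightarrow> i = j" if "i < 3" "j < 3" for i j
    using Z(4)[OF that] Z(4)[OF that(1,1)] by (auto simp: isosceles_def split: if_splits)
  have "mm_scale 2 Z \<notin> atom_pyramid 3 (isosceles 1 \<infinity>)"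
  proof
    assume "mm_scale 2 Z \<in> atom_pyramid 3 (isosceles 1 \<infinity>)"
    then obtain y where y: "pairwise_bounded 3 (isosceles 1 \<infinity>) (mm_scale 2 Z) y"
      by (auto simp: atom_pyramid_def)
    obtain k0 k1 where k: "k0 < 3" "k1 < 3" "y 0 = z k0" "y (Suc 0) = z k1"
      using pairwise_boundedD(1)[OF y, of 0 0] pairwise_boundedD(1)[OF y, of "Suc 0" "Suc 0"] by (auto simp: Z(2))
    have "2 * mm_dist Z (y 0) (y (Suc 0)) \<le> 1"
      using pairwise_boundedD(2)[OF y, of 0 "Suc 0"] by (simp add: isosceles_def one_ereal_def)
    then have "k0 = k1" using Z(4)[OF k(1,2)] by (auto simp: k isosceles_def split: if_splits)
    then have y01: "y 0 = z k0" "y (Suc 0) = z k0" using k by auto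
    have zk: "{z k0} \<in> sets (mm_meas Z)" using k(1) by (simp add: Z(3))
    have "card {0, 1 :: nat} \<le> card {i. i < 3 \<and> y i \<in> {z k0}}"
      using y01 by (intro card_mono) auto
    moreover have "measure (mm_meas Z) {z k0} = card {i. i < 3 \<and> y i \<in> {z k0}} / 3"
      using y zk unfolding pairwise_bounded_def by simp
    moreover have "{i. i < 3 \<and> z i \<in> {z k0}} = {k0}" using inj k(1) by auto
    then have "measure (mm_meas Z) {z k0} = 1 / 3" using Z(5)[OF zk] by simp
    ultimately show False by simp
  qed
  then have "mm_scale (1 / (1 / 2)) Z \<notin> atom_pyramid 3 (isosceles 1 \<infinity>)" by simp
  then have "Z \<notin> pyr_scale (1 / 2) (atom_pyramid 3 (isosceles 1 \<infinity>))"
    by (subst in_pyr_scale_iff) auto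
  then have "pyr_scale (1 / 2) (atom_pyramid 3 (isosceles 1 \<infinity>)) \<noteq> atom_pyramid 3 (isosceles 1 \<infinity>)"
    using ZP by metis
  then show ?thesis
    unfolding Pyr_star_iff using pyramid_isosceles[of 1 \<infinity>] by (auto intro!: exI[of _ "1 / 2 :: real"])
qed

text \<open>Two points at distance 1 with masses 2/3 and 1/3 form a member. In its double the three
  atoms, being within distance 1 of each other, would all coincide, and one point would carry all
  the mass.\<close>

lemma Pyr_star_isosceles_degenerate: "atom_pyramid 3 (isosceles 0 1) \<in> Pyr_star"
proof -
  obtain Z z where Z: "mm_space Z" "mm_carrier Z = z ` {..<3}" "sets (mm_meas Z) = Pow (z ` {..<3})"
    "\<And>i j. i < 3 \<Longrightarrow> j < 3 \<Longrightarrow> mm_dist Z (z i) (z j) = isosceles 0 1 i j"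
    "\<And>A. A \<in> sets (mm_meas Z) \<Longrightarrow> measure (mm_meas Z) A = card {i. i < 3 \<and> z i \<in> A} / 3"
    by (rule isosceles_space[of 0 1]) auto
  interpret Z: mm Z by standard (rule Z(1))
  have ZP: "Z \<in> atom_pyramid 3 (isosceles 0 1)"
    using Z unfolding atom_pyramid_def pairwise_bounded_def
    by (intro CollectI conjI exI[of _ z]) (auto simp: isosceles_def one_ereal_def zero_ereal_def)
  have "mm_scale 2 Z \<notin> atom_pyramid 3 (isosceles 0 1)"
  proof
    assume "mm_scale 2 Z \<in> atom_pyramid 3 (isosceles 0 1)"
    then obtain y where y: "pairwise_bounded 3 (isosceles 0 1) (mm_scale 2 Z) y"
      by (auto simp: atom_pyramid_def)
    have yc: "y i \<in> mm_carrier Z" if "i < 3" for i using pairwise_boundedD(1)[OF y that that] by simp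
    have y_const: "y i = y 0" if i: "i < 3" for i
    proof -
      have "ereal (2 * mm_dist Z (y i) (y 0)) \<le> isosceles 0 1 i 0"
        using pairwise_boundedD(2)[OF y i, of 0] by simp
      also have "\<dots> \<le> ereal 1" by (simp add: isosceles_def one_ereal_def zero_ereal_def)
      finally have le: "2 * mm_dist Z (y i) (y 0) \<le> 1" by simp
      obtain k0 k1 where k: "k0 < 3" "k1 < 3" "y i = z k0" "y 0 = z k1"
        using yc[OF i] yc[of 0] by (auto simp: Z(2))
      then have "mm_dist Z (y i) (y 0) = 0"
        using le Z(4)[OF k(1,2)] by (auto simp: isosceles_def split: if_splits)
      then show ?thesis using Z.zero[OF yc[OF i] yc[of 0]] by simp
    qed
    have "{y 0} \<in> sets (mm_meas Z)" using yc[of 0] by (simp add: Z(3) Z(2))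
    then have "measure (mm_meas Z) {y 0} = card {i. i < 3 \<and> y i \<in> {y 0}} / 3"
      using y unfolding pairwise_bounded_def by simp
    also have "{i. i < 3 \<and> y i \<in> {y 0}} = {..<3}" using y_const by blast
    finally have full: "measure (mm_meas Z) {y 0} = 1" by simp
    obtain i where i: "i < 3" "z i \<noteq> y 0"
    proof -
      have "mm_dist Z (z 0) (z 2) \<noteq> 0" using Z(4)[of 0 2] by (simp add: isosceles_def)
      moreover have "z 0 \<in> mm_carrier Z" by (simp add: Z(2))
      ultimately have "z 0 \<noteq> z 2" by auto
      then show ?thesis using that[of 0] that[of 2] by (cases "z 0 = y 0") auto
    qed
    have "{y 0} \<in> sets (mm_meas Z)" using yc[of 0] by (simp add: Z(3) Z(2))
    then have "measure (mm_meas Z) {y 0} = card {i. i < 3 \<and> z i \<in> {y 0}} / 3" by (rule Z(5))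
    moreover have "card {i. i < 3 \<and> z i \<in> {y 0}} < card {..<3 :: nat}"
      using i by (intro psubset_card_mono) auto
    ultimately show False using full by simp
  qed
  then have "mm_scale (1 / (1 / 2)) Z \<notin> atom_pyramid 3 (isosceles 0 1)" by simp
  then have "Z \<notin> pyr_scale (1 / 2) (atom_pyramid 3 (isosceles 0 1))"
    by (subst in_pyr_scale_iff) auto
  then have "pyr_scale (1 / 2) (atom_pyramid 3 (isosceles 0 1)) \<noteq> atom_pyramid 3 (isosceles 0 1)"
    using ZP by metis
  then show ?thesis
    unfolding Pyr_star_iff using pyramid_isosceles[of 0 1] by (auto intro!: exI[of _ "1 / 2 :: real"])
qed

text \<open>The atoms of a member of the limit have finite mutual distances, so it belongs to the
  approximating pyramids as soon as n exceeds these distances.\<close>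

lemma isosceles_conv_infinite:
  "weak_conv (\<lambda>n. atom_pyramid 3 (isosceles (ereal 1) (ereal (real (Suc n))))) (atom_pyramid 3 (isosceles 1 \<infinity>))"
proof (rule atom_pyramid_weak_conv)
  fix Y assume "Y \<in> atom_pyramid 3 (isosceles 1 \<infinity>)"
  then obtain y where y: "mm_space Y" "pairwise_bounded 3 (isosceles 1 \<infinity>) Y y" by (auto simp: atom_pyramid_def)
  interpret Y: mm Y by standard fact
  obtain K :: nat where K: "(\<Sum>i<3. \<Sum>j<3. mm_dist Y (y i) (y j)) < real K" using reals_Archimedean2 by blast
  have bound: "mm_dist Y (y i) (y j) \<le> real K" if "i < 3" "j < 3" for i j
  proof -
    have "mm_dist Y (y i) (y j) \<le> (\<Sum>j<3. mm_dist Y (y i) (y j))" using that by (intro member_le_sum) auto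
    also have "\<dots> \<le> (\<Sum>i<3. \<Sum>j<3. mm_dist Y (y i) (y j))"
      using that by (intro member_le_sum sum_nonneg) auto
    finally show ?thesis using K by simp
  qed
  have "Y \<in> atom_pyramid 3 (isosceles (ereal 1) (ereal (real (Suc n))))" if n: "n \<ge> K" for n
  proof -
    have "ereal (mm_dist Y (y i) (y j)) \<le> isosceles (ereal 1) (ereal (real (Suc n))) i j" if "i < 3" "j < 3" for i j
      using pairwise_boundedD(2)[OF y(2) that] bound[OF that] n
      by (auto simp: isosceles_def one_ereal_def split: if_splits)
    then have "pairwise_bounded 3 (isosceles (ereal 1) (ereal (real (Suc n)))) Y y"
      using y(2) unfolding pairwise_bounded_def by blast
    then show ?thesis using y(1) by (auto simp: atom_pyramid_def)
  qed
  then show "\<forall>\<^sub>F n in sequentially. Y \<in> atom_pyramid 3 (isosceles (ereal 1) (ereal (real (Suc n))))"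
    unfolding eventually_sequentially by blast
qed (auto simp: isosceles_def one_ereal_def zero_ereal_def)

text \<open>Each approximating pyramid contains the limit, and the excess of its bounds over those
  of the limit is at most 1/(n+1).\<close>

lemma isosceles_conv_degenerate:
  "weak_conv (\<lambda>n. atom_pyramid 3 (isosceles (ereal (inverse (real (Suc n)))) (ereal 1))) (atom_pyramid 3 (isosceles 0 1))"
proof (rule atom_pyramid_weak_conv)
  fix Y assume "Y \<in> atom_pyramid 3 (isosceles 0 1)"
  then have "Y \<in> atom_pyramid 3 (isosceles (ereal (inverse (real (Suc n)))) (ereal 1))" for n
    by (rule subsetD[OF atom_pyramid_mono, rotated]) (auto simp: isosceles_def one_ereal_def zero_ereal_def)
  then show "\<forall>\<^sub>F n in sequentially. Y \<in> atom_pyramid 3 (isosceles (ereal (inverse (real (Suc n)))) (ereal 1))"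
    by simp
next
  fix i j :: nat and \<eta> :: real assume "\<eta> > 0"
  then have "\<forall>\<^sub>F n in sequentially. inverse (real (Suc n)) < \<eta>"
    by (rule order_tendstoD(2)[OF LIMSEQ_inverse_real_of_nat])
  then show "\<forall>\<^sub>F n in sequentially. isosceles (ereal (inverse (real (Suc n)))) (ereal 1) i j \<le> isosceles 0 1 i j + ereal \<eta>"
    by eventually_elim (use \<open>\<eta> > 0\<close> in \<open>auto simp: isosceles_def one_ereal_def zero_ereal_def\<close>)
qed (auto simp: isosceles_def one_ereal_def zero_ereal_def)

lemma nontrivial_Pyr: "\<not> trivial_bundle"
proof (rule nontrivial_criterion[OF Pyr_star_isosceles_infinite Pyr_star_isosceles_degenerate])
  show "pyramid (atom_pyramid 3 (isosceles (ereal 1) (ereal (real (Suc n)))))" for n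
    by (rule pyramid_isosceles) auto
  show "0 < inverse (real (Suc n))" for n by simp
  show "(\<lambda>n. inverse (real (Suc n))) \<longlonglongrightarrow> 0" by (rule LIMSEQ_inverse_real_of_nat)
  show "weak_conv (\<lambda>n. atom_pyramid 3 (isosceles (ereal 1) (ereal (real (Suc n))))) (atom_pyramid 3 (isosceles 1 \<infinity>))"
    by (rule isosceles_conv_infinite)
  \<comment> \<open>The factor 1/(n+1) turns the sides 1 and n+1 into 1/(n+1) and 1.\<close>
  show "weak_conv (\<lambda>n. pyr_scale (inverse (real (Suc n))) (atom_pyramid 3 (isosceles (ereal 1) (ereal (real (Suc n))))))
      (atom_pyramid 3 (isosceles 0 1))"
    using isosceles_conv_degenerate by (simp add: isosceles_scale)
qed

theorem theorem1p3:
  shows "principal_bundle \<and> locally_trivial \<and> \<not> trivial_bundle"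
  using principal_bundle_Pyr locally_trivial_Pyr nontrivial_Pyr by blast

end
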